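(* Let $\phi\in\mathcal{G}(\mathbb{R}^{n+1}_+)$, $s_0,s_1\in C^{\log}_{\rm loc}(\mathbb{R}^n)\cap L^\infty(\mathbb{R}^n)$, and let $p_0,p_1\in C^{\log}(\mathbb{R}^n)$ satisfy that, for all $x\in\mathbb{R}^n$, $s_1(x)\le s_0(x)$ and $s_0(x)-\frac n{p_0(x)}=s_1(x)-\frac n{p_1(x)}$. Then $$b^{s_0(\cdot),\phi}_{p_0(\cdot),\infty}(\mathbb{R}^n)\hookrightarrow b^{s_1(\cdot),\phi}_{p_1(\cdot),\infty}(\mathbb{R}^n);$$ moreover, $B^{s_0(\cdot),\phi}_{p_0(\cdot),\infty}(\mathbb{R}^n)\hookrightarrow B^{s_1(\cdot),\phi}_{p_1(\cdot),\infty}(\mathbb{R}^n)$ (continuous embeddings).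
   Context: Cubes. $Q(x,r)$ is the cube with center $x$ and side length $r$, sides parallel to the axes; $c_Q$, $\ell(Q)$ denote center and side length. $\mathcal{Q}$ is the set of dyadic cubes $Q_{jk}:=2^{-j}([0,1)^n+k)$ ($j\in\mathbb{Z}$, $k\in\mathbb{Z}^n$), $\mathcal{Q}^*:=\{Q\in\mathcal{Q}:\ell(Q)\le1\}$, $j_Q:=-\log_2\ell(Q)$, $\widetilde\chi_Q:=|Q|^{-1/2}\chi_Q$, $a\vee b:=\max\{a,b\}$. Variable exponents. $\mathcal{P}(\mathbb{R}^n)$ is the set of measurable $p:\mathbb{R}^n\to(0,\infty]$ with $p_-:=\operatorname{ess\,inf}p>0$. Put $\rho_{p(x)}(t)=t^{p(x)}$ if $p(x)<\infty$, and if $p(x)=\infty$, $\rho_{p(x)}(t)=0$ for $t\le1$, $=\infty$ for $t>1$. $\varrho_{p(\cdot)}(f):=\int_{\mathbb{R}^n}\rho_{p(x)}(|f(x)|)\,dx$ and $\|f\|_{L^{p(\cdot)}(E)}:=\inf\{\lambda>0:\varrho_{p(\cdot)}(f\chi_E/\lambda)\le1\}$. Log-Hölder classes. $g\in C^{\log}_{\rm loc}(\mathbb{R}^n)$ if $|g(x)-g(y)|\le C_{\log}(g)/\log(e+1/|x-y|)$ for all $x,y$; $g\in C^{\log}(\mathbb{R}^n)$ if moreover $|g(x)-g_\infty|\le C_\infty/\log(e+|x|)$ for all $x$ and some constants $g_\infty,C_\infty$. Here $p_0,p_1\in\mathcal{P}(\mathbb{R}^n)$ and $s_0,s_1$ are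 real-valued; an exponent in $C^{\log}$ with essential supremum $\infty$ is identically $\infty$ (this case is allowed, with $1/\infty=0$). Class $\mathcal{G}(\mathbb{R}^{n+1}_+)$, $\mathbb{R}^{n+1}_+:=\mathbb{R}^n\times[0,\infty)$: measurable $\phi:\mathbb{R}^{n+1}_+\to(0,\infty)$ for which there are $c_1,c_2>0$ with $c_1^{-1}\phi(x,2r)\le\phi(x,r)\le c_1\phi(x,2r)$ for all $x\in\mathbb{R}^n$, $r>0$, and $c_2^{-1}\phi(y,r)\le\phi(x,r)\le c_2\phi(y,r)$ whenever $|x-y|\le r$. Write $\phi(Q):=\phi(c_Q,\ell(Q))$. Admissible pairs. $\widehat f(\xi)=\int f(x)e^{-ix\cdot\xi}dx$. $(\varphi,\Phi)$ is admissible if $\varphi,\Phi$ are Schwartz functions, $\operatorname{supp}\widehat\varphi\subset\{1/2\le|\xi|\le2\}$, $|\widehat\varphi|\ge c>0$ on $3/5\le|\xi|\le5/3$, $\operatorname{supp}\widehat\Phi\subset\{|\xi|\le2\}$, $|\widehat\Phi|\ge c>0$ on $|\xi|\le5/3$. $\varphi_j(x):=2^{jn}\varphi(2^jx)$ for $j\ge1$, and $\varphi_0:=\Phi$. Fix an admissible pair. Spaces (case $q\equiv\infty$). $B^{s(\cdot),\phi}_{p(\cdot),\infty}(\mathbb{R}^n)$ is the set of $f\in\mathcal{S}'(\mathbb{R}^n)$ with $$\|f\|_{B^{s(\cdot),\phi}_{p(\cdot),\infty}(\mathbb{R}^n)}:=\sup_{P\in\mathcal{Q}}\frac1{\phi(P)}\sup_{j\ge(j_P\vee0)}\big\|2^{js(\cdot)}|\varphi_j*f|\big\|_{L^{p(\cdot)}(P)}<\infty,$$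 and $b^{s(\cdot),\phi}_{p(\cdot),\infty}(\mathbb{R}^n)$ is the set of complex sequences $t=\{t_Q\}_{Q\in\mathcal{Q}^*}$ with $$\|t\|_{b^{s(\cdot),\phi}_{p(\cdot),\infty}(\mathbb{R}^n)}:=\sup_{P\in\mathcal{Q}}\frac1{\phi(P)}\sup_{j\ge(j_P\vee0)}\Big\|\sum_{Q\in\mathcal{Q}^*,\,Q\subset P,\,\ell(Q)=2^{-j}}|Q|^{-s(\cdot)/n}|t_Q|\widetilde\chi_Q\Big\|_{L^{p(\cdot)}(P)}<\infty.$$ *)

theory Defs
  imports "HOL-Analysis.Analysis"
begin

section \<open>Dyadic cubes\<close>

definition dyadic_cube :: "int \<Rightarrow> int ^ 'n \<Rightarrow> (real ^ 'n) set" where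
  "dyadic_cube j k =
     (\<lambda>y. (2 powi (- j)) *\<^sub>R (y + (\<chi> i. of_int (k $ i)))) ` {y. \<forall>i. 0 \<le> y $ i \<and> y $ i < 1}"

definition dyadic_cubes :: "(real ^ 'n) set set" where
  "dyadic_cubes = {dyadic_cube j k | j k. True}"

text \<open>A dyadic cube determines its index, see \<open>dyadic_index_cube\<close> below.\<close>

definition dyadic_index :: "(real ^ 'n) set \<Rightarrow> int \<times> (int ^ 'n)" where
  "dyadic_index = inv (\<lambda>(j, k). dyadic_cube j k)"

definition cube_level :: "(real ^ 'n) set \<Rightarrow> int" where
  "cube_level Q = fst (dyadic_index Q)"

definition cube_side :: "(real ^ 'n) set \<Rightarrow> real" where
  "cube_side Q = 2 powi (- cube_level Q)"

definition cube_center :: "(real ^ 'n) set \<Rightarrow> real ^ 'n" where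
  "cube_center Q = cube_side Q *\<^sub>R (\<chi> i. of_int (snd (dyadic_index Q) $ i) + 1 / 2)"

definition small_dyadic_cubes :: "(real ^ 'n) set set" where
  "small_dyadic_cubes = {Q \<in> dyadic_cubes. cube_side Q \<le> 1}"

lemma mem_dyadic_cube:
  "x \<in> dyadic_cube j k \<longleftrightarrow>
     (\<forall>i. 2 powi (- j) * of_int (k $ i) \<le> x $ i \<and> x $ i < 2 powi (- j) * (of_int (k $ i) + 1))"
    (is "_ \<longleftrightarrow> ?R")
proof
  assume "x \<in> dyadic_cube j k"
  then obtain y :: "real ^ 'a" where y: "\<forall>i. 0 \<le> y $ i \<and> y $ i < 1"
    and x: "x = (2 powi (- j)) *\<^sub>R (y + (\<chi> i. of_int (k $ i)))"
    unfolding dyadic_cube_def by auto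
  show ?R using y by (auto simp: x)
next
  assume R: ?R
  let ?y = "(2 powi j) *\<^sub>R x - (\<chi> i. of_int (k $ i)) :: real ^ 'a"
  have p: "(2::real) powi j > 0" by simp
  have e: "(2::real) powi j * 2 powi (- j) = 1"
    by (simp add: power_int_minus)
  have "0 \<le> ?y $ i \<and> ?y $ i < 1" for i
  proof -
    have "2 powi j * (2 powi (- j) * of_int (k $ i)) \<le> 2 powi j * x $ i"
      "2 powi j * x $ i < 2 powi j * (2 powi (- j) * (of_int (k $ i) + 1))"
      using R p by (auto intro!: mult_left_mono mult_strict_left_mono)
    then show ?thesis by (simp add: mult.assoc[symmetric] e del: mult_le_cancel_left_pos mult_less_cancel_left_pos)
  qed
  moreover have "x = (2 powi (- j)) *\<^sub>R (?y + (\<chi> i. of_int (k $ i)))"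
    using e by (simp add: mult.commute)
  ultimately show "x \<in> dyadic_cube j k"
    unfolding dyadic_cube_def by blast
qed

lemma two_powi_inject: "(2::real) powi a = 2 powi b \<longleftrightarrow> a = b"
  by (metis linorder_neq_iff one_less_numeral_iff power_int_strict_increasing semiring_norm(76))

lemma dyadic_cube_inject:
  assumes eq: "dyadic_cube j k = dyadic_cube j' k'"
  shows "j = j' \<and> k = k'"
proof -
  have corner: "2 powi (- b) * of_int (l' $ i) \<le> (2 powi (- a) * of_int (l $ i) :: real)"
    and side: "2 powi (- b) * of_int (l' $ i) = (2 powi (- a) * of_int (l $ i) :: real) \<Longrightarrow>
      (2::real) powi (- b) \<le> 2 powi (- a)"
    if "dyadic_cube a l = dyadic_cube b l'" for a b and l l' :: "int ^ 'a" and i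
  proof -
    have "(\<chi> i. 2 powi (- a) * of_int (l $ i)) \<in> dyadic_cube a l"
      by (simp add: mem_dyadic_cube)
    then show "2 powi (- b) * of_int (l' $ i) \<le> (2 powi (- a) * of_int (l $ i) :: real)"
      unfolding that by (simp add: mem_dyadic_cube)
    assume c: "2 powi (- b) * of_int (l' $ i) = (2 powi (- a) * of_int (l $ i) :: real)"
    show "(2::real) powi (- b) \<le> 2 powi (- a)"
    proof (rule ccontr)
      assume n: "\<not> ?thesis"
      let ?z = "\<chi> m. if m = i then 2 powi (- b) * of_int (l' $ m) + 2 powi (- a)
        else 2 powi (- b) * of_int (l' $ m) :: real ^ 'a"
      have "?z \<in> dyadic_cube b l'"
        using n by (auto simp: mem_dyadic_cube algebra_simps)
      then have "?z $ i < 2 powi (- a) * (of_int (l $ i) + 1)"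
        unfolding that[symmetric] mem_dyadic_cube by blast
      then show False using c by (simp add: algebra_simps)
    qed
  qed
  have c: "2 powi (- j) * of_int (k $ i) = (2 powi (- j') * of_int (k' $ i) :: real)" for i
    using corner[OF eq] corner[OF eq[symmetric]] by (metis order_antisym)
  have "(2::real) powi (- j) = 2 powi (- j')"
    using side[OF eq c[symmetric]] side[OF eq[symmetric] c] by linarith
  then have j: "j = j'"
    by (simp add: two_powi_inject)
  with c show ?thesis by (simp add: vec_eq_iff)
qed

lemma dyadic_index_cube [simp]: "dyadic_index (dyadic_cube j k) = (j, k)"
proof -
  have "inj (\<lambda>(j, k). dyadic_cube j k :: (real ^ 'a) set)"
    by (auto intro!: injI dest: dyadic_cube_inject)
  then show ?thesis unfolding dyadic_index_def by (metis case_prod_conv inv_f_f)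
qed

text \<open>In particular the sum in the norm of a sequence below is a finite sum.\<close>

lemma finite_dyadic_subcubes:
  assumes P: "P \<in> dyadic_cubes"
  shows "finite {Q \<in> dyadic_cubes. Q \<subseteq> (P :: (real ^ 'n) set) \<and> cube_side Q = 2 powi (- j)}"
proof -
  obtain a l where Pl: "P = dyadic_cube a l" using P by (auto simp: dyadic_cubes_def)
  let ?I = "\<lambda>i. {k::int. \<bar>k\<bar> \<le> \<lceil>2 powi j * 2 powi (- a) * (\<bar>of_int (l $ i)\<bar> + 1) :: real\<rceil>}"
  let ?K = "{k :: int ^ 'n. \<forall>i. k $ i \<in> ?I i}"
  have fI: "finite (?I i)" for i
    by (rule finite_subset[of _ "{- \<lceil>2 powi j * 2 powi (- a) * (\<bar>of_int (l $ i)\<bar> + 1) :: real\<rceil>..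
      \<lceil>2 powi j * 2 powi (- a) * (\<bar>of_int (l $ i)\<bar> + 1) :: real\<rceil>}"]) auto
  have "finite ((\<lambda>f. \<chi> i. f i) ` (\<Pi>\<^sub>E i\<in>UNIV. ?I i) :: (int ^ 'n) set)"
    by (intro finite_imageI finite_PiE fI) simp
  moreover have "?K \<subseteq> (\<lambda>f. \<chi> i. f i) ` (\<Pi>\<^sub>E i\<in>UNIV. ?I i)"
  proof
    fix k :: "int ^ 'n" assume k: "k \<in> ?K"
    have "k = (\<chi> i. ($) k i)" by simp
    moreover have "($) k \<in> (\<Pi>\<^sub>E i\<in>UNIV. ?I i)" using k by (auto simp: PiE_def)
    ultimately show "k \<in> (\<lambda>f. \<chi> i. f i) ` (\<Pi>\<^sub>E i\<in>UNIV. ?I i)" by (rule image_eqI)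
  qed
  ultimately have fK: "finite ?K" by (rule rev_finite_subset)
  have "{Q \<in> dyadic_cubes. Q \<subseteq> P \<and> cube_side Q = 2 powi (- j)} \<subseteq> dyadic_cube j ` ?K"
  proof
    fix Q assume "Q \<in> {Q \<in> dyadic_cubes. Q \<subseteq> P \<and> cube_side Q = 2 powi (- j)}"
    then obtain b k where Q: "Q = dyadic_cube b k" "Q \<subseteq> P" "cube_side Q = 2 powi (- j)"
      by (auto simp: dyadic_cubes_def)
    then have b: "b = j" by (simp add: cube_side_def cube_level_def two_powi_inject)
    have "(\<chi> i. 2 powi (- j) * of_int (k $ i)) \<in> Q"
      unfolding Q b by (simp add: mem_dyadic_cube)
    with Q(2) have m: "2 powi (- a) * of_int (l $ i) \<le> (2 powi (- j) * of_int (k $ i) :: real)"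
      "2 powi (- j) * of_int (k $ i) < (2 powi (- a) * (of_int (l $ i) + 1) :: real)" for i
      unfolding Pl by (auto simp: mem_dyadic_cube subset_iff)
    have "k $ i \<in> ?I i" for i
    proof -
      have p: "(2::real) powi (- a) > 0" by simp
      have "\<bar>2 powi (- j) * of_int (k $ i) :: real\<bar> \<le> 2 powi (- a) * (\<bar>of_int (l $ i)\<bar> + 1)"
      proof (rule abs_leI)
        have "2 powi (- a) * (of_int (l $ i) + 1) \<le> 2 powi (- a) * (\<bar>of_int (l $ i)\<bar> + 1 :: real)"
          using p by (intro mult_left_mono) auto
        then show "2 powi (- j) * of_int (k $ i) \<le> 2 powi (- a) * (\<bar>of_int (l $ i)\<bar> + 1 :: real)"
          using m(2)[of i] by linarith
        have "2 powi (- a) * (- of_int (l $ i)) \<le> 2 powi (- a) * (\<bar>of_int (l $ i)\<bar> + 1 :: real)"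
          using p by (intro mult_left_mono) auto
        then show "- (2 powi (- j) * of_int (k $ i)) \<le> 2 powi (- a) * (\<bar>of_int (l $ i)\<bar> + 1 :: real)"
          using m(1)[of i] by linarith
      qed
      then have "2 powi j * \<bar>2 powi (- j) * of_int (k $ i) :: real\<bar>
          \<le> 2 powi j * (2 powi (- a) * (\<bar>of_int (l $ i)\<bar> + 1))"
        by (intro mult_left_mono) auto
      moreover have "2 powi j * \<bar>2 powi (- j) * of_int (k $ i) :: real\<bar> = \<bar>of_int (k $ i)\<bar>"
        by (simp add: abs_mult power_int_minus)
      ultimately have "(of_int \<bar>k $ i\<bar> :: real) \<le> 2 powi j * 2 powi (- a) * (\<bar>of_int (l $ i)\<bar> + 1)"
        by (simp add: mult.assoc)
      then show ?thesis by (simp add: le_ceiling_iff)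
    qed
    then show "Q \<in> dyadic_cube j ` ?K" unfolding Q b by auto
  qed
  then show ?thesis using fK by (meson finite_imageI finite_subset)
qed


section \<open>Variable exponents and function classes\<close>

definition essinf :: "'a measure \<Rightarrow> ('a \<Rightarrow> 'b::complete_linorder) \<Rightarrow> 'b" where
  "essinf M f = Liminf (ae_filter M) f"

definition var_exponents :: "(real ^ 'n \<Rightarrow> ennreal) set" where
  "var_exponents =
     {p. p \<in> borel_measurable lebesgue \<and> (\<forall>x. 0 < p x) \<and> 0 < essinf lebesgue p}"

definition rho :: "ennreal \<Rightarrow> real \<Rightarrow> ennreal" where
  "rho p t = (if p = \<infinity> then (if t \<le> 1 then 0 else \<infinity>) else ennreal (t powr enn2real p))"

definition modular :: "(real ^ 'n \<Rightarrow> ennreal) \<Rightarrow> (real ^ 'n \<Rightarrow> real) \<Rightarrow> ennreal" where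
  "modular p f = (\<integral>\<^sup>+ x. rho (p x) \<bar>f x\<bar> \<partial>lebesgue)"

definition Lp_norm :: "(real ^ 'n \<Rightarrow> ennreal) \<Rightarrow> (real ^ 'n) set \<Rightarrow> (real ^ 'n \<Rightarrow> real) \<Rightarrow> ennreal" where
  "Lp_norm p E f = Inf {ennreal l | l. 0 < l \<and> modular p (\<lambda>x. f x * indicator E x / l) \<le> 1}"

definition Clog_loc :: "(real ^ 'n \<Rightarrow> real) set" where
  "Clog_loc = {g. \<exists>C. \<forall>x y. \<bar>g x - g y\<bar> \<le> C / ln (exp 1 + 1 / norm (x - y))}"

definition Clog :: "(real ^ 'n \<Rightarrow> real) set" where
  "Clog = {g \<in> Clog_loc. \<exists>g_inf C. \<forall>x. \<bar>g x - g_inf\<bar> \<le> C / ln (exp 1 + norm x)}"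

text \<open>A member of \<^const>\<open>Clog\<close> is bounded, so an exponent in that class is either real-valued
  or, by convention, identically infinite.\<close>

definition Clog_exponents :: "(real ^ 'n \<Rightarrow> ennreal) set" where
  "Clog_exponents = {p \<in> var_exponents.
     (\<forall>x. p x = \<infinity>) \<or> ((\<forall>x. p x < \<infinity>) \<and> (\<lambda>x. enn2real (p x)) \<in> Clog)}"

definition Linfty :: "(real ^ 'n \<Rightarrow> real) set" where
  "Linfty = {s \<in> borel_measurable lebesgue. \<exists>C. AE x in lebesgue. \<bar>s x\<bar> \<le> C}"

text \<open>Elements live on the closed half space, so the values of \<open>\<phi> x r\<close> for negative \<open>r\<close>
  are irrelevant.\<close>

definition growth_class :: "(real ^ 'n \<Rightarrow> real \<Rightarrow> real) set" where
  "growth_class = {\<phi>.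
     (\<lambda>(x, r). \<phi> x r) \<in> borel_measurable (lebesgue_on (UNIV \<times> {0..})) \<and>
     (\<forall>x. \<forall>r\<ge>0. 0 < \<phi> x r) \<and>
     (\<exists>c1>0. \<forall>x. \<forall>r>0. inverse c1 * \<phi> x (2 * r) \<le> \<phi> x r \<and> \<phi> x r \<le> c1 * \<phi> x (2 * r)) \<and>
     (\<exists>c2>0. \<forall>x y. \<forall>r\<ge>0. norm (x - y) \<le> r \<longrightarrow>
        inverse c2 * \<phi> y r \<le> \<phi> x r \<and> \<phi> x r \<le> c2 * \<phi> y r)}"

definition on_cube :: "(real ^ 'n \<Rightarrow> real \<Rightarrow> real) \<Rightarrow> (real ^ 'n) set \<Rightarrow> real" where
  "on_cube \<phi> Q = \<phi> (cube_center Q) (cube_side Q)"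


section \<open>Schwartz functions and tempered distributions\<close>

definition partial_deriv :: "'n \<Rightarrow> (real ^ 'n \<Rightarrow> complex) \<Rightarrow> real ^ 'n \<Rightarrow> complex" where
  "partial_deriv i f x = frechet_derivative f (at x) (axis i 1)"

text \<open>A multi-index of order \<open>m\<close> is given by a list of \<open>m\<close> coordinate directions.\<close>

primrec partial_derivs :: "'n list \<Rightarrow> (real ^ 'n \<Rightarrow> complex) \<Rightarrow> real ^ 'n \<Rightarrow> complex" where
  "partial_derivs [] f = f"
| "partial_derivs (i # a) f = partial_deriv i (partial_derivs a f)"

definition schwartz :: "(real ^ 'n \<Rightarrow> complex) set" where
  "schwartz = {f.
     (\<forall>a x. partial_derivs a f differentiable (at x)) \<and>
     (\<forall>N a. bdd_above (range (\<lambda>x. (1 + norm x) ^ N * norm (partial_derivs a f x))))}"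

definition schwartz_seminorm :: "nat \<Rightarrow> 'n list \<Rightarrow> (real ^ 'n \<Rightarrow> complex) \<Rightarrow> real" where
  "schwartz_seminorm N a f = (SUP x. (1 + norm x) ^ N * norm (partial_derivs a f x))"

definition schwartz_topology :: "(real ^ 'n \<Rightarrow> complex) topology" where
  "schwartz_topology = topology_generated_by
     {{g \<in> schwartz. schwartz_seminorm N a (\<lambda>x. g x - f x) < e} | f N a e. f \<in> schwartz \<and> 0 < e}"

text \<open>A tempered distribution is a functional on \<^const>\<open>schwartz\<close>; as a total function it is
  fixed to be \<^const>\<open>undefined\<close> elsewhere.\<close>

definition tempered_distributions :: "((real ^ 'n \<Rightarrow> complex) \<Rightarrow> complex) set" where
  "tempered_distributions = {f \<in> extensional schwartz.
     (\<forall>g\<in>schwartz. \<forall>h\<in>schwartz. \<forall>a b. f (\<lambda>x. a * g x + b * h x) = a * f g + b * f h) \<and>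
     continuous_map schwartz_topology euclidean f}"

definition conv :: "(real ^ 'n \<Rightarrow> complex) \<Rightarrow> ((real ^ 'n \<Rightarrow> complex) \<Rightarrow> complex) \<Rightarrow> real ^ 'n \<Rightarrow> complex" where
  "conv g f x = f (\<lambda>y. g (x - y))"

definition fourier :: "(real ^ 'n \<Rightarrow> complex) \<Rightarrow> real ^ 'n \<Rightarrow> complex" where
  "fourier f \<xi> = (\<integral>x. f x * cis (- (x \<bullet> \<xi>)) \<partial>lebesgue)"

definition supp :: "(real ^ 'n \<Rightarrow> complex) \<Rightarrow> (real ^ 'n) set" where
  "supp f = closure {x. f x \<noteq> 0}"

definition admissible :: "(real ^ 'n \<Rightarrow> complex) \<Rightarrow> (real ^ 'n \<Rightarrow> complex) \<Rightarrow> bool" where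
  "admissible \<psi> \<Psi> \<longleftrightarrow>
     \<psi> \<in> schwartz \<and> \<Psi> \<in> schwartz \<and>
     supp (fourier \<psi>) \<subseteq> {\<xi>. 1 / 2 \<le> norm \<xi> \<and> norm \<xi> \<le> 2} \<and>
     (\<exists>c>0. \<forall>\<xi>. 3 / 5 \<le> norm \<xi> \<and> norm \<xi> \<le> 5 / 3 \<longrightarrow> c \<le> norm (fourier \<psi> \<xi>)) \<and>
     supp (fourier \<Psi>) \<subseteq> {\<xi>. norm \<xi> \<le> 2} \<and>
     (\<exists>c>0. \<forall>\<xi>. norm \<xi> \<le> 5 / 3 \<longrightarrow> c \<le> norm (fourier \<Psi> \<xi>))"

definition dilate ::
  "(real ^ 'n \<Rightarrow> complex) \<Rightarrow> (real ^ 'n \<Rightarrow> complex) \<Rightarrow> nat \<Rightarrow> real ^ 'n \<Rightarrow> complex" where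
  "dilate \<psi> \<Psi> j x =
     (if j = 0 then \<Psi> x else complex_of_real (2 ^ (j * CARD('n))) * \<psi> ((2 ^ j) *\<^sub>R x))"


section \<open>The spaces\<close>

definition B_norm ::
  "(real ^ 'n \<Rightarrow> complex) \<Rightarrow> (real ^ 'n \<Rightarrow> complex) \<Rightarrow> (real ^ 'n \<Rightarrow> real) \<Rightarrow>
   (real ^ 'n \<Rightarrow> real \<Rightarrow> real) \<Rightarrow> (real ^ 'n \<Rightarrow> ennreal) \<Rightarrow>
   ((real ^ 'n \<Rightarrow> complex) \<Rightarrow> complex) \<Rightarrow> ennreal" where
  "B_norm \<psi> \<Psi> s \<phi> p f =
     (SUP P\<in>dyadic_cubes. ennreal (1 / on_cube \<phi> P) *
        (SUP j\<in>{nat (max (cube_level P) 0)..}.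
           Lp_norm p P (\<lambda>x. 2 powr (real j * s x) * norm (conv (dilate \<psi> \<Psi> j) f x))))"

definition B_space ::
  "(real ^ 'n \<Rightarrow> complex) \<Rightarrow> (real ^ 'n \<Rightarrow> complex) \<Rightarrow> (real ^ 'n \<Rightarrow> real) \<Rightarrow>
   (real ^ 'n \<Rightarrow> real \<Rightarrow> real) \<Rightarrow> (real ^ 'n \<Rightarrow> ennreal) \<Rightarrow>
   ((real ^ 'n \<Rightarrow> complex) \<Rightarrow> complex) set" where
  "B_space \<psi> \<Psi> s \<phi> p = {f \<in> tempered_distributions. B_norm \<psi> \<Psi> s \<phi> p f < \<infinity>}"

definition normalized_indicator :: "(real ^ 'n) set \<Rightarrow> real ^ 'n \<Rightarrow> real" where
  "normalized_indicator Q x = measure lebesgue Q powr (- 1 / 2) * indicator Q x"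

definition b_norm ::
  "(real ^ 'n \<Rightarrow> real) \<Rightarrow> (real ^ 'n \<Rightarrow> real \<Rightarrow> real) \<Rightarrow> (real ^ 'n \<Rightarrow> ennreal) \<Rightarrow>
   ((real ^ 'n) set \<Rightarrow> complex) \<Rightarrow> ennreal" where
  "b_norm s \<phi> p t =
     (SUP P\<in>dyadic_cubes. ennreal (1 / on_cube \<phi> P) *
        (SUP j\<in>{nat (max (cube_level P) 0)..}.
           Lp_norm p P (\<lambda>x.
             \<Sum>Q\<in>{Q \<in> small_dyadic_cubes. Q \<subseteq> P \<and> cube_side Q = 2 powi (- int j)}.
               measure lebesgue Q powr (- s x / real CARD('n)) * norm (t Q) *
               normalized_indicator Q x)))"

definition b_space ::
  "(real ^ 'n \<Rightarrow> real) \<Rightarrow> (real ^ 'n \<Rightarrow> real \<Rightarrow> real) \<Rightarrow> (real ^ 'n \<Rightarrow> ennreal) \<Rightarrow>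
   ((real ^ 'n) set \<Rightarrow> complex) set" where
  "b_space s \<phi> p = {t \<in> extensional small_dyadic_cubes. b_norm s \<phi> p t < \<infinity>}"

text \<open>Continuous embedding of quasi-normed spaces given by carrier and quasi-norm.\<close>

definition embeds :: "'a set \<Rightarrow> ('a \<Rightarrow> ennreal) \<Rightarrow> 'a set \<Rightarrow> ('a \<Rightarrow> ennreal) \<Rightarrow> bool" where
  "embeds X norm_X Y norm_Y \<longleftrightarrow>
     X \<subseteq> Y \<and> (\<exists>C>0. \<forall>f\<in>X. norm_Y f \<le> ennreal C * norm_X f)"

end

theory Submission
  imports Defs
begin

text \<open>Put \<open>\<sigma> = s0 - n / p0 = s1 - n / p1\<close>. If \<open>A \<ge> 0\<close> satisfies \<open>2 powr (j * \<sigma>) * A \<le> C * l\<close> on a cube, then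
  pointwise \<open>(2 powr (j * s1) * A / (C * l)) powr p1 \<le> (2 powr (j * s0) * A / l) powr p0\<close>, because
  \<open>p0 \<le> p1\<close> and both sides carry the same factor \<open>2 powr (j * n)\<close>. So both embeddings reduce to a
  supremum bound for \<open>2 powr (j * \<sigma>) * A\<close> in terms of the modular of \<open>2 powr (j * s0) * A\<close>.

  For sequences \<open>A\<close> is constant on cubes of side \<open>2 ^ (- j)\<close>, on which \<open>2 powr (j * \<sigma>)\<close> is essentially
  constant by log-Hoelder continuity, and the average over such a cube is bounded by the modular.

  For distributions \<open>A\<close> is the modulus of a band-limited function, which is reproduced by convolution with
  a rapidly decreasing kernel; the Peetre inequality thus bounds \<open>A\<close> by its local \<open>r\<close>-th power means, where \<open>r \<le> min 1 p0\<close>. Neighbouring cubes are compared through the log-Hoelder continuity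
  of \<open>\<sigma>\<close> and the doubling properties of \<open>\<phi>\<close>, at the cost of a polynomial factor.\<close>

section \<open>Integration on Euclidean space\<close>

text \<open>The distribution half carries the difficulty. A value of a band-limited function depends
  on the function everywhere, so the modular on the cube containing a point does not control the
  value there. The hypothesis is therefore used on all cubes of one level at once, normalised by
  \<open>on_cube \<phi> P * N\<close> with a single number \<open>N\<close>. After dilation by
  \<open>2 ^ j\<close> every frequency block has its spectrum in the ball of radius two. One kernel
  then serves all levels, and the constants depend only on data that are fixed in advance: the
  kernel, \<open>\<sigma>\<close>, \<open>\<phi>\<close> and a positive lower bound of
  \<open>p0\<close>. That lower bound may be below one, where plain convolution estimates fail. The
  remedy is to absorb a power of a supremum, which requires this supremum to be finite beforehand. A
  tempered distribution guarantees finiteness only with a weight whose order depends on the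
  distribution. The kernel is an infinite product rather than the transform of a smooth bump: every
  finite stage has an explicit multiplier that equals one on a ball, and this suffices to compute
  convolutions.\<close>

lemma lborel_integral_affine:
  fixes f :: "'a::euclidean_space \<Rightarrow> 'b::{banach, second_countable_topology}"
  assumes [measurable]: "f \<in> borel_measurable borel" and c: "c \<noteq> 0"
  shows "(\<integral>x. f x \<partial>lborel) = \<bar>c\<bar> ^ DIM('a) *\<^sub>R (\<integral>x. f (t + c *\<^sub>R x) \<partial>lborel)"
  by (subst lborel_affine[OF c, of t]) (simp add: integral_density integral_distr)

lemma lborel_integrable_affine:
  fixes f :: "'a::euclidean_space \<Rightarrow> 'b::{banach, second_countable_topology}"
  assumes f: "integrable lborel f" and c: "c \<noteq> 0"
  shows "integrable lborel (\<lambda>x. f (t + c *\<^sub>R x))"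
proof -
  have [measurable]: "f \<in> borel_measurable borel" using f by auto
  have "integrable (density (distr lborel borel (\<lambda>x. t + c *\<^sub>R x)) (\<lambda>_. \<bar>c\<bar> ^ DIM('a))) f"
    using f lborel_affine[OF c, of t] by simp
  then have "integrable lborel (\<lambda>x. \<bar>c\<bar> ^ DIM('a) *\<^sub>R f (t + c *\<^sub>R x))"
    by (simp add: integrable_density integrable_distr_eq)
  then have "integrable lborel (\<lambda>x. (1 / \<bar>c\<bar> ^ DIM('a)) *\<^sub>R (\<bar>c\<bar> ^ DIM('a) *\<^sub>R f (t + c *\<^sub>R x)))"
    by (rule integrable_scaleR_right)
  then show ?thesis using c by simp
qed

lemma lborel_nn_integral_affine:
  fixes f :: "'a::euclidean_space \<Rightarrow> ennreal"
  assumes [measurable]: "f \<in> borel_measurable borel" and c: "c \<noteq> 0"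
  shows "(\<integral>\<^sup>+x. f x \<partial>lborel) = ennreal (\<bar>c\<bar> ^ DIM('a)) * (\<integral>\<^sup>+x. f (t + c *\<^sub>R x) \<partial>lborel)"
  by (subst lborel_affine[OF c, of t])
    (simp add: nn_integral_density nn_integral_distr nn_integral_cmult)

text \<open>Supplies the joint integrability for every exchange of integrals in the construction of
  the kernel: each time a product of functions of separate variables is a majorant.\<close>

lemma integrable_pair_bound:
  fixes F :: "'a::euclidean_space \<times> 'b::euclidean_space \<Rightarrow> 'c::{banach, second_countable_topology}"
  assumes F[measurable]: "F \<in> borel_measurable (lborel \<Otimes>\<^sub>M lborel)"
    and f: "integrable lborel f" and g: "integrable lborel g"
    and le: "\<And>x y. norm (F (x, y)) \<le> norm (f x :: real) * norm (g y :: real)"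
  shows "integrable (lborel \<Otimes>\<^sub>M lborel) F"
proof (rule integrableI_bounded[OF F])
  have [measurable]: "f \<in> borel_measurable borel" "g \<in> borel_measurable borel"
    using f g by auto
  have "(\<integral>\<^sup>+z. norm (F z) \<partial>(lborel \<Otimes>\<^sub>M lborel)) = (\<integral>\<^sup>+x. \<integral>\<^sup>+y. norm (F (x, y)) \<partial>lborel \<partial>lborel)"
    by (subst lborel.nn_integral_fst[symmetric]) auto
  also have "\<dots> \<le> (\<integral>\<^sup>+x. \<integral>\<^sup>+y. ennreal (norm (f x)) * ennreal (norm (g y)) \<partial>lborel \<partial>lborel)"
    by (intro nn_integral_mono) (use le in \<open>simp add: ennreal_mult[symmetric] ennreal_leI\<close>)
  also have "\<dots> = (\<integral>\<^sup>+x. norm (f x) \<partial>lborel) * (\<integral>\<^sup>+y. norm (g y) \<partial>lborel)"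
    by (simp add: nn_integral_cmult nn_integral_multc)
  also have "\<dots> < \<infinity>"
    using f g by (auto simp: integrable_iff_bounded ennreal_mult_less_top)
  finally show "(\<integral>\<^sup>+z. norm (F z) \<partial>(lborel \<Otimes>\<^sub>M lborel)) < \<infinity>" .
qed

text \<open>The least \<open>k\<close> with \<open>t < 2 ^ k\<close> works, since minimality bounds
  \<open>2 ^ (k - 1)\<close> by \<open>t\<close>. It selects the dyadic scale both in the decay
  estimate and when distant cubes are compared.\<close>

lemma ex_power2_between: "0 \<le> (t::real) \<Longrightarrow> \<exists>k. t < 2 ^ k \<and> 2 ^ k \<le> 2 * (1 + t)"
proof -
  assume t: "0 \<le> t"
  define k where "k = (LEAST k. t < 2 ^ k)"
  obtain k0 where "t < 2 ^ k0" using real_arch_pow[of 2 t] by auto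
  then have k: "t < 2 ^ k" unfolding k_def by (rule LeastI)
  have "2 ^ k \<le> 2 * (1 + t)"
  proof (cases k)
    case (Suc l)
    then have "\<not> t < 2 ^ l" using not_less_Least[of l "\<lambda>k. t < 2 ^ k"] unfolding k_def by simp
    then show ?thesis using Suc by simp
  qed (use t in simp)
  with k show ?thesis by blast
qed

lemma suminf_ge_term_ennreal: "f k \<le> (\<Sum>i. f i :: ennreal)"
  using sum_le_suminf[OF summableI finite.insertI[OF finite.emptyI], of k f] by simp

text \<open>A series of indicators of balls of radius \<open>2 ^ k\<close> dominates the function,
  with heights proportional to the \<open>N\<close>-th power of \<open>1 / 2 ^ k\<close>. Volumes
  grow only with the dimension as exponent, so \<open>N > DIM('a)\<close> leaves a convergent
  geometric series.\<close>

lemma integrable_poly_decay: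
  assumes N: "N > DIM('a::euclidean_space)"
  shows "integrable lborel (\<lambda>x::'a. 1 / (1 + norm x) ^ N)"
proof (rule integrableI_bounded)
  let ?V = "unit_ball_vol (real DIM('a))"
  have V: "?V \<ge> 0" by simp
  have [measurable]: "ball 0 ((2::real) ^ k) \<in> sets (borel :: 'a measure)" for k by simp
  let ?b = "\<lambda>k::nat. 2 ^ N * (1 / 2 ^ k) ^ N :: real"
  let ?B = "\<lambda>k::nat. ball 0 (2 ^ k) :: 'a set"
  have pw: "ennreal (1 / (1 + norm x) ^ N) \<le> (\<Sum>k. ennreal (?b k) * indicator (?B k) x)" for x :: 'a
  proof -
    obtain k where k: "norm x < 2 ^ k" "2 ^ k \<le> 2 * (1 + norm x)"
      using ex_power2_between[OF norm_ge_zero] by blast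
    have "2 ^ k / 2 \<le> 1 + norm x" using k(2) by simp
    then have "(2 ^ k / 2) ^ N \<le> (1 + norm x) ^ N" by (intro power_mono) auto
    then have "1 / (1 + norm x) ^ N \<le> 1 / (2 ^ k / 2) ^ N"
      by (intro divide_left_mono) (auto intro!: mult_pos_pos zero_less_power add_pos_nonneg)
    also have "\<dots> = ?b k" by (simp add: power_divide)
    finally have "ennreal (1 / (1 + norm x) ^ N) \<le> ennreal (?b k) * indicator (?B k) x"
      using k(1) by (simp add: ennreal_leI dist_norm)
    also have "\<dots> \<le> (\<Sum>i. ennreal (?b i) * indicator (?B i) x)"
      by (rule suminf_ge_term_ennreal)
    finally show ?thesis .
  qed
  have "(\<integral>\<^sup>+x. ennreal (norm (1 / (1 + norm (x::'a)) ^ N)) \<partial>lborel)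
     \<le> (\<integral>\<^sup>+x. (\<Sum>k. ennreal (?b k) * indicator (?B k) x) \<partial>lborel)"
    using pw by (intro nn_integral_mono) simp
  also have "\<dots> = (\<Sum>k. ennreal (?b k) * emeasure lborel (?B k))"
    by (subst nn_integral_suminf) (simp_all add: nn_integral_cmult_indicator)
  also have "\<dots> = (\<Sum>k. ennreal (2 ^ N * ?V * (1 / 2 ^ (N - DIM('a))) ^ k))"
  proof (intro suminf_cong)
    fix k
    have "ennreal (?b k) * emeasure lborel (?B k) = ennreal (?b k * (?V * (2 ^ k) ^ DIM('a)))"
      by (simp add: emeasure_ball ennreal_mult[symmetric])
    also have "?b k * (?V * (2 ^ k) ^ DIM('a)) = 2 ^ N * ?V * ((1 / 2 ^ k) ^ N * (2 ^ k) ^ DIM('a))"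
      by simp
    also have "(1 / 2 ^ k :: real) ^ N * (2 ^ k) ^ DIM('a) = (1 / 2 ^ k) ^ (N - DIM('a))"
    proof -
      have "(1 / 2 ^ k :: real) ^ N = (1 / 2 ^ k) ^ (N - DIM('a)) * (1 / 2 ^ k) ^ DIM('a)"
        using N by (simp add: power_add[symmetric] del: power_one_over)
      then show ?thesis by (simp add: power_mult_distrib[symmetric] mult.assoc)
    qed
    also have "(1 / 2 ^ k :: real) ^ (N - DIM('a)) = (1 / 2 ^ (N - DIM('a))) ^ k"
      by (simp add: power_divide power_mult[symmetric] mult.commute)
    finally show "ennreal (?b k) * emeasure lborel (?B k) = ennreal (2 ^ N * ?V * (1 / 2 ^ (N - DIM('a))) ^ k)" .
  qed
  also have "\<dots> < \<infinity>"
  proof -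
    have "(1 / 2 ^ (N - DIM('a)) :: real) < 1" using N by (simp add: one_less_power)
    then have "summable (\<lambda>k. 2 ^ N * ?V * (1 / 2 ^ (N - DIM('a)) :: real) ^ k)"
      by (intro summable_mult summable_geometric) simp
    then show ?thesis by (subst suminf_ennreal2) (auto simp: V)
  qed
  finally show "(\<integral>\<^sup>+x. ennreal (norm (1 / (1 + norm (x::'a)) ^ N)) \<partial>lborel) < \<infinity>" .
qed measurable

section \<open>A reproducing kernel for band-limited functions\<close>

text \<open>The Fourier transform of the uniform distribution on the unit interval, that is
  \<open>(cis t - 1) / (\<i> * t)\<close> for \<open>t \<noteq> 0\<close>. The integral form covers
  \<open>t = 0\<close> and is what an average over a segment produces.\<close>

definition sinc_factor :: "real \<Rightarrow> complex" where
  "sinc_factor t = (\<integral>u. indicator {0..1} u *\<^sub>R cis (u * t) \<partial>lborel)"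

lemma integrable_indicator_01: "integrable lborel (indicat_real {0..1::real})"
  by (intro integrable_real_indicator) simp_all

lemma integrable_cis_01: "integrable lborel (\<lambda>u::real. indicator {0..1} u *\<^sub>R cis (u * t))"
  using borel_integrable_compact[of "{0..1}" "\<lambda>u. cis (u * t)"]
  by (simp add: continuous_intros)

lemma norm_sinc_factor_le_1: "norm (sinc_factor t) \<le> 1"
proof -
  have "norm (sinc_factor t) \<le> (\<integral>u. norm (indicator {0..1} u *\<^sub>R cis (u * t)) \<partial>lborel)"
    unfolding sinc_factor_def by (rule integral_norm_bound)
  also have "\<dots> = 1" by simp
  finally show ?thesis .
qed

lemma sinc_factor_eq: "t \<noteq> 0 \<Longrightarrow> sinc_factor t = (cis t - 1) / (\<i> * t)"
proof -
  assume t: "t \<noteq> 0"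
  have "((\<lambda>u. cis (u * t)) has_integral (cis (1 * t) / (\<i> * t) - cis (0 * t) / (\<i> * t))) {0..1}"
  proof (rule fundamental_theorem_of_calculus)
    fix u :: real assume "u \<in> {0..1}"
    show "((\<lambda>u. cis (u * t) / (\<i> * t)) has_vector_derivative cis (u * t)) (at u within {0..1})"
      unfolding has_vector_derivative_def using t
      by (auto intro!: derivative_eq_intros simp: scaleR_conv_of_real field_simps)
  qed simp
  moreover have "(LBINT u:{0..1}. cis (u * t)) = integral {0..1} (\<lambda>u. cis (u * t))"
    using integrable_cis_01[of t] by (intro set_borel_integral_eq_integral) (simp add: set_integrable_def)
  ultimately have "(LBINT u:{0..1}. cis (u * t)) = cis (1 * t) / (\<i> * t) - cis (0 * t) / (\<i> * t)"
    by (simp add: integral_unique)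
  then show ?thesis by (simp add: sinc_factor_def set_lebesgue_integral_def diff_divide_distrib)
qed

lemma norm_sinc_factor_mult_le: "norm (sinc_factor t) * \<bar>t\<bar> \<le> 2"
proof (cases "t = 0")
  case False
  have "norm (cis t - 1) \<le> norm (cis t) + norm (1::complex)" by (rule norm_triangle_ineq4)
  then show ?thesis using False by (simp add: sinc_factor_eq norm_divide norm_mult)
qed simp

lemma norm_cis_minus_1_le: "norm (cis t - 1) \<le> \<bar>t\<bar>"
proof -
  have "norm (cis t - cis 0) \<le> 1 * norm (t - 0)"
    by (rule differentiable_bound[of UNIV _ "\<lambda>x y. y *\<^sub>R (\<i> * cis x)"])
      (auto intro!: derivative_eq_intros onorm_le simp: norm_mult scaleR_conv_of_real)
  then show ?thesis by simp
qed

text \<open>Behaviour near zero: with arguments shrinking geometrically, the factors approach one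
  summably fast, so that their infinite product converges. The bounds by \<open>1\<close> and by
  \<open>2 / \<bar>t\<bar>\<close> serve for boundedness and decay.\<close>

lemma norm_sinc_factor_minus_1: "norm (sinc_factor t - 1) \<le> \<bar>t\<bar>"
proof -
  have 1: "(\<integral>u. indicator {0..1::real} u *\<^sub>R (1::complex) \<partial>lborel) = 1"
    by (subst Bochner_Integration.integral_scaleR_left) (simp_all add: integrable_indicator_01 content_real)
  have i1: "integrable lborel (\<lambda>u::real. indicator {0..1} u *\<^sub>R (1::complex))" by simp
  have "sinc_factor t - 1 = (\<integral>u. indicator {0..1} u *\<^sub>R (cis (u * t) - 1) \<partial>lborel)"
    unfolding sinc_factor_def
    by (subst 1[symmetric], subst Bochner_Integration.integral_diff[symmetric])
      (auto simp: integrable_cis_01 i1 scaleR_diff_right)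
  also have "norm \<dots> \<le> (\<integral>u. indicator {0..1::real} u * \<bar>t\<bar> \<partial>lborel)"
  proof (rule Bochner_Integration.integral_norm_bound_integral)
    show "integrable lborel (\<lambda>u. indicator {0..1} u *\<^sub>R (cis (u * t) - 1))"
      using Bochner_Integration.integrable_diff[OF integrable_cis_01[of t] i1] by (simp add: scaleR_diff_right)
    fix u :: real
    show "norm (indicator {0..1} u *\<^sub>R (cis (u * t) - 1)) \<le> indicator {0..1} u * \<bar>t\<bar>"
      using norm_cis_minus_1_le[of "u * t"]
      mult_left_le_one_le[of "\<bar>t\<bar>" u]
      by (auto simp: indicator_def abs_mult intro: order_trans)
  qed simp
  also have "\<dots> = \<bar>t\<bar>" by simp
  finally show ?thesis .
qed

text \<open>\<open>\<eta>\<close> is the inverse Fourier transform of a cutoff \<open>m\<close>. Averaging \<open>m\<close> over a segment gives \<open>\<eta>\<close> one more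
  order of decay in the direction of the segment, and shrinks the ball on which \<open>m\<close> is one only by the
  length of the segment. Infinitely many averages of summable length yield rapid decay.\<close>

definition cutoff :: "real \<Rightarrow> ('a::euclidean_space \<Rightarrow> complex) \<Rightarrow> bool" where
  "cutoff \<rho> \<eta> \<longleftrightarrow> (\<exists>m R. m \<in> borel_measurable borel \<and> (\<forall>\<xi>. \<bar>m \<xi>\<bar> \<le> (1::real)) \<and>
     (\<forall>\<xi>. norm \<xi> > R \<longrightarrow> m \<xi> = 0) \<and> (\<forall>\<xi>. norm \<xi> \<le> \<rho> \<longrightarrow> m \<xi> = 1) \<and>
     \<eta> = (\<lambda>x. \<integral>\<xi>. m \<xi> *\<^sub>R cis (x \<bullet> \<xi>) \<partial>lborel))"

lemma integrable_indicator_cball: "integrable lborel (indicat_real (cball (a::'a::euclidean_space) R))"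
  using emeasure_bounded_finite[OF bounded_cball] by (intro integrable_real_indicator) simp_all

lemma measurable_cis [measurable]: "cis \<in> borel_measurable borel"
  by (intro borel_measurable_continuous_onI continuous_intros)

lemma cutoff_measurable: "cutoff \<rho> \<eta> \<Longrightarrow> \<eta> \<in> borel_measurable borel"
  by (auto simp: cutoff_def)

lemma cutoff_indicator:
  "cutoff \<rho> (\<lambda>x::'a::euclidean_space. \<integral>\<xi>. indicator (cball 0 \<rho>) \<xi> *\<^sub>R cis (x \<bullet> \<xi>) \<partial>lborel)"
  unfolding cutoff_def
  by (rule exI[of _ "indicator (cball 0 \<rho>)"], rule exI[of _ \<rho>]) 
    (auto intro!: borel_measurable_indicator borel_closed split: split_indicator)

text \<open>Translating \<open>m\<close> by \<open>u *\<^sub>R v\<close> multiplies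
  \<open>\<eta>\<close> by \<open>cis (u * (x \<bullet> v))\<close>. Integrating over
  \<open>u\<close> and exchanging the integrals gives the factor
  \<open>sinc_factor (x \<bullet> v)\<close>.\<close>

lemma cutoff_average:
  assumes "cutoff \<rho> \<eta>"
  shows "cutoff (\<rho> - norm v) (\<lambda>x. \<eta> x * sinc_factor (x \<bullet> v))"
proof -
  obtain m R where m[measurable]: "m \<in> borel_measurable borel" and m1: "\<And>\<xi>. \<bar>m \<xi>\<bar> \<le> (1::real)"
    and mR: "\<And>\<xi>. norm \<xi> > R \<Longrightarrow> m \<xi> = 0" and mr: "\<And>\<xi>. norm \<xi> \<le> \<rho> \<Longrightarrow> m \<xi> = 1"
    and eta: "\<eta> = (\<lambda>x. \<integral>\<xi>. m \<xi> *\<^sub>R cis (x \<bullet> \<xi>) \<partial>lborel)"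
    using assms unfolding cutoff_def by auto
  define m' where "m' \<xi> = (\<integral>u. indicator {0..1::real} u * m (\<xi> - u *\<^sub>R v) \<partial>lborel)" for \<xi>
  have i: "integrable lborel (\<lambda>u::real. indicator {0..1} u * m (\<xi> - u *\<^sub>R v))" for \<xi>
    by (rule Bochner_Integration.integrable_bound[OF integrable_indicator_01])
      (simp_all, simp add: indicator_def m1)
  have nle: "norm (u *\<^sub>R v) \<le> norm v" if "u \<in> {0..1}" for u
    using that by (auto intro: mult_left_le_one_le)
  have 1: "m' \<in> borel_measurable borel" unfolding m'_def by measurable
  have 2: "\<bar>m' \<xi>\<bar> \<le> 1" for \<xi>
  proof -
    have "norm (m' \<xi>) \<le> (\<integral>u. indicator {0..1::real} u \<partial>lborel)"
      unfolding m'_def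
      by (rule Bochner_Integration.integral_norm_bound_integral[OF i integrable_indicator_01])
        (simp add: indicator_def m1)
    then show ?thesis by simp
  qed
  have 3: "m' \<xi> = 0" if "norm \<xi> > R + norm v" for \<xi>
  proof -
    have "indicator {0..1} u * m (\<xi> - u *\<^sub>R v) = 0" for u
      using nle[of u] norm_triangle_ineq2[of \<xi> "u *\<^sub>R v"] that by (auto simp: indicator_def intro!: mR)
    then show ?thesis unfolding m'_def by (simp only: integral_zero)
  qed
  have 4: "m' \<xi> = 1" if "norm \<xi> \<le> \<rho> - norm v" for \<xi>
  proof -
    have "indicator {0..1} u * m (\<xi> - u *\<^sub>R v) = indicator {0..1} u" for u
      using nle[of u] norm_triangle_ineq4[of \<xi> "u *\<^sub>R v"] that by (auto simp: indicator_def intro!: mr)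
    then have "m' \<xi> = (\<integral>u. indicator {0..1::real} u \<partial>lborel)" unfolding m'_def by (simp only:)
    then show ?thesis by (simp add: content_real)
  qed
  have 5: "\<eta> x * sinc_factor (x \<bullet> v) = (\<integral>\<xi>. m' \<xi> *\<^sub>R cis (x \<bullet> \<xi>) \<partial>lborel)" for x
  proof -
    let ?F = "\<lambda>u \<xi>. (indicator {0..1} u * m (\<xi> - u *\<^sub>R v)) *\<^sub>R cis (x \<bullet> \<xi>)"
    have int: "integrable (lborel \<Otimes>\<^sub>M lborel) (case_prod ?F)"
    proof (rule integrable_pair_bound)
      show "integrable lborel (indicat_real {0..1::real})" by (rule integrable_indicator_01)
      show "integrable lborel (indicat_real (cball (0::'a) (R + norm v)))"
        by (rule integrable_indicator_cball)
      fix u \<xi>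
      show "norm (case (u, \<xi>) of (u, \<xi>) \<Rightarrow> ?F u \<xi>) \<le> norm (indicat_real {0..1} u) * norm (indicat_real (cball 0 (R + norm v)) \<xi>)"
      proof (cases "u \<in> {0..1} \<and> norm \<xi> > R + norm v")
        case True
        then have "m (\<xi> - u *\<^sub>R v) = 0"
          using nle[of u] norm_triangle_ineq2[of \<xi> "u *\<^sub>R v"] by (intro mR) linarith
        then show ?thesis by simp
      qed (auto simp: indicator_def m1)
    qed measurable
    have "(\<integral>\<xi>. m' \<xi> *\<^sub>R cis (x \<bullet> \<xi>) \<partial>lborel) = (\<integral>\<xi>. \<integral>u. ?F u \<xi> \<partial>lborel \<partial>lborel)"
      unfolding m'_def by (simp add: i)
    also have "\<dots> = (\<integral>u. \<integral>\<xi>. ?F u \<xi> \<partial>lborel \<partial>lborel)"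
      by (rule lborel_pair.Fubini_integral[OF int])
    also have "\<dots> = (\<integral>u. \<eta> x * (indicator {0..1} u *\<^sub>R cis (u * (x \<bullet> v))) \<partial>lborel)"
    proof (rule Bochner_Integration.integral_cong[OF refl])
      fix u
      have "(\<integral>\<xi>. ?F u \<xi> \<partial>lborel) = (\<integral>\<xi>. ?F u (u *\<^sub>R v + 1 *\<^sub>R \<xi>) \<partial>lborel)"
        by (subst lborel_integral_affine[where c = 1 and t = "u *\<^sub>R v"]) simp_all
      also have "\<dots> = (\<integral>\<xi>. (indicator {0..1} u *\<^sub>R cis (u * (x \<bullet> v))) * (m \<xi> *\<^sub>R cis (x \<bullet> \<xi>)) \<partial>lborel)"
        by (intro Bochner_Integration.integral_cong)
          (simp_all add: inner_add_right cis_mult[symmetric] scaleR_conv_of_real)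
      also have "\<dots> = \<eta> x * (indicator {0..1} u *\<^sub>R cis (u * (x \<bullet> v)))"
        unfolding eta by (subst Bochner_Integration.integral_mult_right_zero) (simp add: mult.commute)
      finally show "(\<integral>\<xi>. ?F u \<xi> \<partial>lborel) = \<eta> x * (indicator {0..1} u *\<^sub>R cis (u * (x \<bullet> v)))" .
    qed
    also have "\<dots> = \<eta> x * sinc_factor (x \<bullet> v)"
      unfolding sinc_factor_def by (simp only: Bochner_Integration.integral_mult_right_zero)
    finally show ?thesis by simp
  qed
  show ?thesis unfolding cutoff_def using 1 2 3 4 5 by blast
qed

section \<open>Fourier transforms and convolution with dilated cutoffs\<close>

lemma fourier_lborel:
  fixes h :: "real ^ 'n \<Rightarrow> complex"
  assumes [measurable]: "h \<in> borel_measurable borel"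
  shows "fourier h \<xi> = (\<integral>x. h x * cis (- (x \<bullet> \<xi>)) \<partial>lborel)"
  unfolding fourier_def by (rule integral_completion) measurable

lemma fourier_measurable [measurable]:
  fixes h :: "real ^ 'n \<Rightarrow> complex"
  assumes [measurable]: "h \<in> borel_measurable borel"
  shows "fourier h \<in> borel_measurable borel"
proof -
  have "fourier h = (\<lambda>\<xi>. \<integral>x. h x * cis (- (x \<bullet> \<xi>)) \<partial>lborel)"
    by (auto simp: fourier_lborel)
  then show ?thesis by simp
qed

lemma fourier_zero_if_supp:
  assumes "supp (fourier h) \<subseteq> {\<xi>. norm \<xi> \<le> 2}" "norm \<xi> > 2"
  shows "fourier h \<xi> = 0"
proof (rule ccontr)
  assume "fourier h \<xi> \<noteq> 0"
  then have "\<xi> \<in> supp (fourier h)" unfolding supp_def using closure_subset[of "{x. fourier h x \<noteq> 0}"] by auto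
  with assms show False by auto
qed

lemma norm_fourier_le:
  fixes h :: "real ^ 'n \<Rightarrow> complex"
  assumes "integrable lborel h"
  shows "norm (fourier h \<xi>) \<le> (\<integral>x. norm (h x) \<partial>lborel)"
  using integral_norm_bound[of lborel "\<lambda>x. h x * cis (- (x \<bullet> \<xi>))"] assms
  by (simp add: fourier_lborel norm_mult)

text \<open>On the Fourier side the dilated kernel acts as multiplication by
  \<open>m (t *\<^sub>R \<xi>)\<close>. This is one wherever \<open>fourier h\<close> can be
  nonzero, because there \<open>norm (t *\<^sub>R \<xi>) \<le> 2 * t \<le> \<rho>\<close>.\<close>

lemma cutoff_conv_scaled:
  fixes h :: "real ^ 'n \<Rightarrow> complex"
  assumes cut: "cutoff \<rho> \<eta>" and "\<rho> \<ge> 2" and h: "integrable lborel h"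
    and supp: "\<And>\<xi>. norm \<xi> > 2 \<Longrightarrow> fourier h \<xi> = 0" and t: "0 < t" "t \<le> 1"
  shows "(\<integral>w. \<eta> w * h (x - t *\<^sub>R w) \<partial>lborel) = (\<integral>\<xi>. cis (x \<bullet> \<xi>) * fourier h \<xi> \<partial>lborel)"
proof -
  obtain m R where m[measurable]: "m \<in> borel_measurable borel" and m1: "\<And>\<xi>. \<bar>m \<xi>\<bar> \<le> (1::real)"
    and mR: "\<And>\<xi>. norm \<xi> > R \<Longrightarrow> m \<xi> = 0" and mr: "\<And>\<xi>. norm \<xi> \<le> \<rho> \<Longrightarrow> m \<xi> = 1"
    and eta: "\<eta> = (\<lambda>x. \<integral>\<xi>. m \<xi> *\<^sub>R cis (x \<bullet> \<xi>) \<partial>lborel)"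
    using cut unfolding cutoff_def by auto
  have [measurable]: "h \<in> borel_measurable borel" using h by auto
  let ?F = "\<lambda>\<xi> w. (m \<xi> *\<^sub>R cis (w \<bullet> \<xi>)) * h (x - t *\<^sub>R w)"
  have hx: "integrable lborel (\<lambda>w. h (x - t *\<^sub>R w))"
    using lborel_integrable_affine[OF h, of "- t" x] t by simp
  have int: "integrable (lborel \<Otimes>\<^sub>M lborel) (case_prod ?F)"
  proof (rule integrable_pair_bound)
    show "integrable lborel (indicat_real (cball (0::real^'n) R))"
      by (rule integrable_indicator_cball)
    show "integrable lborel (\<lambda>w. norm (h (x - t *\<^sub>R w)))"
      using hx by (rule integrable_norm)
    fix \<xi> w
    show "norm (case (\<xi>, w) of (\<xi>, w) \<Rightarrow> ?F \<xi> w) \<le> norm (indicat_real (cball 0 R) \<xi>) * norm (norm (h (x - t *\<^sub>R w)))"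
      using m1[of \<xi>] mR[of \<xi>] by (auto simp: norm_mult indicator_def intro!: mult_left_le_one_le)
  qed measurable
  have "(\<integral>w. \<eta> w * h (x - t *\<^sub>R w) \<partial>lborel) = (\<integral>w. \<integral>\<xi>. ?F \<xi> w \<partial>lborel \<partial>lborel)"
    unfolding eta by (simp only: Bochner_Integration.integral_mult_left_zero)
  also have "\<dots> = (\<integral>\<xi>. \<integral>w. ?F \<xi> w \<partial>lborel \<partial>lborel)"
    by (rule lborel_pair.Fubini_integral[OF int])
  also have "\<dots> = (\<integral>\<xi>. (1 / t) ^ CARD('n) *\<^sub>R (cis (x \<bullet> ((1 / t) *\<^sub>R \<xi>)) * fourier h ((1 / t) *\<^sub>R \<xi>)) \<partial>lborel)"
  proof (rule Bochner_Integration.integral_cong[OF refl])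
    fix \<xi>
    have "(\<integral>w. ?F \<xi> w \<partial>lborel) = (1 / t) ^ CARD('n) *\<^sub>R (\<integral>z. ?F \<xi> ((1 / t) *\<^sub>R x + (- (1 / t)) *\<^sub>R z) \<partial>lborel)"
      using t by (subst lborel_integral_affine[where c = "- (1 / t)" and t = "(1 / t) *\<^sub>R x"]) simp_all
    also have "(\<integral>z. ?F \<xi> ((1 / t) *\<^sub>R x + (- (1 / t)) *\<^sub>R z) \<partial>lborel)
      = (\<integral>z. (m \<xi> *\<^sub>R cis (x \<bullet> ((1 / t) *\<^sub>R \<xi>))) * (h z * cis (- (z \<bullet> ((1 / t) *\<^sub>R \<xi>)))) \<partial>lborel)"
    proof (intro Bochner_Integration.integral_cong refl)
      fix z
      have a: "((1 / t) *\<^sub>R x + (- (1 / t)) *\<^sub>R z) \<bullet> \<xi> = x \<bullet> ((1 / t) *\<^sub>R \<xi>) + - (z \<bullet> ((1 / t) *\<^sub>R \<xi>))"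
        by (simp add: inner_diff_left)
      have b: "x - t *\<^sub>R ((1 / t) *\<^sub>R x + (- (1 / t)) *\<^sub>R z) = z"
        using t by (simp add: algebra_simps)
      show "?F \<xi> ((1 / t) *\<^sub>R x + (- (1 / t)) *\<^sub>R z) = (m \<xi> *\<^sub>R cis (x \<bullet> ((1 / t) *\<^sub>R \<xi>))) * (h z * cis (- (z \<bullet> ((1 / t) *\<^sub>R \<xi>))))"
        unfolding a b cis_mult[symmetric] by simp
    qed
    also have "\<dots> = (m \<xi> *\<^sub>R cis (x \<bullet> ((1 / t) *\<^sub>R \<xi>))) * fourier h ((1 / t) *\<^sub>R \<xi>)"
      by (subst Bochner_Integration.integral_mult_right_zero) (simp add: fourier_lborel)
    also have "\<dots> = cis (x \<bullet> ((1 / t) *\<^sub>R \<xi>)) * fourier h ((1 / t) *\<^sub>R \<xi>)"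
    proof (cases "norm \<xi> \<le> 2")
      case True
      then show ?thesis using mr[of \<xi>] \<open>\<rho> \<ge> 2\<close> by simp
    next
      case False
      then have "2 * t < norm \<xi>" using t by (smt (verit) mult_left_le)
      then have "2 < norm ((1 / t) *\<^sub>R \<xi>)" using t by (simp add: field_simps)
      then show ?thesis using supp by simp
    qed
    finally show "(\<integral>w. ?F \<xi> w \<partial>lborel) = (1 / t) ^ CARD('n) *\<^sub>R (cis (x \<bullet> ((1 / t) *\<^sub>R \<xi>)) * fourier h ((1 / t) *\<^sub>R \<xi>))" .
  qed
  also have "\<dots> = (\<integral>\<xi>. cis (x \<bullet> \<xi>) * fourier h \<xi> \<partial>lborel)"
    using t by (subst (2) lborel_integral_affine[where c = "1 / t" and t = 0]) simp_all
  finally show ?thesis .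
qed

text \<open>The right-hand side of \<open>cutoff_conv_scaled\<close> does not depend on \<open>t\<close>; letting \<open>t\<close> tend to zero
  replaces Fourier inversion.\<close>

lemma cutoff_conv:
  fixes h :: "real ^ 'n \<Rightarrow> complex"
  assumes cut: "cutoff \<rho> \<eta>" "\<rho> \<ge> 2" "integrable lborel \<eta>" and h: "integrable lborel h"
    and cont: "continuous_on UNIV h" and bd: "\<And>x. norm (h x) \<le> B"
    and supp: "\<And>\<xi>. norm \<xi> > 2 \<Longrightarrow> fourier h \<xi> = 0"
  shows "(\<integral>w. \<eta> w * h (x - w) \<partial>lborel) = (\<integral>w. \<eta> w \<partial>lborel) * h x"
    and "(\<integral>\<xi>. cis (x \<bullet> \<xi>) * fourier h \<xi> \<partial>lborel) = (\<integral>w. \<eta> w \<partial>lborel) * h x"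
proof -
  let ?I = "\<integral>\<xi>. cis (x \<bullet> \<xi>) * fourier h \<xi> \<partial>lborel"
  have [measurable]: "h \<in> borel_measurable borel" "\<eta> \<in> borel_measurable borel"
    using h cut(3) by auto
  have "(\<lambda>k. \<integral>w. \<eta> w * h (x - (1 / real (Suc k)) *\<^sub>R w) \<partial>lborel) \<longlonglongrightarrow> (\<integral>w. \<eta> w * h x \<partial>lborel)"
  proof (rule integral_dominated_convergence)
    show "integrable lborel (\<lambda>w. B * norm (\<eta> w))" using cut(3) by simp
    show "AE w in lborel. (\<lambda>k. \<eta> w * h (x - (1 / real (Suc k)) *\<^sub>R w)) \<longlonglongrightarrow> \<eta> w * h x"
    proof (intro AE_I2)
      fix w
      have "(\<lambda>k. x - (1 / real (Suc k)) *\<^sub>R w) \<longlonglongrightarrow> x - 0 *\<^sub>R w"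
        by (intro tendsto_intros LIMSEQ_Suc lim_1_over_n)
      then have "(\<lambda>k. h (x - (1 / real (Suc k)) *\<^sub>R w)) \<longlonglongrightarrow> h x"
        using continuous_on_tendsto_compose[OF cont, of "\<lambda>k. x - (1 / real (Suc k)) *\<^sub>R w" x sequentially]
        by simp
      then show "(\<lambda>k. \<eta> w * h (x - (1 / real (Suc k)) *\<^sub>R w)) \<longlonglongrightarrow> \<eta> w * h x"
        by (intro tendsto_mult_left)
    qed
    show "AE w in lborel. norm (\<eta> w * h (x - (1 / real (Suc k)) *\<^sub>R w)) \<le> B * norm (\<eta> w)" for k
      by (intro AE_I2) (simp add: norm_mult mult.commute[of B] mult_left_mono[OF bd])
  qed simp_all
  moreover have "(\<integral>w. \<eta> w * h (x - (1 / real (Suc k)) *\<^sub>R w) \<partial>lborel) = ?I" for k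
    by (rule cutoff_conv_scaled[OF cut(1,2) h supp]) auto
  ultimately have "(\<lambda>k. ?I) \<longlonglongrightarrow> (\<integral>w. \<eta> w * h x \<partial>lborel)" by (simp only:)
  then have I: "?I = (\<integral>w. \<eta> w \<partial>lborel) * h x"
    using LIMSEQ_unique[OF tendsto_const] by fastforce
  then show "?I = (\<integral>w. \<eta> w \<partial>lborel) * h x" .
  show "(\<integral>w. \<eta> w * h (x - w) \<partial>lborel) = (\<integral>w. \<eta> w \<partial>lborel) * h x"
    using cutoff_conv_scaled[OF cut(1,2) h supp, of 1 x] I by simp
qed

section \<open>Schwartz functions\<close>

lemma schwartz_differentiable: "h \<in> schwartz \<Longrightarrow> partial_derivs a h differentiable (at x)"
  by (simp add: schwartz_def)

lemma schwartz_continuous: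
  assumes "h \<in> schwartz"
  shows "continuous_on UNIV (partial_derivs a h)"
  using schwartz_differentiable[OF assms]
  by (intro continuous_at_imp_continuous_on) (auto intro: differentiable_imp_continuous_within)

lemma schwartz_measurable: "h \<in> schwartz \<Longrightarrow> partial_derivs a h \<in> borel_measurable borel"
  by (intro borel_measurable_continuous_onI schwartz_continuous)

lemma schwartz_bound:
  assumes "h \<in> schwartz"
  obtains C where "0 < C" "\<And>x. (1 + norm x) ^ N * norm (partial_derivs a h x) \<le> C"
proof -
  have "bdd_above (range (\<lambda>x. (1 + norm x) ^ N * norm (partial_derivs a h x)))"
    using assms by (simp add: schwartz_def)
  then obtain B where "\<And>x. (1 + norm x) ^ N * norm (partial_derivs a h x) \<le> B"
    by (auto simp: bdd_above_def)
  then have "(1 + norm x) ^ N * norm (partial_derivs a h x) \<le> max B 1" for x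
    by (meson max.coboundedI1)
  then show ?thesis by (intro that[of "max B 1"]) auto
qed

lemma schwartz_integrable:
  fixes h :: "real ^ 'n \<Rightarrow> complex"
  assumes h: "h \<in> schwartz"
  shows "integrable lborel h"
proof -
  let ?N = "Suc DIM(real^'n)"
  obtain C where C: "0 < C" "\<And>x. (1 + norm x) ^ ?N * norm (partial_derivs [] h x) \<le> C"
    using schwartz_bound[OF h] by blast
  show ?thesis
  proof (rule Bochner_Integration.integrable_bound)
    show "integrable lborel (\<lambda>x::real^'n. C * (1 / (1 + norm x) ^ ?N))"
      by (intro integrable_mult_right integrable_poly_decay) simp
    show "h \<in> borel_measurable lborel" using schwartz_measurable[OF h, of "[]"] by simp
    show "AE x in lborel. norm (h x) \<le> norm (C * (1 / (1 + norm x) ^ ?N))"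
    proof (intro AE_I2)
      fix x :: "real^'n"
      have "0 < (1 + norm x) ^ ?N" by (intro zero_less_power add_pos_nonneg) auto
      then show "norm (h x) \<le> norm (C * (1 / (1 + norm x) ^ ?N))"
        using C(2)[of x] C(1) by (simp add: field_simps abs_of_nonneg del: power_Suc)
    qed
  qed
qed

lemma partial_deriv_affine:
  assumes "k differentiable (at (b + c *\<^sub>R x))"
  shows "partial_deriv i (\<lambda>y. k (b + c *\<^sub>R y)) x = of_real c * partial_deriv i k (b + c *\<^sub>R x)"
proof -
  have k: "(k has_derivative frechet_derivative k (at (b + c *\<^sub>R x))) (at (b + c *\<^sub>R x))"
    using assms frechet_derivative_works by blast
  have "((\<lambda>y. b + c *\<^sub>R y) has_derivative (\<lambda>y. c *\<^sub>R y)) (at x)"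
    by (auto intro!: derivative_eq_intros)
  then have "((\<lambda>y. k (b + c *\<^sub>R y)) has_derivative (\<lambda>y. frechet_derivative k (at (b + c *\<^sub>R x)) (c *\<^sub>R y))) (at x)"
    by (rule has_derivative_compose[where g = k]) (rule k)
  then have "frechet_derivative (\<lambda>y. k (b + c *\<^sub>R y)) (at x) = (\<lambda>y. frechet_derivative k (at (b + c *\<^sub>R x)) (c *\<^sub>R y))"
    by (rule frechet_derivative_at[symmetric])
  moreover have "frechet_derivative k (at (b + c *\<^sub>R x)) (c *\<^sub>R y) = c *\<^sub>R frechet_derivative k (at (b + c *\<^sub>R x)) y" for y
    using has_derivative_linear[OF k] by (rule linear_cmul)
  ultimately show ?thesis unfolding partial_deriv_def by (simp add: scaleR_conv_of_real)
qed

lemma differentiable_affine: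
  assumes "k differentiable (at (b + c *\<^sub>R x))"
  shows "(\<lambda>y. k (b + c *\<^sub>R y)) differentiable (at x)"
proof -
  have "(\<lambda>y. b + c *\<^sub>R y) differentiable (at x)" by (intro derivative_intros)
  from differentiable_chain_at[OF this assms] show ?thesis by (simp add: o_def)
qed

lemma partial_derivs_affine:
  assumes h: "h \<in> schwartz"
  shows "partial_derivs a (\<lambda>y. h (b + c *\<^sub>R y)) = (\<lambda>y. of_real (c ^ length a) * partial_derivs a h (b + c *\<^sub>R y))"
proof (induction a)
  case (Cons i a)
  show ?case
  proof
    fix x
    let ?k = "\<lambda>y. of_real (c ^ length a) * partial_derivs a h y"
    have "?k differentiable (at (b + c *\<^sub>R x))"
      using schwartz_differentiable[OF h] by (intro derivative_intros)
    from partial_deriv_affine[OF this, of i]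
    have "partial_derivs (i # a) (\<lambda>y. h (b + c *\<^sub>R y)) x = of_real c * partial_deriv i ?k (b + c *\<^sub>R x)"
      by (simp add: Cons)
    also have "partial_deriv i ?k (b + c *\<^sub>R x) = of_real (c ^ length a) * partial_derivs (i # a) h (b + c *\<^sub>R x)"
    proof -
      have "(partial_derivs a h has_derivative frechet_derivative (partial_derivs a h) (at (b + c *\<^sub>R x))) (at (b + c *\<^sub>R x))"
        using schwartz_differentiable[OF h] frechet_derivative_works by blast
      then have "(?k has_derivative (\<lambda>y. of_real (c ^ length a) * frechet_derivative (partial_derivs a h) (at (b + c *\<^sub>R x)) y)) (at (b + c *\<^sub>R x))"
        by (rule has_derivative_mult_right)
      then show ?thesis
        unfolding partial_deriv_def partial_derivs.simps by (subst frechet_derivative_at[symmetric]) auto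
    qed
    finally show "partial_derivs (i # a) (\<lambda>y. h (b + c *\<^sub>R y)) x = of_real (c ^ length (i # a)) * partial_derivs (i # a) h (b + c *\<^sub>R x)"
      by (simp add: mult_ac)
  qed
qed simp

lemma one_plus_norm_affine:
  fixes b y :: "'a::real_normed_vector"
  assumes "c \<noteq> 0"
  shows "1 + norm y \<le> (1 + 1 / \<bar>c\<bar>) * ((1 + norm b) * (1 + norm (b + c *\<^sub>R y)))"
proof -
  let ?P = "(1 + norm b) * (1 + norm (b + c *\<^sub>R y))"
  have "norm (c *\<^sub>R y) \<le> norm (b + c *\<^sub>R y) + norm b"
    by (metis add_diff_cancel_left' norm_triangle_ineq4)
  also have "\<dots> \<le> ?P" by (simp add: algebra_simps)
  finally have "norm y \<le> ?P / \<bar>c\<bar>" using assms by (simp add: field_simps)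
  moreover have "1 * 1 \<le> ?P" by (intro mult_mono) auto
  moreover have "(1 + 1 / \<bar>c\<bar>) * ?P = ?P + ?P / \<bar>c\<bar>" by (simp add: distrib_right[of 1])
  ultimately show ?thesis by linarith
qed

text \<open>The translation enters only through the factor \<open>(1 + norm b) ^ N\<close>. This
  uniformity in \<open>b\<close> is what gives convolutions with tempered distributions polynomial
  growth.\<close>

lemma schwartz_affine_bound:
  assumes h: "h \<in> schwartz" and c: "c \<noteq> 0"
  shows "\<exists>C>0. \<forall>b y. (1 + norm y) ^ N * norm (partial_derivs a (\<lambda>y. h (b + c *\<^sub>R y)) y) \<le> C * (1 + norm b) ^ N"
proof -
  obtain D where D: "0 < D" "\<And>x. (1 + norm x) ^ N * norm (partial_derivs a h x) \<le> D"
    using schwartz_bound[OF h] by blast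
  let ?K = "(1 + 1 / \<bar>c\<bar>) ^ N * \<bar>c\<bar> ^ length a"
  have "(1 + norm y) ^ N * norm (partial_derivs a (\<lambda>y. h (b + c *\<^sub>R y)) y) \<le> ?K * D * (1 + norm b) ^ N" for b y
  proof -
    have "(1 + norm y) ^ N * norm (partial_derivs a (\<lambda>y. h (b + c *\<^sub>R y)) y)
      = (1 + norm y) ^ N * (\<bar>c\<bar> ^ length a * norm (partial_derivs a h (b + c *\<^sub>R y)))"
      by (simp add: partial_derivs_affine[OF h] norm_mult norm_power)
    also have "\<dots> \<le> ((1 + 1 / \<bar>c\<bar>) * ((1 + norm b) * (1 + norm (b + c *\<^sub>R y)))) ^ N * (\<bar>c\<bar> ^ length a * norm (partial_derivs a h (b + c *\<^sub>R y)))"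
      by (intro mult_right_mono power_mono one_plus_norm_affine c) auto
    also have "\<dots> = ?K * (1 + norm b) ^ N * ((1 + norm (b + c *\<^sub>R y)) ^ N * norm (partial_derivs a h (b + c *\<^sub>R y)))"
      by (simp add: power_mult_distrib mult_ac)
    also have "\<dots> \<le> ?K * (1 + norm b) ^ N * D"
      by (intro mult_left_mono D) auto
    finally show ?thesis by (simp add: mult_ac)
  qed
  moreover have "?K * D > 0" using D(1) c by (auto intro!: mult_pos_pos zero_less_power add_pos_nonneg)
  ultimately show ?thesis by blast
qed

lemma schwartz_affine:
  assumes h: "h \<in> schwartz" and c: "c \<noteq> 0"
  shows "(\<lambda>y. h (b + c *\<^sub>R y)) \<in> schwartz"
  unfolding schwartz_def
proof (intro CollectI conjI allI)
  show "partial_derivs a (\<lambda>y. h (b + c *\<^sub>R y)) differentiable at x" for a x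
    unfolding partial_derivs_affine[OF h]
    by (intro differentiable_mult differentiable_const differentiable_affine schwartz_differentiable h)
  show "bdd_above (range (\<lambda>x. (1 + norm x) ^ N * norm (partial_derivs a (\<lambda>y. h (b + c *\<^sub>R y)) x)))" for N a
    using schwartz_affine_bound[OF h c, of N a] by (auto simp: bdd_above_def)
qed

lemma partial_derivs_lincomb:
  assumes g: "g \<in> schwartz" and h: "h \<in> schwartz"
  shows "partial_derivs a (\<lambda>x. u * g x + v * h x) = (\<lambda>x. u * partial_derivs a g x + v * partial_derivs a h x)"
proof (induction a)
  case (Cons i a)
  show ?case
  proof
    fix x
    have "((\<lambda>x. u * partial_derivs a g x + v * partial_derivs a h x) has_derivative
      (\<lambda>y. u * frechet_derivative (partial_derivs a g) (at x) y + v * frechet_derivative (partial_derivs a h) (at x) y)) (at x)"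
      using schwartz_differentiable[OF g] schwartz_differentiable[OF h]
      by (intro has_derivative_add has_derivative_mult_right) (auto simp: frechet_derivative_works)
    then show "partial_derivs (i # a) (\<lambda>x. u * g x + v * h x) x = u * partial_derivs (i # a) g x + v * partial_derivs (i # a) h x"
      by (simp add: Cons partial_deriv_def frechet_derivative_at[symmetric])
  qed
qed simp

lemma schwartz_lincomb:
  assumes g: "g \<in> schwartz" and h: "h \<in> schwartz"
  shows "(\<lambda>x. u * g x + v * h x) \<in> schwartz"
  unfolding schwartz_def
proof (intro CollectI conjI allI)
  show "partial_derivs a (\<lambda>x. u * g x + v * h x) differentiable at x" for a x
    unfolding partial_derivs_lincomb[OF g h]
    by (intro derivative_intros schwartz_differentiable g h)
  fix N :: nat and a
  obtain C where C: "0 < C" "\<And>x. (1 + norm x) ^ N * norm (partial_derivs a g x) \<le> C"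
    using schwartz_bound[OF g] by blast
  obtain D where D: "0 < D" "\<And>x. (1 + norm x) ^ N * norm (partial_derivs a h x) \<le> D"
    using schwartz_bound[OF h] by blast
  have "(1 + norm x) ^ N * norm (partial_derivs a (\<lambda>x. u * g x + v * h x) x) \<le> norm u * C + norm v * D" for x
  proof -
    have "(1 + norm x) ^ N * norm (partial_derivs a (\<lambda>x. u * g x + v * h x) x)
      \<le> (1 + norm x) ^ N * (norm u * norm (partial_derivs a g x) + norm v * norm (partial_derivs a h x))"
      unfolding partial_derivs_lincomb[OF g h]
      by (intro mult_left_mono order.trans[OF norm_triangle_ineq]) (auto simp: norm_mult)
    also have "\<dots> = norm u * ((1 + norm x) ^ N * norm (partial_derivs a g x)) + norm v * ((1 + norm x) ^ N * norm (partial_derivs a h x))"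
      by (simp add: algebra_simps)
    also have "\<dots> \<le> norm u * C + norm v * D"
      by (intro add_mono mult_left_mono C D) auto
    finally show ?thesis .
  qed
  then show "bdd_above (range (\<lambda>x. (1 + norm x) ^ N * norm (partial_derivs a (\<lambda>x. u * g x + v * h x) x)))"
    by (auto simp: bdd_above_def)
qed

lemma schwartz_zero: "(\<lambda>x. 0) \<in> schwartz"
proof -
  have "partial_derivs a (\<lambda>x. 0) = (\<lambda>x. 0)" for a :: "'a list"
    by (induction a) (auto simp: partial_deriv_def)
  then show ?thesis unfolding schwartz_def by (auto simp: bdd_above_def)
qed

lemma
  assumes "finite V" and "\<And>v. v \<in> V \<Longrightarrow> h v \<in> schwartz"
  shows schwartz_sum: "(\<lambda>x. \<Sum>v\<in>V. u v * h v x) \<in> schwartz"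
    and partial_derivs_sum: "partial_derivs a (\<lambda>x. \<Sum>v\<in>V. u v * h v x) = (\<lambda>x. \<Sum>v\<in>V. u v * partial_derivs a (h v) x)"
proof -
  have "(\<lambda>x. \<Sum>v\<in>V. u v * h v x) \<in> schwartz \<and>
    partial_derivs a (\<lambda>x. \<Sum>v\<in>V. u v * h v x) = (\<lambda>x. \<Sum>v\<in>V. u v * partial_derivs a (h v) x)"
    using assms
  proof (induction V rule: finite_induct)
    case empty
    have "partial_derivs a (\<lambda>x. 0) = (\<lambda>x. 0)"
      by (induction a) (auto simp: partial_deriv_def)
    then show ?case by (simp add: schwartz_zero)
  next
    case (insert w V)
    then show ?case
      using schwartz_lincomb[of "h w" "\<lambda>x. \<Sum>v\<in>V. u v * h v x" "u w" 1]
        partial_derivs_lincomb[of "h w" "\<lambda>x. \<Sum>v\<in>V. u v * h v x" a "u w" 1]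
      by simp
  qed
  then show "(\<lambda>x. \<Sum>v\<in>V. u v * h v x) \<in> schwartz"
    and "partial_derivs a (\<lambda>x. \<Sum>v\<in>V. u v * h v x) = (\<lambda>x. \<Sum>v\<in>V. u v * partial_derivs a (h v) x)" by auto
qed

section \<open>Existence of the kernel\<close>

lemma cutoff_mono: "cutoff \<rho> \<eta> \<Longrightarrow> \<rho>' \<le> \<rho> \<Longrightarrow> cutoff \<rho>' \<eta>"
  unfolding cutoff_def
proof (elim exE)
  fix m R
  assume "m \<in> borel_measurable borel \<and> (\<forall>\<xi>. \<bar>m \<xi>\<bar> \<le> 1) \<and> (\<forall>\<xi>. norm \<xi> > R \<longrightarrow> m \<xi> = 0) \<and>
    (\<forall>\<xi>. norm \<xi> \<le> \<rho> \<longrightarrow> m \<xi> = 1) \<and> \<eta> = (\<lambda>x. \<integral>\<xi>. m \<xi> *\<^sub>R cis (x \<bullet> \<xi>) \<partial>lborel)" "\<rho>' \<le> \<rho>"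
  then show "\<exists>m R. m \<in> borel_measurable borel \<and> (\<forall>\<xi>. \<bar>m \<xi>\<bar> \<le> 1) \<and> (\<forall>\<xi>. norm \<xi> > R \<longrightarrow> m \<xi> = 0) \<and>
    (\<forall>\<xi>. norm \<xi> \<le> \<rho>' \<longrightarrow> m \<xi> = 1) \<and> \<eta> = (\<lambda>x. \<integral>\<xi>. m \<xi> *\<^sub>R cis (x \<bullet> \<xi>) \<partial>lborel)"
    by (intro exI[of _ m] exI[of _ R]) auto
qed

lemma cutoff_average_Basis:
  fixes \<eta> :: "'a::euclidean_space \<Rightarrow> complex"
  assumes "cutoff \<rho> \<eta>" "r \<ge> 0" "finite I" "I \<subseteq> Basis"
  shows "cutoff (\<rho> - real (card I) * r) (\<lambda>x. \<eta> x * (\<Prod>i\<in>I. sinc_factor (r * (x \<bullet> i))))"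
  using assms(3,4)
proof (induction I rule: finite_induct)
  case empty
  then show ?case using assms(1) by simp
next
  case (insert b I)
  then have "cutoff (\<rho> - real (card I) * r - norm (r *\<^sub>R b)) (\<lambda>x. \<eta> x * (\<Prod>i\<in>I. sinc_factor (r * (x \<bullet> i))) * sinc_factor (x \<bullet> (r *\<^sub>R b)))"
    by (intro cutoff_average) auto
  moreover have "\<rho> - real (card I) * r - norm (r *\<^sub>R b) = \<rho> - real (card (insert b I)) * r"
    using insert assms(2) by (simp add: algebra_simps)
  moreover have "(\<lambda>x. \<eta> x * (\<Prod>i\<in>I. sinc_factor (r * (x \<bullet> i))) * sinc_factor (x \<bullet> (r *\<^sub>R b))) =
    (\<lambda>x. \<eta> x * (\<Prod>i\<in>insert b I. sinc_factor (r * (x \<bullet> i))))"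
    using insert(1,2) by (simp add: mult_ac)
  ultimately show ?case by (simp only:)
qed

text \<open>The inverse transform (up to a constant) of a ball indicator after \<open>K\<close>
  rounds of averaging, round \<open>k\<close> using one segment of length \<open>(1 / 2) ^ k\<close>
  along each basis vector. All directions are needed to get decay in every coordinate.\<close>

definition kernel_approx :: "real \<Rightarrow> nat \<Rightarrow> 'a::euclidean_space \<Rightarrow> complex" where
  "kernel_approx \<rho> K x = (\<integral>\<xi>. indicator (cball 0 \<rho>) \<xi> *\<^sub>R cis (x \<bullet> \<xi>) \<partial>lborel) *
     (\<Prod>k<K. \<Prod>i\<in>Basis. sinc_factor ((1 / 2) ^ k * (x \<bullet> i)))"

text \<open>Each round shrinks the radius by \<open>DIM('a)\<close> times the segment length, and
  the lengths add up to at most two. The starting radius makes up for this total loss, so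
  \<open>\<rho>\<close> is good for every \<open>K\<close>.\<close>

lemma cutoff_kernel_approx:
  "cutoff \<rho> (kernel_approx (\<rho> + 2 * real DIM('a)) K :: 'a::euclidean_space \<Rightarrow> complex)"
proof -
  let ?\<rho> = "\<rho> + 2 * real DIM('a)"
  have "cutoff (?\<rho> - real DIM('a) * (\<Sum>k<K. (1 / 2) ^ k)) (kernel_approx ?\<rho> K :: 'a \<Rightarrow> complex)"
  proof (induction K)
    case 0
    show ?case using cutoff_indicator[of ?\<rho>] by (simp add: kernel_approx_def[abs_def])
  next
    case (Suc K)
    show ?case
      using cutoff_average_Basis[OF Suc, of "(1 / 2) ^ K" Basis]
      by (simp add: kernel_approx_def[abs_def] algebra_simps)
  qed
  moreover have "(\<Sum>k<K. (1 / 2) ^ k :: real) \<le> 2"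
    by (simp add: sum_gp_strict)
  then have "real DIM('a) * (\<Sum>k<K. (1 / 2) ^ k) \<le> real DIM('a) * 2"
    by (intro mult_left_mono) auto
  ultimately show ?thesis by (elim cutoff_mono) simp
qed

text \<open>The factors of the first \<open>M\<close> rounds in one coordinate direction give decay
  of order \<open>M\<close> in that coordinate; all remaining factors are at most one in modulus.
  The constant does not involve \<open>K\<close>, so the bound survives the limit.\<close>

lemma kernel_approx_bound:
  "\<exists>C. \<forall>K\<ge>M. \<forall>x::'a::euclidean_space. (1 + norm x) ^ M * norm (kernel_approx \<rho> K x) \<le> C"
proof -
  let ?n = "real DIM('a)"
  define V where "V = measure lborel (cball (0::'a) \<rho>)"
  \<comment> \<open>Factor \<open>k\<close> is at most
    \<open>2 * 2 ^ k / \<bar>x \<bullet> i\<bar>\<close>, by \<open>norm_sinc_factor_mult_le\<close>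
    at the argument \<open>(1 / 2) ^ k * (x \<bullet> i)\<close>.\<close>
  define D where "D = (\<Prod>k<M. 2 * 2 ^ k :: real)"
  have D: "D \<ge> 0" unfolding D_def by (intro prod_nonneg) auto
  have V: "norm (\<integral>\<xi>. indicator (cball 0 \<rho>) \<xi> *\<^sub>R cis (x \<bullet> \<xi>) \<partial>lborel) \<le> V" for x :: 'a
    unfolding V_def
    using integral_norm_bound[of lborel "\<lambda>\<xi>. indicator (cball 0 \<rho>) \<xi> *\<^sub>R cis (x \<bullet> \<xi>)"] by simp
  have V0: "V \<ge> 0" unfolding V_def by simp
  define P where "P x k = (\<Prod>i\<in>Basis. sinc_factor ((1 / 2) ^ k * (x \<bullet> i)))" for x :: 'a and k :: nat
  have kern: "norm (kernel_approx \<rho> K x) =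
      norm (\<integral>\<xi>. indicator (cball 0 \<rho>) \<xi> *\<^sub>R cis (x \<bullet> \<xi>) \<partial>lborel) * (\<Prod>k<K. norm (P x k))" for K and x :: 'a
    unfolding kernel_approx_def P_def by (simp only: norm_mult prod_norm)
  have Pi: "norm (P x k) \<le> norm (sinc_factor ((1 / 2) ^ k * (x \<bullet> i)))" if "i \<in> Basis" for x i and k :: nat
  proof -
    have "norm (P x k) = norm (sinc_factor ((1 / 2) ^ k * (x \<bullet> i))) * (\<Prod>j\<in>Basis - {i}. norm (sinc_factor ((1 / 2) ^ k * (x \<bullet> j))))"
      unfolding P_def prod.remove[OF finite_Basis that] norm_mult prod_norm ..
    also have "\<dots> \<le> norm (sinc_factor ((1 / 2) ^ k * (x \<bullet> i))) * 1"
      by (intro mult_left_mono prod_le_1) (simp_all add: norm_sinc_factor_le_1)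
    finally show ?thesis by simp
  qed
  have P1: "norm (P x k) \<le> 1" for x k
    using Pi[OF SOME_Basis] norm_sinc_factor_le_1 order_trans by blast
  have A: "norm (kernel_approx \<rho> K x) \<le> V" for K and x :: 'a
  proof -
    have "(\<Prod>k<K. norm (P x k)) \<le> 1" by (intro prod_le_1) (simp add: P1)
    moreover have "0 \<le> (\<Prod>k<K. norm (P x k))" by (intro prod_nonneg) simp
    ultimately show ?thesis unfolding kern
      using mult_mono[OF V[of x] _ V0] by fastforce
  qed
  have B: "norm (kernel_approx \<rho> K x) * \<bar>x \<bullet> i\<bar> ^ M \<le> V * D" if "K \<ge> M" "i \<in> Basis" for K and x i :: 'a
  proof -
    have "(\<Prod>k<K. norm (P x k)) \<le> (\<Prod>k<K. norm (sinc_factor ((1 / 2) ^ k * (x \<bullet> i))))"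
      by (intro prod_mono) (simp add: Pi that(2))
    also have "\<dots> = (\<Prod>k<M. norm (sinc_factor ((1 / 2) ^ k * (x \<bullet> i)))) * (\<Prod>k=M..<K. norm (sinc_factor ((1 / 2) ^ k * (x \<bullet> i))))"
    proof -
      have U: "{..<K} = {..<M} \<union> {M..<K}" using that(1) by auto
      show ?thesis unfolding U by (rule prod.union_disjoint) auto
    qed
    also have "\<dots> \<le> (\<Prod>k<M. norm (sinc_factor ((1 / 2) ^ k * (x \<bullet> i)))) * 1"
      by (intro mult_left_mono prod_le_1 prod_nonneg) (simp_all add: norm_sinc_factor_le_1)
    finally have "(\<Prod>k<K. norm (P x k)) * \<bar>x \<bullet> i\<bar> ^ M
      \<le> (\<Prod>k<M. norm (sinc_factor ((1 / 2) ^ k * (x \<bullet> i)))) * \<bar>x \<bullet> i\<bar> ^ M"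
      by (intro mult_right_mono) auto
    also have "\<dots> = (\<Prod>k<M. norm (sinc_factor ((1 / 2) ^ k * (x \<bullet> i))) * \<bar>x \<bullet> i\<bar>)"
      by (simp add: prod.distrib)
    also have "\<dots> \<le> D" unfolding D_def
    proof (intro prod_mono conjI)
      fix k
      show "norm (sinc_factor ((1 / 2) ^ k * (x \<bullet> i))) * \<bar>x \<bullet> i\<bar> \<le> 2 * 2 ^ k"
        using norm_sinc_factor_mult_le[of "(1 / 2) ^ k * (x \<bullet> i)"]
        by (simp add: abs_mult field_simps power_divide)
    qed auto
    finally have "(\<Prod>k<K. norm (P x k)) * \<bar>x \<bullet> i\<bar> ^ M \<le> D" .
    then show ?thesis unfolding kern mult.assoc
      by (intro mult_mono V V0 mult_nonneg_nonneg prod_nonneg) simp_all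
  qed
  have "(1 + norm x) ^ M * norm (kernel_approx \<rho> K x) \<le> 2 ^ M * (V + ?n ^ M * (V * D))" if K: "K \<ge> M" for K and x :: 'a
  proof -
    \<comment> \<open>A largest coordinate carries at least the share \<open>1 / ?n\<close> of the
      sum of all coordinates, hence of the norm. Decay in this coordinate is decay in
      \<open>norm x\<close>.\<close>
    obtain i where i: "i \<in> Basis" "norm x \<le> ?n * \<bar>x \<bullet> i\<bar>"
    proof -
      have "\<exists>i\<in>Basis. norm x \<le> ?n * \<bar>x \<bullet> i\<bar>"
      proof (rule ccontr)
        assume "\<not> ?thesis"
        then have "(\<Sum>i\<in>(Basis::'a set). ?n * \<bar>x \<bullet> i\<bar>) < (\<Sum>i\<in>(Basis::'a set). norm x)"
          by (intro sum_strict_mono) auto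
        also have "\<dots> = ?n * norm x" by simp
        also have "\<dots> \<le> ?n * (\<Sum>i\<in>Basis. \<bar>x \<bullet> i\<bar>)" by (intro mult_left_mono norm_le_l1) auto
        finally show False by (simp add: sum_distrib_left)
      qed
      then show ?thesis using that by blast
    qed
    have "(1 + norm x) ^ M \<le> (2 * max 1 (norm x)) ^ M" by (intro power_mono) auto
    also have "\<dots> \<le> 2 ^ M * (1 + norm x ^ M)" by (auto simp: power_mult_distrib max_def)
    also have "\<dots> \<le> 2 ^ M * (1 + (?n * \<bar>x \<bullet> i\<bar>) ^ M)"
      by (intro mult_left_mono add_left_mono power_mono i) auto
    finally have "(1 + norm x) ^ M * norm (kernel_approx \<rho> K x) \<le> 2 ^ M * (1 + (?n * \<bar>x \<bullet> i\<bar>) ^ M) * norm (kernel_approx \<rho> K x)"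
      by (intro mult_right_mono) auto
    also have "\<dots> = 2 ^ M * (norm (kernel_approx \<rho> K x) + ?n ^ M * (norm (kernel_approx \<rho> K x) * \<bar>x \<bullet> i\<bar> ^ M))"
      by (simp add: power_mult_distrib algebra_simps)
    also have "\<dots> \<le> 2 ^ M * (V + ?n ^ M * (V * D))"
      by (intro mult_left_mono add_mono A B K i) auto
    finally show ?thesis .
  qed
  then show ?thesis by blast
qed

lemma sinc_factor_prod_convergent: "convergent (\<lambda>K. \<Prod>k<K. sinc_factor ((1 / 2) ^ k * t))"
proof -
  have "summable (\<lambda>k. norm (sinc_factor ((1 / 2) ^ k * t) - 1))"
  proof (rule summable_comparison_test)
    show "summable (\<lambda>k. (1 / 2) ^ k * \<bar>t\<bar>)" by (intro summable_mult2 summable_geometric) simp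
    have "norm (norm (sinc_factor ((1 / 2) ^ n * t) - 1)) \<le> (1 / 2) ^ n * \<bar>t\<bar>" for n
      using norm_sinc_factor_minus_1[of "(1 / 2) ^ n * t"] by (simp add: abs_mult)
    then show "\<exists>N. \<forall>n\<ge>N. norm (norm (sinc_factor ((1 / 2) ^ n * t) - 1)) \<le> (1 / 2) ^ n * \<bar>t\<bar>"
      by blast
  qed
  then have "abs_convergent_prod (\<lambda>k. sinc_factor ((1 / 2) ^ k * t))"
    by (rule summable_imp_abs_convergent_prod)
  then obtain L where "(\<lambda>n. \<Prod>i\<le>n. sinc_factor ((1 / 2) ^ i * t)) \<longlonglongrightarrow> L"
    using convergent_prod_imp_convergent abs_convergent_prod_imp_convergent_prod
    unfolding convergent_def by blast
  then have "(\<lambda>n. \<Prod>i<Suc n. sinc_factor ((1 / 2) ^ i * t)) \<longlonglongrightarrow> L"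
    by (simp only: lessThan_Suc_atMost)
  then have "(\<lambda>K. \<Prod>k<K. sinc_factor ((1 / 2) ^ k * t)) \<longlonglongrightarrow> L"
    by (rule LIMSEQ_imp_Suc)
  then show ?thesis unfolding convergent_def ..
qed

text \<open>Exchanging the two finite products leaves one scalar infinite product for each
  coordinate.\<close>

lemma kernel_approx_convergent: "convergent (\<lambda>K. kernel_approx \<rho> K x)"
proof -
  have "\<exists>L. (\<lambda>K. \<Prod>k<K. sinc_factor ((1 / 2) ^ k * t)) \<longlonglongrightarrow> L" for t
    using sinc_factor_prod_convergent[of t] by (simp add: convergent_def)
  then obtain L where L: "\<And>t. (\<lambda>K. \<Prod>k<K. sinc_factor ((1 / 2) ^ k * t)) \<longlonglongrightarrow> L t" by metis
  have "(\<lambda>K. kernel_approx \<rho> K x) \<longlonglongrightarrow> (\<integral>\<xi>. indicator (cball 0 \<rho>) \<xi> *\<^sub>R cis (x \<bullet> \<xi>) \<partial>lborel) * (\<Prod>i\<in>Basis. L (x \<bullet> i))"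
    unfolding kernel_approx_def
    by (subst prod.swap) (intro tendsto_mult_left tendsto_prod L)
  then show ?thesis by (auto simp: convergent_def)
qed

text \<open>Shows that the integral of \<open>\<eta>\<close> is non-zero and does not depend on \<open>\<eta>\<close>.\<close>

lemma cutoff_Plancherel:
  fixes h \<eta> :: "real ^ 'n \<Rightarrow> complex"
  assumes cut: "cutoff \<rho> \<eta>" "\<rho> \<ge> 2" "integrable lborel \<eta>" and h: "h \<in> schwartz"
    and supp: "\<And>\<xi>. norm \<xi> > 2 \<Longrightarrow> fourier h \<xi> = 0"
  shows "(\<integral>w. \<eta> w \<partial>lborel) * (\<integral>x. of_real ((norm (h x))\<^sup>2) \<partial>lborel) = of_real (\<integral>\<xi>. (norm (fourier h \<xi>))\<^sup>2 \<partial>lborel)"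
proof -
  obtain B where B: "\<And>x. norm (h x) \<le> B" using schwartz_bound[OF h, of 0 "[]"] by auto
  have ih: "integrable lborel h" by (rule schwartz_integrable[OF h])
  have [measurable]: "h \<in> borel_measurable borel" using ih by auto
  have cont: "continuous_on UNIV h" using schwartz_continuous[OF h, of "[]"] by simp
  let ?B = "\<integral>x. norm (h x) \<partial>lborel"
  have [measurable]: "fourier h \<in> borel_measurable borel" by measurable
  have [measurable]: "cnj \<in> borel_measurable borel"
    by (intro borel_measurable_continuous_onI continuous_intros)
  let ?F = "\<lambda>x \<xi>. cnj (h x) * (cis (x \<bullet> \<xi>) * fourier h \<xi>)"
  have int: "integrable (lborel \<Otimes>\<^sub>M lborel) (case_prod ?F)"
  proof (rule integrable_pair_bound)
    show "integrable lborel (\<lambda>x. norm (h x))" using ih by simp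
    show "integrable lborel (\<lambda>\<xi>::real^'n. ?B * indicat_real (cball 0 2) \<xi>)"
      by (intro integrable_mult_right integrable_indicator_cball)
    show "norm (case (x, \<xi>) of (x, \<xi>) \<Rightarrow> ?F x \<xi>) \<le> norm (norm (h x)) * norm (?B * indicat_real (cball 0 2) \<xi>)" for x \<xi>
      using norm_fourier_le[OF ih, of \<xi>] supp[of \<xi>]
      by (auto simp: norm_mult indicator_def intro!: mult_left_mono)
  qed measurable
  have "(\<integral>w. \<eta> w \<partial>lborel) * (\<integral>x. of_real ((norm (h x))\<^sup>2) \<partial>lborel)
     = (\<integral>x. cnj (h x) * ((\<integral>w. \<eta> w \<partial>lborel) * h x) \<partial>lborel)"
    by (subst Bochner_Integration.integral_mult_right_zero[symmetric])
      (simp add: complex_norm_square mult_ac del: of_real_power)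
  \<comment> \<open>Inversion up to the constant
    \<open>\<integral>w. \<eta> w \<partial>lborel\<close>, from \<open>cutoff_conv(2)\<close>,
    applied to the factor \<open>h x\<close> but not to its conjugate.\<close>
  also have "\<dots> = (\<integral>x. (\<integral>\<xi>. ?F x \<xi> \<partial>lborel) \<partial>lborel)"
    using cutoff_conv(2)[OF cut ih cont B supp] by simp
  also have "\<dots> = (\<integral>\<xi>. (\<integral>x. ?F x \<xi> \<partial>lborel) \<partial>lborel)"
    by (rule lborel_pair.Fubini_integral[OF int, symmetric])
  also have "\<dots> = (\<integral>\<xi>. complex_of_real ((norm (fourier h \<xi>))\<^sup>2) \<partial>lborel)"
  proof (rule Bochner_Integration.integral_cong[OF refl])
    fix \<xi>
    have "(\<integral>x. ?F x \<xi> \<partial>lborel) = (\<integral>x. fourier h \<xi> * cnj (h x * cis (- (x \<bullet> \<xi>))) \<partial>lborel)"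
      by (intro Bochner_Integration.integral_cong) (auto simp: cis_cnj)
    also have "\<dots> = fourier h \<xi> * cnj (\<integral>x. h x * cis (- (x \<bullet> \<xi>)) \<partial>lborel)"
      by (simp only: Bochner_Integration.integral_mult_right_zero Bochner_Integration.integral_cnj)
    also have "\<dots> = complex_of_real ((norm (fourier h \<xi>))\<^sup>2)"
      by (simp add: fourier_lborel complex_norm_square[symmetric])
    finally show "(\<integral>x. ?F x \<xi> \<partial>lborel) = complex_of_real ((norm (fourier h \<xi>))\<^sup>2)" .
  qed
  also have "\<dots> = of_real (\<integral>\<xi>. (norm (fourier h \<xi>))\<^sup>2 \<partial>lborel)"
    by (rule integral_complex_of_real)
  finally show ?thesis .
qed

text \<open>With the lower bound that admissibility puts on \<open>\<Psi>\<close> near the origin,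
  this excludes that the normalising constant of the kernel vanishes.\<close>

lemma integral_norm_fourier_sq_pos:
  fixes h :: "real ^ 'n \<Rightarrow> complex"
  assumes h: "integrable lborel h"
    and supp: "\<And>\<xi>. norm \<xi> > 2 \<Longrightarrow> fourier h \<xi> = 0"
    and c: "c > 0" "r > 0" "\<And>\<xi>. norm \<xi> \<le> r \<Longrightarrow> c \<le> norm (fourier h \<xi>)"
  shows "(\<integral>\<xi>. (norm (fourier h \<xi>))\<^sup>2 \<partial>lborel) > 0"
proof -
  have [measurable]: "h \<in> borel_measurable borel" using h by auto
  let ?B = "\<integral>x. norm (h x) \<partial>lborel"
  have "0 < c\<^sup>2 * measure lborel (cball (0::real^'n) r)"
    using c by (simp add: content_cball)
  also have "\<dots> = (\<integral>\<xi>. c\<^sup>2 * indicator (cball (0::real^'n) r) \<xi> \<partial>lborel)" by simp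
  also have "\<dots> \<le> (\<integral>\<xi>. (norm (fourier h \<xi>))\<^sup>2 \<partial>lborel)"
  proof (rule integral_mono)
    show "integrable lborel (\<lambda>\<xi>::real^'n. c\<^sup>2 * indicat_real (cball 0 r) \<xi>)"
      by (intro integrable_mult_right integrable_indicator_cball)
    show "integrable lborel (\<lambda>\<xi>. (norm (fourier h \<xi>))\<^sup>2)"
    proof (rule Bochner_Integration.integrable_bound)
      show "integrable lborel (\<lambda>\<xi>::real^'n. ?B\<^sup>2 * indicat_real (cball 0 2) \<xi>)"
        by (intro integrable_mult_right integrable_indicator_cball)
      show "AE \<xi> in lborel. norm ((norm (fourier h \<xi>))\<^sup>2) \<le> norm (?B\<^sup>2 * indicat_real (cball 0 2) \<xi>)"
        using norm_fourier_le[OF h] supp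
        by (intro AE_I2) (auto simp: indicator_def intro!: power_mono)
    qed measurable
    show "c\<^sup>2 * indicat_real (cball 0 r) \<xi> \<le> (norm (fourier h \<xi>))\<^sup>2" for \<xi>
      using c by (auto simp: indicator_def intro!: power_mono)
  qed
  finally show ?thesis .
qed

lemma poly_decay_integrable:
  fixes \<eta> :: "'a::euclidean_space \<Rightarrow> complex"
  assumes [measurable]: "\<eta> \<in> borel_measurable borel" and N: "N > DIM('a)"
    and C: "\<And>x. (1 + norm x) ^ (N + M) * norm (\<eta> x) \<le> C"
  shows "integrable lborel (\<lambda>x. (1 + norm x) ^ M * norm (\<eta> x))"
proof (rule Bochner_Integration.integrable_bound)
  show "integrable lborel (\<lambda>x::'a. C * (1 / (1 + norm x) ^ N))"
    by (intro integrable_mult_right integrable_poly_decay N)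
  have "0 \<le> (1 + norm (0::'a)) ^ (N + M) * norm (\<eta> 0)" by auto
  with C have C0: "0 \<le> C" using order_trans by blast
  show "AE x in lborel. norm ((1 + norm x) ^ M * norm (\<eta> x)) \<le> norm (C * (1 / (1 + norm x) ^ N))"
  proof (intro AE_I2)
    fix x :: 'a
    have "0 < (1 + norm x) ^ N" by (intro zero_less_power add_pos_nonneg) auto
    then show "norm ((1 + norm x) ^ M * norm (\<eta> x)) \<le> norm (C * (1 / (1 + norm x) ^ N))"
      using C[of x] C0 by (simp add: field_simps power_add)
  qed
qed measurable

text \<open>Decay of every order is demanded because a tempered distribution may have any order of
  growth. The radius \<open>2\<close> is the spectral radius allowed for both functions of an
  admissible pair.\<close>

definition reproducing_kernel :: "(real ^ 'n \<Rightarrow> complex) \<Rightarrow> bool" where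
  "reproducing_kernel \<eta> \<longleftrightarrow> \<eta> \<in> borel_measurable borel \<and>
     (\<forall>N. \<exists>C. \<forall>x. (1 + norm x) ^ N * norm (\<eta> x) \<le> C) \<and>
     (\<forall>h\<in>schwartz. (\<forall>\<xi>. norm \<xi> > 2 \<longrightarrow> fourier h \<xi> = 0) \<longrightarrow> (\<forall>x. (\<integral>w. \<eta> w * h (x - w) \<partial>lborel) = h x))"

text \<open>All approximations of large index reproduce \<open>h\<close> up to one common factor.
  The pointwise limit inherits this by dominated convergence and has decay of every order; division
  by the factor normalises it.\<close>

lemma reproducing_kernel_exists:
  fixes \<psi> \<Psi> :: "real ^ 'n \<Rightarrow> complex"
  assumes adm: "admissible \<psi> \<Psi>"
  shows "\<exists>\<eta> :: real ^ 'n \<Rightarrow> complex. reproducing_kernel \<eta>"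
proof -
  let ?n = "DIM(real^'n)"
  let ?K = "kernel_approx (2 + 2 * real ?n) :: nat \<Rightarrow> real^'n \<Rightarrow> complex"
  have Psi: "\<Psi> \<in> schwartz" using adm by (simp add: admissible_def)
  have suppPsi: "fourier \<Psi> \<xi> = 0" if "norm \<xi> > 2" for \<xi>
    using adm that by (intro fourier_zero_if_supp) (simp_all only: admissible_def)
  have "\<exists>c>0. \<forall>\<xi>. norm \<xi> \<le> 5 / 3 \<longrightarrow> c \<le> norm (fourier \<Psi> \<xi>)" using adm by (simp only: admissible_def)
  then obtain c where c: "c > 0" "\<And>\<xi>. norm \<xi> \<le> 5 / 3 \<Longrightarrow> c \<le> norm (fourier \<Psi> \<xi>)" by auto
  have cut: "cutoff 2 (?K k)" for k by (rule cutoff_kernel_approx)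
  have meas[measurable]: "?K k \<in> borel_measurable borel" for k using cutoff_measurable[OF cut] .
  have "\<exists>C. \<forall>k\<ge>M. \<forall>x. (1 + norm x) ^ M * norm (?K k x) \<le> C" for M by (rule kernel_approx_bound)
  then obtain C where C: "\<And>M k x. k \<ge> M \<Longrightarrow> (1 + norm x) ^ M * norm (?K k x) \<le> C M" by metis
  have int: "integrable lborel (?K k)" if "k \<ge> Suc ?n" for k
  proof -
    have "integrable lborel (\<lambda>x. (1 + norm x) ^ 0 * norm (?K k x))"
      using C[of "Suc ?n" k] that by (intro poly_decay_integrable[of _ "Suc ?n"] meas) auto
    then have "integrable lborel (\<lambda>x. norm (?K k x))" by simp
    then show ?thesis by (rule integrable_norm_cancel) measurable
  qed
  \<comment> \<open>The Plancherel constant, read off from the test function \<open>\<Psi>\<close>.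
    Its value does not matter, only that it is nonzero and common to all approximations.\<close>
  define \<kappa> where "\<kappa> = (\<integral>\<xi>. (norm (fourier \<Psi> \<xi>))\<^sup>2 \<partial>lborel) / (\<integral>x. of_real ((norm (\<Psi> x))\<^sup>2) \<partial>lborel :: complex)"
  have pos: "(\<integral>\<xi>. (norm (fourier \<Psi> \<xi>))\<^sup>2 \<partial>lborel) > 0"
    using c suppPsi schwartz_integrable[OF Psi] by (intro integral_norm_fourier_sq_pos[of _ c "5/3"]) auto
  have kap: "(\<integral>w. ?K k w \<partial>lborel) = \<kappa> \<and> \<kappa> \<noteq> 0" if "k \<ge> Suc ?n" for k
  proof -
    have "(\<integral>w. ?K k w \<partial>lborel) * (\<integral>x. of_real ((norm (\<Psi> x))\<^sup>2) \<partial>lborel) = of_real (\<integral>\<xi>. (norm (fourier \<Psi> \<xi>))\<^sup>2 \<partial>lborel)"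
      by (rule cutoff_Plancherel[OF cut _ int Psi suppPsi]) (use that in auto)
    moreover from this pos have "(\<integral>x. of_real ((norm (\<Psi> x))\<^sup>2) \<partial>lborel :: complex) \<noteq> 0" by auto
    ultimately show ?thesis using pos unfolding \<kappa>_def by (auto simp: field_simps)
  qed
  have "\<exists>L. (\<lambda>k. ?K k x) \<longlonglongrightarrow> L" for x using kernel_approx_convergent[of _ x] by (simp add: convergent_def)
  then obtain L where L: "\<And>x. (\<lambda>k. ?K k x) \<longlonglongrightarrow> L x" by metis
  have [measurable]: "L \<in> borel_measurable borel"
    by (rule borel_measurable_LIMSEQ_metric[OF meas]) (use L in auto)
  have LC: "(1 + norm x) ^ M * norm (L x) \<le> C M" for M x
    using C by (intro LIMSEQ_le_const2[OF tendsto_mult_left[OF tendsto_norm[OF L]]]) auto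
  have rep: "(\<integral>w. L w * h (x - w) \<partial>lborel) = \<kappa> * h x"
    if h: "h \<in> schwartz" and supp: "\<And>\<xi>. norm \<xi> > 2 \<Longrightarrow> fourier h \<xi> = 0" for h x
  proof -
    obtain B where B: "\<And>x. norm (h x) \<le> B" using schwartz_bound[OF h, of 0 "[]"] by auto
    have ih: "integrable lborel h" by (rule schwartz_integrable[OF h])
    have [measurable]: "h \<in> borel_measurable borel" using ih by auto
    have cont: "continuous_on UNIV h" using schwartz_continuous[OF h, of "[]"] by simp
    \<comment> \<open>The shift by \<open>Suc ?n\<close> skips the approximations that have too few
      factors for a common integrable majorant.\<close>
    let ?f = "\<lambda>k. \<integral>w. ?K (k + Suc ?n) w * h (x - w) \<partial>lborel"
    have "?f k = \<kappa> * h x" for k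
      using kap[of "k + Suc ?n"]
      by (subst cutoff_conv(1)[OF cut _ int ih cont B supp]) auto
    moreover have "?f \<longlonglongrightarrow> (\<integral>w. L w * h (x - w) \<partial>lborel)"
    proof (rule integral_dominated_convergence)
      show "integrable lborel (\<lambda>w::real^'n. C (Suc ?n) * (1 / (1 + norm w) ^ Suc ?n) * B)"
        by (intro integrable_mult_left integrable_mult_right integrable_poly_decay) auto
      show "AE w in lborel. (\<lambda>k. ?K (k + Suc ?n) w * h (x - w)) \<longlonglongrightarrow> L w * h (x - w)"
        using LIMSEQ_ignore_initial_segment[OF L, of "Suc ?n"]
        by (intro AE_I2 tendsto_mult_right)
      show "AE w in lborel. norm (?K (k + Suc ?n) w * h (x - w)) \<le> C (Suc ?n) * (1 / (1 + norm w) ^ Suc ?n) * B" for k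
      proof (intro AE_I2)
        fix w :: "real^'n"
        have p: "0 < (1 + norm w) ^ Suc ?n" by (intro zero_less_power add_pos_nonneg) auto
        have "norm (?K (k + Suc ?n) w) \<le> C (Suc ?n) * (1 / (1 + norm w) ^ Suc ?n)"
          using C[of "Suc ?n" "k + Suc ?n" w] p by (simp add: field_simps)
        then show "norm (?K (k + Suc ?n) w * h (x - w)) \<le> C (Suc ?n) * (1 / (1 + norm w) ^ Suc ?n) * B"
          unfolding norm_mult using B[of "x - w"]
          by (intro mult_mono) (auto intro: order_trans[OF norm_ge_zero])
      qed
    qed measurable
    ultimately have "(\<lambda>k::nat. \<kappa> * h x) \<longlonglongrightarrow> (\<integral>w. L w * h (x - w) \<partial>lborel)" by (simp only:)
    then show ?thesis using LIMSEQ_unique[OF tendsto_const] by fastforce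
  qed
  have k0: "\<kappa> \<noteq> 0" using kap by blast
  have "reproducing_kernel (\<lambda>x. L x / \<kappa>)"
    unfolding reproducing_kernel_def
  proof (intro conjI allI ballI impI)
    show "\<exists>B. \<forall>x. (1 + norm x) ^ N * norm (L x / \<kappa>) \<le> B" for N
      using LC[of _ N] k0 by (intro exI[of _ "C N / norm \<kappa>"]) (simp add: norm_divide divide_right_mono)
    fix h :: "real^'n \<Rightarrow> complex" and x assume "h \<in> schwartz" "\<forall>\<xi>. 2 < norm \<xi> \<longrightarrow> fourier h \<xi> = 0"
    then show "(\<integral>w. L w / \<kappa> * h (x - w) \<partial>lborel) = h x"
      using rep[of h x] k0 by simp
  qed measurable
  then show ?thesis by blast
qed

section \<open>Weighted increments of Schwartz functions\<close>

lemma differentiable_increment_bound: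
  fixes k :: "real ^ 'n \<Rightarrow> complex"
  assumes k: "\<And>x. k differentiable (at x)"
    and B: "\<And>x. x \<in> cball Y 1 \<Longrightarrow> (\<Sum>i\<in>UNIV. norm (partial_deriv i k x)) \<le> B"
    and V: "norm V \<le> 1"
  shows "norm (k (Y + V) - k Y) \<le> B * norm V"
proof -
  have "norm (k (Y + V) - k Y) \<le> B * norm (Y + V - Y)"
  proof (rule differentiable_bound[of "cball Y 1" k "\<lambda>x. frechet_derivative k (at x)"])
    show "(k has_derivative frechet_derivative k (at x)) (at x within cball Y 1)" for x
      using k frechet_derivative_works has_derivative_at_withinI by blast
    show "onorm (frechet_derivative k (at x)) \<le> B" if x: "x \<in> cball Y 1" for x
    proof (rule onorm_le)
      fix v :: "real^'n"
      have lin: "linear (frechet_derivative k (at x))"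
        using k linear_frechet_derivative by blast
      have "v = (\<Sum>i\<in>UNIV. (v $ i) *\<^sub>R axis i 1)"
        using basis_expansion[of v] by (simp add: scalar_mult_eq_scaleR)
      then have "frechet_derivative k (at x) v = (\<Sum>i\<in>UNIV. (v $ i) *\<^sub>R partial_deriv i k x)"
        using linear_sum[OF lin] linear_cmul[OF lin] unfolding partial_deriv_def by (metis (no_types, lifting) sum.cong)
      also have "norm \<dots> \<le> (\<Sum>i\<in>UNIV. norm v * norm (partial_deriv i k x))"
        by (intro order_trans[OF norm_sum] sum_mono) (simp add: component_le_norm_cart mult_right_mono)
      also have "\<dots> \<le> B * norm v"
        using mult_left_mono[OF B[OF x], of "norm v"] by (simp add: sum_distrib_left[symmetric] mult.commute)
      finally show "norm (frechet_derivative k (at x) v) \<le> B * norm v" .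
    qed
  qed (use V in \<open>auto simp: dist_norm\<close>)
  then show ?thesis by simp
qed

text \<open>Mean value inequality on the unit ball around \<open>Y\<close>. There
  \<open>1 + norm Y \<le> 2 * (1 + norm x)\<close>, which lets the weight pass to the point where
  the derivative is taken and costs \<open>2 ^ N\<close>.\<close>

lemma schwartz_increment_bound:
  fixes h :: "real ^ 'n \<Rightarrow> complex"
  assumes h: "h \<in> schwartz"
  shows "\<exists>D>0. \<forall>Y V. norm V \<le> 1 \<longrightarrow> (1 + norm Y) ^ N * norm (partial_derivs a h (Y + V) - partial_derivs a h Y) \<le> D * norm V"
proof -
  have "\<exists>C. \<forall>x. (1 + norm x) ^ N * norm (partial_derivs (i # a) h x) \<le> C" for i
    using schwartz_bound[OF h] by metis
  then obtain C where C: "\<And>i x. (1 + norm x) ^ N * norm (partial_derivs (i # a) h x) \<le> C i" by metis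
  define D where "D = 2 ^ N * (\<Sum>i\<in>UNIV. \<bar>C i\<bar>) + 1"
  have D: "D > 0" unfolding D_def by (intro add_nonneg_pos mult_nonneg_nonneg sum_nonneg) auto
  have "(1 + norm Y) ^ N * norm (partial_derivs a h (Y + V) - partial_derivs a h Y) \<le> D * norm V"
    if V: "norm V \<le> 1" for Y V
  proof -
    let ?P = "(1 + norm Y) ^ N"
    have P: "?P > 0" by (intro zero_less_power add_pos_nonneg) auto
    have "norm (partial_derivs a h (Y + V) - partial_derivs a h Y) \<le> D / ?P * norm V"
    proof (rule differentiable_increment_bound[OF schwartz_differentiable[OF h] _ V])
      fix x assume x: "x \<in> cball Y 1"
      have "norm Y \<le> norm x + norm (Y - x)" by (metis add.commute norm_triangle_sub)
      then have "1 + norm Y \<le> 2 * (1 + norm x)" proof -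
        have "norm (Y - x) \<le> 1" using x by (simp add: dist_norm)
        moreover have "0 \<le> norm x" by simp
        ultimately show ?thesis using \<open>norm Y \<le> norm x + norm (Y - x)\<close> by argo
      qed
      then have P2: "?P \<le> 2 ^ N * (1 + norm x) ^ N"
        unfolding power_mult_distrib[symmetric] by (intro power_mono) auto
      have "?P * (\<Sum>i\<in>UNIV. norm (partial_deriv i (partial_derivs a h) x)) \<le>
          2 ^ N * (1 + norm x) ^ N * (\<Sum>i\<in>UNIV. norm (partial_deriv i (partial_derivs a h) x))"
        by (intro mult_right_mono P2 sum_nonneg) auto
      also have "\<dots> = 2 ^ N * (\<Sum>i\<in>UNIV. (1 + norm x) ^ N * norm (partial_derivs (i # a) h x))"
        by (simp add: sum_distrib_left mult.assoc)
      also have "\<dots> \<le> 2 ^ N * (\<Sum>i\<in>UNIV. \<bar>C i\<bar>)"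
        by (intro mult_left_mono sum_mono order_trans[OF C]) auto
      also have "\<dots> \<le> D" unfolding D_def by simp
      finally show "(\<Sum>i\<in>UNIV. norm (partial_deriv i (partial_derivs a h) x)) \<le> D / ?P"
        using P by (simp add: field_simps)
    qed
    then show ?thesis using P by (simp add: field_simps)
  qed
  with D show ?thesis by blast
qed

text \<open>Close points are handled by the increment bound, distant ones by decay of both terms;
  the minimum with one joins the cases. The range of \<open>q\<close> covers simple functions with
  \<open>norm (s m w) \<le> 2 * norm w\<close> as well as small shifts away from
  \<open>v = 0\<close>.\<close>

lemma schwartz_affine_increment_bound:
  fixes h :: "real ^ 'n \<Rightarrow> complex"
  assumes h: "h \<in> schwartz" and c: "c \<noteq> 0"
  shows "\<exists>D>0. \<forall>v q y. norm q \<le> 2 * norm v + 1 \<longrightarrow>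
    (1 + norm y) ^ N * norm (partial_derivs a h (X - v + c *\<^sub>R y) - partial_derivs a h (X - q + c *\<^sub>R y))
      \<le> D * (min 1 (norm (v - q)) * (1 + norm v) ^ N)"
proof -
  let ?k = "partial_derivs a h" and ?K = "1 + 1 / \<bar>c\<bar>"
  obtain D where D: "0 < D" "\<And>Y V. norm V \<le> 1 \<Longrightarrow> (1 + norm Y) ^ N * norm (?k (Y + V) - ?k Y) \<le> D * norm V"
    using schwartz_increment_bound[OF h] by blast
  obtain E where E: "0 < E" "\<And>x. (1 + norm x) ^ N * norm (?k x) \<le> E"
    using schwartz_bound[OF h] by blast
  have K: "?K > 0" using c by (simp add: add_pos_nonneg)
  define L where "L = (?K * (2 * (1 + norm X))) ^ N"
  have L: "L > 0" unfolding L_def using K by (intro zero_less_power mult_pos_pos add_pos_nonneg) auto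
  have w: "(1 + norm y) ^ N \<le> L * (1 + norm v) ^ N * (1 + norm (X - q + c *\<^sub>R y)) ^ N"
    if "norm q \<le> 2 * norm v + 1" for y v q
  proof -
    have "1 + norm y \<le> ?K * ((1 + norm (X - q)) * (1 + norm (X - q + c *\<^sub>R y)))"
      by (rule one_plus_norm_affine[OF c])
    also have "\<dots> \<le> ?K * ((2 * (1 + norm X) * (1 + norm v)) * (1 + norm (X - q + c *\<^sub>R y)))"
    proof (intro mult_left_mono mult_right_mono)
      have "1 + norm (X - q) \<le> 1 + (norm X + (2 * norm v + 1))"
        using norm_triangle_ineq4[of X q] that by linarith
      also have "\<dots> \<le> 2 * (1 + norm X) * (1 + norm v)" by (simp add: algebra_simps)
      finally show "1 + norm (X - q) \<le> 2 * (1 + norm X) * (1 + norm v)" .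
    qed (use K in auto)
    finally have "(1 + norm y) ^ N \<le> (?K * ((2 * (1 + norm X) * (1 + norm v)) * (1 + norm (X - q + c *\<^sub>R y)))) ^ N"
      by (intro power_mono) auto
    then show ?thesis unfolding L_def by (simp add: power_mult_distrib mult_ac)
  qed
  have "(1 + norm y) ^ N * norm (?k (X - v + c *\<^sub>R y) - ?k (X - q + c *\<^sub>R y))
      \<le> L * (D + 2 * E) * (min 1 (norm (v - q)) * (1 + norm v) ^ N)" if q: "norm q \<le> 2 * norm v + 1" for v q y
  proof (cases "norm (v - q) \<le> 1")
    case True
    let ?Y = "X - q + c *\<^sub>R y"
    have e: "X - v + c *\<^sub>R y = ?Y + (q - v)" by simp
    have "(1 + norm y) ^ N * norm (?k (?Y + (q - v)) - ?k ?Y)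
      \<le> L * (1 + norm v) ^ N * (1 + norm ?Y) ^ N * norm (?k (?Y + (q - v)) - ?k ?Y)"
      by (intro mult_right_mono w q) auto
    also have "\<dots> = L * (1 + norm v) ^ N * ((1 + norm ?Y) ^ N * norm (?k (?Y + (q - v)) - ?k ?Y))"
      by simp
    also have "\<dots> \<le> L * (1 + norm v) ^ N * (D * norm (q - v))"
      using True L by (intro mult_left_mono D) (auto simp: norm_minus_commute)
    also have "\<dots> \<le> L * (1 + norm v) ^ N * ((D + 2 * E) * norm (q - v))"
      using E(1) L by (intro mult_left_mono mult_right_mono) auto
    finally show ?thesis using True unfolding e by (simp add: norm_minus_commute mult_ac)
  next
    case False
    have t: "(1 + norm y) ^ N * norm (?k (X - q' + c *\<^sub>R y)) \<le> L * (1 + norm v) ^ N * E"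
      if "norm q' \<le> 2 * norm v + 1" for q'
    proof -
      have "(1 + norm y) ^ N * norm (?k (X - q' + c *\<^sub>R y)) \<le>
         L * (1 + norm v) ^ N * (1 + norm (X - q' + c *\<^sub>R y)) ^ N * norm (?k (X - q' + c *\<^sub>R y))"
        by (intro mult_right_mono w that) auto
      also have "\<dots> = L * (1 + norm v) ^ N * ((1 + norm (X - q' + c *\<^sub>R y)) ^ N * norm (?k (X - q' + c *\<^sub>R y)))"
        by simp
      also have "\<dots> \<le> L * (1 + norm v) ^ N * E" using L by (intro mult_left_mono E) auto
      finally show ?thesis .
    qed
    have "(1 + norm y) ^ N * norm (?k (X - v + c *\<^sub>R y) - ?k (X - q + c *\<^sub>R y))
      \<le> (1 + norm y) ^ N * (norm (?k (X - v + c *\<^sub>R y)) + norm (?k (X - q + c *\<^sub>R y)))"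
      by (intro mult_left_mono norm_triangle_ineq4) auto
    also have "\<dots> \<le> L * (1 + norm v) ^ N * E + L * (1 + norm v) ^ N * E"
      unfolding distrib_left by (intro add_mono t q) (use norm_ge_zero[of v] in linarith)
    also have "\<dots> = L * (1 + norm v) ^ N * (2 * E)" by simp
    also have "\<dots> \<le> L * (1 + norm v) ^ N * (D + 2 * E)"
      using D(1) L by (intro mult_left_mono) auto
    finally show ?thesis using False by (simp add: mult_ac)
  qed
  moreover have "L * (D + 2 * E) > 0" using L D(1) E(1) by simp
  ultimately show ?thesis by blast
qed

section \<open>Tempered distributions\<close>

lemma schwartz_seminorm_upper:
  "h \<in> schwartz \<Longrightarrow> (1 + norm x) ^ N * norm (partial_derivs a h x) \<le> schwartz_seminorm N a h"
  unfolding schwartz_seminorm_def by (rule cSUP_upper) (auto simp: schwartz_def)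

lemma schwartz_seminorm_least:
  "(\<And>x. (1 + norm x) ^ N * norm (partial_derivs a h x) \<le> S) \<Longrightarrow> schwartz_seminorm N a h \<le> S"
  unfolding schwartz_seminorm_def by (rule cSUP_least) auto

lemma schwartz_diff: "g \<in> schwartz \<Longrightarrow> h \<in> schwartz \<Longrightarrow> (\<lambda>x. g x - h x) \<in> schwartz"
  using schwartz_lincomb[of g h 1 "-1"] by simp

lemma partial_derivs_diff:
  "g \<in> schwartz \<Longrightarrow> h \<in> schwartz \<Longrightarrow> partial_derivs a (\<lambda>x. g x - h x) = (\<lambda>x. partial_derivs a g x - partial_derivs a h x)"
  using partial_derivs_lincomb[of g h a 1 "-1"] by simp

lemma schwartz_seminorm_triangle:
  assumes "g \<in> schwartz" "u \<in> schwartz" "f \<in> schwartz"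
  shows "schwartz_seminorm N a (\<lambda>x. g x - f x) \<le> schwartz_seminorm N a (\<lambda>x. g x - u x) + schwartz_seminorm N a (\<lambda>x. u x - f x)"
proof (rule schwartz_seminorm_least)
  fix x
  have "(1 + norm x) ^ N * norm (partial_derivs a (\<lambda>x. g x - f x) x) \<le>
    (1 + norm x) ^ N * (norm (partial_derivs a (\<lambda>x. g x - u x) x) + norm (partial_derivs a (\<lambda>x. u x - f x) x))"
    using assms by (intro mult_left_mono) (auto simp: partial_derivs_diff intro: order_trans[OF _ norm_triangle_ineq])
  also have "\<dots> \<le> schwartz_seminorm N a (\<lambda>x. g x - u x) + schwartz_seminorm N a (\<lambda>x. u x - f x)"
    unfolding distrib_left by (intro add_mono schwartz_seminorm_upper schwartz_diff assms)
  finally show "(1 + norm x) ^ N * norm (partial_derivs a (\<lambda>x. g x - f x) x)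
    \<le> schwartz_seminorm N a (\<lambda>x. g x - u x) + schwartz_seminorm N a (\<lambda>x. u x - f x)" .
qed

text \<open>The generating sets are seminorm balls about arbitrary centres. The triangle inequality
  recentres them at \<open>u\<close>, and finite intersections unite the index sets and take the
  smaller radius.\<close>

lemma schwartz_topology_nbhd:
  assumes "openin schwartz_topology U" "u \<in> U"
  shows "\<exists>F e. finite F \<and> 0 < e \<and> (\<forall>g\<in>schwartz. (\<forall>(N, a)\<in>F. schwartz_seminorm N a (\<lambda>x. g x - u x) < e) \<longrightarrow> g \<in> U)"
proof -
  have "generate_topology_on {{g \<in> schwartz. schwartz_seminorm N a (\<lambda>x. g x - f x) < e} | f N a e. f \<in> schwartz \<and> 0 < e} U"
    using assms(1) unfolding schwartz_topology_def openin_topology_generated_by_iff .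
  then show ?thesis using assms(2)
  proof (induction U rule: generate_topology_on.induct)
    case (Int A B)
    then have uA: "u \<in> A" and uB: "u \<in> B" by auto
    from Int.IH(1)[OF uA] obtain F e where "finite F" "0 < e"
      and 1: "\<forall>g\<in>schwartz. (\<forall>(N, a)\<in>F. schwartz_seminorm N a (\<lambda>x. g x - u x) < e) \<longrightarrow> g \<in> A"
      by (elim exE conjE)
    moreover from Int.IH(2)[OF uB] obtain F' e' where "finite F'" "0 < e'"
      and 2: "\<forall>g\<in>schwartz. (\<forall>(N, a)\<in>F'. schwartz_seminorm N a (\<lambda>x. g x - u x) < e') \<longrightarrow> g \<in> B"
      by (elim exE conjE)
    moreover have "\<forall>g\<in>schwartz. (\<forall>(N, a)\<in>F \<union> F'. schwartz_seminorm N a (\<lambda>x. g x - u x) < min e e') \<longrightarrow> g \<in> A \<inter> B"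
      using 1 2 by fastforce
    ultimately show ?case by (intro exI[of _ "F \<union> F'"] exI[of _ "min e e'"]) auto
  next
    case (UN K)
    then obtain k where "k \<in> K" "u \<in> k" by blast
    from UN.IH[OF this] obtain F e where F: "finite F" "0 < e"
      and k: "\<forall>g\<in>schwartz. (\<forall>(N, a)\<in>F. schwartz_seminorm N a (\<lambda>x. g x - u x) < e) \<longrightarrow> g \<in> k"
      by (elim exE conjE)
    have "\<forall>g\<in>schwartz. (\<forall>(N, a)\<in>F. schwartz_seminorm N a (\<lambda>x. g x - u x) < e) \<longrightarrow> g \<in> \<Union>K"
      using k \<open>k \<in> K\<close> by (meson UnionI)
    with F show ?case by (intro exI[of _ F] exI[of _ e] conjI)
  next
    case (Basis s)
    then obtain f N a e where s: "s = {g \<in> schwartz. schwartz_seminorm N a (\<lambda>x. g x - f x) < e}" "f \<in> schwartz" "0 < e"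
      by blast
    with Basis have u: "u \<in> schwartz" "schwartz_seminorm N a (\<lambda>x. u x - f x) < e" by auto
    show ?case
    proof (intro exI[of _ "{(N, a)}"] exI[of _ "e - schwartz_seminorm N a (\<lambda>x. u x - f x)"] conjI ballI impI)
      fix g assume "g \<in> schwartz" "\<forall>(N', a')\<in>{(N, a)}. schwartz_seminorm N' a' (\<lambda>x. g x - u x) < e - schwartz_seminorm N a (\<lambda>x. u x - f x)"
      then show "g \<in> s" using schwartz_seminorm_triangle[of g u f N a] u s by auto
    qed (use u in auto)
  qed auto
qed

lemma tempered_lincomb:
  "f \<in> tempered_distributions \<Longrightarrow> g \<in> schwartz \<Longrightarrow> h \<in> schwartz \<Longrightarrow> f (\<lambda>x. a * g x + b * h x) = a * f g + b * f h"
  unfolding tempered_distributions_def by blast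

lemma tempered_zero: "f \<in> tempered_distributions \<Longrightarrow> f (\<lambda>x. 0) = 0"
  using tempered_lincomb[of f "\<lambda>x. 0" "\<lambda>x. 0" 0 0] schwartz_zero by simp

lemma tempered_sum:
  assumes f: "f \<in> tempered_distributions" and "finite V" and "\<And>v. v \<in> V \<Longrightarrow> h v \<in> schwartz"
  shows "f (\<lambda>x. \<Sum>v\<in>V. u v * h v x) = (\<Sum>v\<in>V. u v * f (h v))"
  using assms(2,3)
proof (induction V rule: finite_induct)
  case (insert w V)
  then show ?case
    using tempered_lincomb[OF f, of "h w" "\<lambda>x. \<Sum>v\<in>V. u v * h v x" "u w" 1] schwartz_sum[of V h u] by simp
qed (simp add: tempered_zero[OF f])

text \<open>Continuity in quantitative form. The bound \<open>S\<close> is any number above the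
  weighted derivatives instead of a supremum, so that explicit pointwise estimates can be inserted
  directly.\<close>

definition seminorm_controlled ::
  "nat \<Rightarrow> 'n list set \<Rightarrow> real \<Rightarrow> ((real ^ 'n \<Rightarrow> complex) \<Rightarrow> complex) \<Rightarrow> bool" where
  "seminorm_controlled N A C f \<longleftrightarrow> finite A \<and> 0 < C \<and> (\<forall>h\<in>schwartz. \<forall>S>0.
    (\<forall>a\<in>A. \<forall>y. (1 + norm y) ^ N * norm (partial_derivs a h y) \<le> S) \<longrightarrow> norm (f h) \<le> C * S)"

lemma seminorm_controlledD:
  assumes "seminorm_controlled N A C f" "h \<in> schwartz" "S > 0"
    and "\<And>a y. a \<in> A \<Longrightarrow> (1 + norm y) ^ N * norm (partial_derivs a h y) \<le> S"
  shows "norm (f h) \<le> C * S"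
  using assms by (simp add: seminorm_controlled_def)

lemma tempered_seminorm_controlled:
  fixes f :: "(real ^ 'n \<Rightarrow> complex) \<Rightarrow> complex"
  assumes f: "f \<in> tempered_distributions"
  shows "\<exists>N A C. seminorm_controlled N A C f"
proof -
  have cm: "continuous_map schwartz_topology euclidean f"
    using f unfolding tempered_distributions_def by blast
  let ?U = "{h \<in> topspace schwartz_topology. f h \<in> ball 0 1}"
  have "(\<lambda>x::real^'n. 0) \<in> {g \<in> schwartz. schwartz_seminorm 0 [] (\<lambda>x. g x - (\<lambda>x. 0) x) < 1}"
    using schwartz_zero by (auto simp: schwartz_seminorm_def)
  then have "(\<lambda>x::real^'n. 0) \<in> topspace schwartz_topology"
    unfolding schwartz_topology_def topology_generated_by_topspace
    using schwartz_zero zero_less_one by blast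
  then have z: "(\<lambda>x::real^'n. 0) \<in> ?U" using tempered_zero[OF f] by simp
  have "openin schwartz_topology ?U"
    using cm by (rule openin_continuous_map_preimage) simp
  from schwartz_topology_nbhd[OF this z] obtain F e where F: "finite F" "0 < e"
    and U: "\<And>g. g\<in>schwartz \<Longrightarrow> (\<forall>(N, a)\<in>F. schwartz_seminorm N a g < e) \<Longrightarrow> g \<in> ?U"
    by auto
  \<comment> \<open>One weight of the largest order dominates all others; the inserted zero covers
    an empty \<open>F\<close>.\<close>
  define N where "N = Max (insert 0 (fst ` F))"
  have N: "N' \<le> N" if "(N', a) \<in> F" for N' a
    unfolding N_def using F(1) that by (intro Max_ge) (auto intro: rev_image_eqI)
  have "norm (f h) \<le> (2 / e) * S" if h: "h \<in> schwartz" and S: "S > 0"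
    and b: "\<And>a y. a \<in> snd ` F \<Longrightarrow> (1 + norm y) ^ N * norm (partial_derivs a h y) \<le> S" for h S
  proof -
    \<comment> \<open>Scales the relevant seminorms down to \<open>e / 2\<close>, strictly inside
      the neighbourhood. Undoing the scaling yields the constant \<open>2 / e\<close>.\<close>
    let ?r = "e / (2 * S)"
    \<comment> \<open>The vanishing summand gives the scalar multiple the shape required by
      \<open>schwartz_lincomb\<close> and \<open>tempered_lincomb\<close>.\<close>
    let ?g = "\<lambda>x. of_real ?r * h x + 0 * h x"
    have r: "?r > 0" using F(2) S by simp
    have g: "?g \<in> schwartz" by (rule schwartz_lincomb[OF h h])
    have "schwartz_seminorm N' a ?g < e" if Na: "(N', a) \<in> F" for N' a
    proof -
      have "schwartz_seminorm N' a ?g \<le> e / 2"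
      proof (rule schwartz_seminorm_least)
        fix x :: "real^'n"
        have "(1 + norm x) ^ N' * norm (partial_derivs a ?g x) = ?r * ((1 + norm x) ^ N' * norm (partial_derivs a h x))"
          unfolding partial_derivs_lincomb[OF h h] using F(2) S by (simp add: norm_mult norm_divide)
        also have "\<dots> \<le> ?r * ((1 + norm x) ^ N * norm (partial_derivs a h x))"
          using r by (intro mult_left_mono mult_right_mono power_increasing N[OF Na]) auto
        also have "\<dots> \<le> ?r * S" using r Na by (intro mult_left_mono b) force+
        finally show "(1 + norm x) ^ N' * norm (partial_derivs a ?g x) \<le> e / 2" using S by simp
      qed
      then show ?thesis using F(2) by simp
    qed
    then have "?g \<in> ?U" by (intro U[OF g]) auto
    then have "norm (f ?g) < 1" by simp
    then have "?r * norm (f h) < 1"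
      using F(2) S by (simp only: tempered_lincomb[OF f h h]) (simp add: norm_mult norm_divide)
    then show ?thesis using F(2) S by (simp add: field_simps)
  qed
  then show ?thesis using F unfolding seminorm_controlled_def
    by (intro exI[of _ N] exI[of _ "snd ` F"] exI[of _ "2 / e"]) auto
qed

section \<open>The reproducing formula for distributions\<close>

lemma directional_derivative_LIMSEQ:
  fixes k :: "real ^ 'n \<Rightarrow> complex"
  assumes "k differentiable (at x)"
  shows "(\<lambda>m. of_nat (Suc m) * (k (x + (1 / real (Suc m)) *\<^sub>R axis i 1) - k x)) \<longlonglongrightarrow> partial_deriv i k x"
proof -
  let ?D = "frechet_derivative k (at x)"
  let ?v = "\<lambda>m. (1 / real (Suc m)) *\<^sub>R (axis i 1 :: real^'n)"
  have D: "(k has_derivative ?D) (at x)" using assms frechet_derivative_works by blast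
  have n: "norm (?v m) = 1 / real (Suc m)" for m by (simp add: norm_axis_1)
  have "filterlim ?v (at 0) sequentially"
    unfolding filterlim_at
  proof
    have "(\<lambda>m. 1 / real (Suc m)) \<longlonglongrightarrow> 0" by (rule LIMSEQ_Suc[OF lim_1_over_n])
    then show "?v \<longlonglongrightarrow> 0" by (intro tendsto_norm_zero_cancel[of ?v]) (simp only: n)
    show "\<forall>\<^sub>F m in sequentially. ?v m \<in> UNIV \<and> ?v m \<noteq> 0"
      by (simp add: axis_eq_0_iff)
  qed
  moreover have "(\<lambda>v. norm (k (x + v) - k x - ?D v) / norm v) \<midarrow>0\<rightarrow> 0"
    using D by (simp add: has_derivative_at)
  ultimately have "(\<lambda>m. norm (k (x + ?v m) - k x - ?D (?v m)) / norm (?v m)) \<longlonglongrightarrow> 0"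
    by (rule filterlim_compose[rotated])
  moreover have "norm (k (x + ?v m) - k x - ?D (?v m)) / norm (?v m)
      = norm (of_nat (Suc m) * (k (x + ?v m) - k x) - partial_deriv i k x)" for m
  proof -
    have "?D (?v m) = of_real (1 / real (Suc m)) * partial_deriv i k x"
      using has_derivative_linear[OF D] by (simp only: linear_cmul partial_deriv_def) (simp add: scaleR_conv_of_real)
    then have "of_nat (Suc m) * (k (x + ?v m) - k x) - partial_deriv i k x
      = of_nat (Suc m) * (k (x + ?v m) - k x - ?D (?v m))"
      by (simp add: algebra_simps del: of_nat_Suc)
    then have "norm (of_nat (Suc m) * (k (x + ?v m) - k x) - partial_deriv i k x)
      = real (Suc m) * norm (k (x + ?v m) - k x - ?D (?v m))"
      by (simp only: norm_mult norm_of_nat)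
    then show ?thesis unfolding n by (simp add: mult.commute)
  qed
  ultimately have "(\<lambda>m. norm (of_nat (Suc m) * (k (x + ?v m) - k x) - partial_deriv i k x)) \<longlonglongrightarrow> 0"
    by (simp only:)
  then show ?thesis using LIM_zero_cancel tendsto_norm_zero_iff by blast
qed

lemma reproducing_kernel_integrable:
  fixes \<eta> :: "real ^ 'n \<Rightarrow> complex"
  assumes "reproducing_kernel \<eta>"
  shows "integrable lborel (\<lambda>w. (1 + norm w) ^ M * norm (\<eta> w))"
proof -
  obtain C where "\<And>x. (1 + norm x) ^ (Suc DIM(real^'n) + M) * norm (\<eta> x) \<le> C"
    using assms unfolding reproducing_kernel_def by metis
  then show ?thesis
    using assms unfolding reproducing_kernel_def by (intro poly_decay_integrable) auto
qed

lemma reproducing_kernel_measurable: "reproducing_kernel \<eta> \<Longrightarrow> \<eta> \<in> borel_measurable borel"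
  by (simp add: reproducing_kernel_def)

lemma reproducing_kernel_mult_integrable:
  fixes \<eta> :: "real ^ 'n \<Rightarrow> complex"
  assumes \<eta>: "reproducing_kernel \<eta>" and [measurable]: "g \<in> borel_measurable borel"
    and g: "\<And>w. norm (g w) \<le> C * (1 + norm w) ^ M"
  shows "integrable lborel (\<lambda>w. \<eta> w * g w)"
proof (rule Bochner_Integration.integrable_bound)
  show "integrable lborel (\<lambda>w. C * ((1 + norm w) ^ M * norm (\<eta> w)))"
    by (intro integrable_mult_right reproducing_kernel_integrable \<eta>)
  show "AE w in lborel. norm (\<eta> w * g w) \<le> norm (C * ((1 + norm w) ^ M * norm (\<eta> w)))"
  proof (intro AE_I2)
    fix w
    have "norm (\<eta> w * g w) \<le> norm (\<eta> w) * (C * (1 + norm w) ^ M)"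
      unfolding norm_mult by (intro mult_left_mono g) auto
    then show "norm (\<eta> w * g w) \<le> norm (C * ((1 + norm w) ^ M * norm (\<eta> w)))"
      by (simp add: mult_ac)
  qed
qed (use reproducing_kernel_measurable[OF \<eta>] in measurable)

text \<open>The spectral hypothesis is about \<open>h\<close> alone, so the formula is passed to
  derivatives through difference quotients: these are reproduced by linearity, and the increment
  bound dominates them uniformly in \<open>m\<close>.\<close>

lemma reproducing_kernel_partial_derivs:
  fixes \<eta> :: "real ^ 'n \<Rightarrow> complex"
  assumes \<eta>: "reproducing_kernel \<eta>" and h: "h \<in> schwartz"
    and supp: "\<And>\<xi>. norm \<xi> > 2 \<Longrightarrow> fourier h \<xi> = 0"
  shows "(\<integral>w. \<eta> w * partial_derivs a h (x - w) \<partial>lborel) = partial_derivs a h x"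
proof (induction a arbitrary: x)
  case Nil
  then show ?case using \<eta> h supp by (simp add: reproducing_kernel_def)
next
  case (Cons i a)
  note [measurable] = reproducing_kernel_measurable[OF \<eta>]
  let ?k = "partial_derivs a h"
  let ?q = "\<lambda>m x. of_nat (Suc m) * (?k (x + (1 / real (Suc m)) *\<^sub>R axis i 1) - ?k x)"
  have [measurable]: "?k \<in> borel_measurable borel" "partial_derivs (i # a) h \<in> borel_measurable borel"
    by (rule schwartz_measurable[OF h])+
  obtain B where B: "\<And>x. norm (?k x) \<le> B"
    using schwartz_bound[OF h, of 0 a] by auto
  have ik: "integrable lborel (\<lambda>w. \<eta> w * ?k (z - w))" for z
    by (rule reproducing_kernel_mult_integrable[OF \<eta>, of _ B 0]) (use B in auto)
  obtain D where D: "\<And>Y V. norm V \<le> 1 \<Longrightarrow> norm (?k (Y + V) - ?k Y) \<le> D * norm V"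
    using schwartz_increment_bound[OF h, of 0 a] by auto
  have q: "(\<integral>w. \<eta> w * ?q m (x - w) \<partial>lborel) = ?q m x" for m
  proof -
    let ?z = "x + (1 / real (Suc m)) *\<^sub>R axis i 1"
    have "(\<integral>w. \<eta> w * ?q m (x - w) \<partial>lborel) = (\<integral>w. of_nat (Suc m) * (\<eta> w * ?k (?z - w) - \<eta> w * ?k (x - w)) \<partial>lborel)"
      by (intro Bochner_Integration.integral_cong) (auto simp: algebra_simps)
    also have "\<dots> = of_nat (Suc m) * ((\<integral>w. \<eta> w * ?k (?z - w) \<partial>lborel) - (\<integral>w. \<eta> w * ?k (x - w) \<partial>lborel))"
      by (simp only: Bochner_Integration.integral_mult_right_zero Bochner_Integration.integral_diff[OF ik ik])
    finally show ?thesis by (simp only: Cons)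
  qed
  have "(\<lambda>m. \<integral>w. \<eta> w * ?q m (x - w) \<partial>lborel) \<longlonglongrightarrow> (\<integral>w. \<eta> w * partial_derivs (i # a) h (x - w) \<partial>lborel)"
  proof (rule integral_dominated_convergence)
    show "integrable lborel (\<lambda>w. D * ((1 + norm w) ^ 0 * norm (\<eta> w)))"
      by (intro integrable_mult_right reproducing_kernel_integrable \<eta>)
    show "AE w in lborel. (\<lambda>m. \<eta> w * ?q m (x - w)) \<longlonglongrightarrow> \<eta> w * partial_derivs (i # a) h (x - w)"
      unfolding partial_derivs.simps
      by (intro AE_I2 tendsto_mult_left directional_derivative_LIMSEQ schwartz_differentiable h)
    show "AE w in lborel. norm (\<eta> w * ?q m (x - w)) \<le> D * ((1 + norm w) ^ 0 * norm (\<eta> w))" for m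
    proof (intro AE_I2)
      fix w
      have "norm (?q m (x - w)) \<le> real (Suc m) * (D * norm ((1 / real (Suc m)) *\<^sub>R (axis i 1 :: real^'n)))"
        unfolding norm_mult norm_of_nat by (intro mult_left_mono D) (auto simp: norm_axis_1)
      also have "\<dots> = D" by (simp add: norm_axis_1)
      finally have "norm (\<eta> w) * norm (?q m (x - w)) \<le> norm (\<eta> w) * D" by (rule mult_left_mono) simp
      then show "norm (\<eta> w * ?q m (x - w)) \<le> D * ((1 + norm w) ^ 0 * norm (\<eta> w))"
        unfolding norm_mult by (simp add: mult_ac)
    qed
  qed measurable
  then have "(\<lambda>m. ?q m x) \<longlonglongrightarrow> (\<integral>w. \<eta> w * partial_derivs (i # a) h (x - w) \<partial>lborel)"
    by (simp only: q)
  moreover have "(\<lambda>m. ?q m x) \<longlonglongrightarrow> partial_derivs (i # a) h x"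
    unfolding partial_derivs.simps by (intro directional_derivative_LIMSEQ schwartz_differentiable h)
  ultimately show ?case using LIMSEQ_unique by blast
qed

lemma integral_mult_simple_function:
  fixes \<eta> g :: "'a::euclidean_space \<Rightarrow> complex"
  assumes \<eta>: "integrable lborel \<eta>" and s: "simple_function lborel s"
  shows "(\<integral>w. \<eta> w * g (s w) \<partial>lborel) = (\<Sum>v\<in>range s. (\<integral>w. \<eta> w * indicator (s -` {v}) w \<partial>lborel) * g v)"
proof -
  have fin: "finite (range s)" using simple_functionD(1)[OF s] by simp
  have m: "s -` {v} \<in> sets lborel" for v using simple_functionD(2)[OF s, of "{v}"] by simp
  have "(\<integral>w. \<eta> w * g (s w) \<partial>lborel) = (\<integral>w. (\<Sum>v\<in>range s. (\<eta> w * indicator (s -` {v}) w) * g v) \<partial>lborel)"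
  proof (intro Bochner_Integration.integral_cong refl)
    fix w
    have "(\<Sum>v\<in>range s. (\<eta> w * indicator (s -` {v}) w) * g v) = (\<Sum>v\<in>range s. if v = s w then \<eta> w * g v else 0)"
      by (intro sum.cong) (auto simp: indicator_def)
    also have "\<dots> = \<eta> w * g (s w)" using fin by (subst sum.delta) auto
    finally show "\<eta> w * g (s w) = (\<Sum>v\<in>range s. (\<eta> w * indicator (s -` {v}) w) * g v)" ..
  qed
  also have "\<dots> = (\<Sum>v\<in>range s. (\<integral>w. \<eta> w * indicator (s -` {v}) w \<partial>lborel) * g v)"
  proof (subst Bochner_Integration.integral_sum)
    show "integrable lborel (\<lambda>w. \<eta> w * indicator (s -` {v}) w * g v)" for v
    proof (rule integrable_mult_left)
      have "(\<lambda>w. \<eta> w * indicator (s -` {v}) w) = (\<lambda>w. indicator (s -` {v}) w *\<^sub>R \<eta> w)"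
        by (auto simp: indicator_def)
      then show "integrable lborel (\<lambda>w. \<eta> w * indicator (s -` {v}) w)"
        using integrable_mult_indicator[OF m \<eta>] by simp
    qed
  qed simp
  finally show ?thesis .
qed


lemma member_le_sum_plus_1:
  fixes D :: "'a \<Rightarrow> real"
  assumes "finite A" "\<And>a. 0 \<le> D a" "a \<in> A"
  shows "D a \<le> sum D A + 1"
  using member_le_sum[of a A D] assms by auto

text \<open>The finitely many seminorms that control \<open>f\<close> grow polynomially under
  translation of the test function. The order \<open>N\<close> and the constant depend on
  \<open>f\<close>; only finiteness of a weighted supremum will be drawn from them.\<close>

lemma tempered_conv_bound:
  fixes h :: "real ^ 'n \<Rightarrow> complex"
  assumes f: "f \<in> tempered_distributions" and h: "h \<in> schwartz" and c: "c \<noteq> 0"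
  shows "\<exists>N C. 0 < C \<and> (\<forall>X. norm (f (\<lambda>y. h (X + c *\<^sub>R y))) \<le> C * (1 + norm X) ^ N)"
proof -
  obtain N A C where ctl: "seminorm_controlled N A C f"
    using tempered_seminorm_controlled[OF f] by blast
  then have A: "finite A" "0 < C" by (simp_all add: seminorm_controlled_def)
  note b = seminorm_controlledD[OF ctl]
  have "\<exists>D. \<forall>a. D a > 0 \<and> (\<forall>b y. (1 + norm y) ^ N * norm (partial_derivs a (\<lambda>y. h (b + c *\<^sub>R y)) y) \<le> D a * (1 + norm b) ^ N)"
    by (rule choice, rule allI, rule schwartz_affine_bound[OF h c])
  then obtain D where D: "\<And>a. D a > 0"
    "\<And>a b y. (1 + norm y) ^ N * norm (partial_derivs a (\<lambda>y. h (b + c *\<^sub>R y)) y) \<le> D a * (1 + norm b) ^ N"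
    by auto
  define S where "S = sum D A + 1"
  have S: "S > 0" unfolding S_def using D(1) by (intro add_nonneg_pos sum_nonneg) (auto intro: less_imp_le)
  have "norm (f (\<lambda>y. h (X + c *\<^sub>R y))) \<le> C * (S * (1 + norm X) ^ N)" for X
  proof (rule b[OF schwartz_affine[OF h c]])
    show "0 < S * (1 + norm X) ^ N" using S by (intro mult_pos_pos zero_less_power add_pos_nonneg) auto
    fix a y assume a: "a \<in> A"
    have "D a \<le> S" unfolding S_def by (rule member_le_sum_plus_1[OF A(1) _ a]) (use D(1) in \<open>auto intro: less_imp_le\<close>)
    then have "D a * (1 + norm X) ^ N \<le> S * (1 + norm X) ^ N" by (intro mult_right_mono) auto
    then show "(1 + norm y) ^ N * norm (partial_derivs a (\<lambda>y. h (X + c *\<^sub>R y)) y) \<le> S * (1 + norm X) ^ N"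
      by (rule order_trans[OF D(2)])
  qed
  then show ?thesis using A(2) S by (intro exI[of _ N] exI[of _ "C * S"]) (auto simp: mult_ac)
qed

text \<open>One constant for all multi-indices in \<open>A\<close>; the power of
  \<open>\<bar>c\<bar>\<close> is the chain rule factor of the inner dilation.\<close>

lemma schwartz_increments_bound:
  fixes h :: "real ^ 'n \<Rightarrow> complex"
  assumes h: "h \<in> schwartz" and c: "c \<noteq> 0" and A: "finite A"
  shows "\<exists>S>0. \<forall>a\<in>A. \<forall>v q y. norm q \<le> 2 * norm v + 1 \<longrightarrow>
    \<bar>c\<bar> ^ length a * ((1 + norm y) ^ N * norm (partial_derivs a h (X - v + c *\<^sub>R y) - partial_derivs a h (X - q + c *\<^sub>R y)))
      \<le> S * (min 1 (norm (v - q)) * (1 + norm v) ^ N)"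
proof -
  have "\<exists>D. \<forall>a. D a > 0 \<and> (\<forall>v q y. norm q \<le> 2 * norm v + 1 \<longrightarrow>
    (1 + norm y) ^ N * norm (partial_derivs a h (X - v + c *\<^sub>R y) - partial_derivs a h (X - q + c *\<^sub>R y))
      \<le> D a * (min 1 (norm (v - q)) * (1 + norm v) ^ N))"
    by (rule choice, rule allI, rule schwartz_affine_increment_bound[OF h c])
  then obtain D where D0: "\<forall>a. D a > 0 \<and> (\<forall>v q y. norm q \<le> 2 * norm v + 1 \<longrightarrow>
    (1 + norm y) ^ N * norm (partial_derivs a h (X - v + c *\<^sub>R y) - partial_derivs a h (X - q + c *\<^sub>R y))
      \<le> D a * (min 1 (norm (v - q)) * (1 + norm v) ^ N))"
    by (elim exE)
  have D1: "D a > 0" for a using D0 by simp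
  have D2: "(1 + norm y) ^ N * norm (partial_derivs a h (X - v + c *\<^sub>R y) - partial_derivs a h (X - q + c *\<^sub>R y))
      \<le> D a * (min 1 (norm (v - q)) * (1 + norm v) ^ N)" if "norm q \<le> 2 * norm v + 1" for a v q y
    using D0[THEN spec, of a] that by simp
  define S where "S = (\<Sum>a\<in>A. \<bar>c\<bar> ^ length a * D a) + 1"
  have S: "S > 0" unfolding S_def by (intro add_nonneg_pos sum_nonneg mult_nonneg_nonneg less_imp_le[OF D1]) auto
  show ?thesis
  proof (intro exI[of _ S] conjI ballI allI impI S)
    fix a and v q y :: "real ^ 'n" assume a: "a \<in> A" and q: "norm q \<le> 2 * norm v + 1"
    have "\<bar>c\<bar> ^ length a * D a \<le> S" unfolding S_def
      by (rule member_le_sum_plus_1[OF A _ a]) (intro mult_nonneg_nonneg less_imp_le[OF D1] zero_le_power abs_ge_zero)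
    then have "(\<bar>c\<bar> ^ length a * D a) * (min 1 (norm (v - q)) * (1 + norm v) ^ N) \<le> S * (min 1 (norm (v - q)) * (1 + norm v) ^ N)"
      by (intro mult_right_mono) auto
    moreover have "\<bar>c\<bar> ^ length a * ((1 + norm y) ^ N * norm (partial_derivs a h (X - v + c *\<^sub>R y) - partial_derivs a h (X - q + c *\<^sub>R y)))
      \<le> \<bar>c\<bar> ^ length a * (D a * (min 1 (norm (v - q)) * (1 + norm v) ^ N))"
      by (intro mult_left_mono D2 q) auto
    ultimately show "\<bar>c\<bar> ^ length a * ((1 + norm y) ^ N * norm (partial_derivs a h (X - v + c *\<^sub>R y) - partial_derivs a h (X - q + c *\<^sub>R y)))
      \<le> S * (min 1 (norm (v - q)) * (1 + norm v) ^ N)" by (simp add: mult.assoc)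
  qed
qed

text \<open>A shift by \<open>q\<close> changes the test function by a multiple of
  \<open>norm q\<close> in each controlling seminorm, which is the case \<open>v = 0\<close> of the
  increment bound.\<close>

lemma tempered_conv_continuous:
  fixes h :: "real ^ 'n \<Rightarrow> complex"
  assumes f: "f \<in> tempered_distributions" and h: "h \<in> schwartz" and c: "c \<noteq> 0"
  shows "continuous_on UNIV (\<lambda>X. f (\<lambda>y. h (X + c *\<^sub>R y)))"
proof (rule continuous_at_imp_continuous_on, intro ballI)
  fix X
  obtain N A C where ctl: "seminorm_controlled N A C f"
    using tempered_seminorm_controlled[OF f] by blast
  then have A: "finite A" "0 < C" by (simp_all add: seminorm_controlled_def)
  note b = seminorm_controlledD[OF ctl]
  let ?G = "\<lambda>X. f (\<lambda>y. h (X + c *\<^sub>R y))"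
  obtain S where S: "S > 0" and inc: "\<And>a v q y. a \<in> A \<Longrightarrow> norm q \<le> 2 * norm v + 1 \<Longrightarrow>
    \<bar>c\<bar> ^ length a * ((1 + norm y) ^ N * norm (partial_derivs a h (X - v + c *\<^sub>R y) - partial_derivs a h (X - q + c *\<^sub>R y)))
      \<le> S * (min 1 (norm (v - q)) * (1 + norm v) ^ N)"
    using schwartz_increments_bound[OF h c A(1)] by metis
  have G: "norm (?G X - ?G (X - q)) \<le> C * (S * norm q)" if q: "norm q \<le> 1" for q
  proof (cases "q = 0")
    case False
    have s: "(\<lambda>y. h (X' + c *\<^sub>R y)) \<in> schwartz" for X' by (rule schwartz_affine[OF h c])
    have "?G X - ?G (X - q) = f (\<lambda>y. 1 * h (X + c *\<^sub>R y) + (-1) * h (X - q + c *\<^sub>R y))"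
      by (subst tempered_lincomb[OF f s s]) simp
    also have "norm \<dots> \<le> C * (S * norm q)"
    proof (rule b[OF schwartz_lincomb[OF s s]])
      show "0 < S * norm q" using S False by simp
      fix a and y :: "real ^ 'n" assume a: "a \<in> A"
      have "(1 + norm y) ^ N * norm (partial_derivs a (\<lambda>y. 1 * h (X + c *\<^sub>R y) + (-1) * h (X - q + c *\<^sub>R y)) y)
        = \<bar>c\<bar> ^ length a * ((1 + norm y) ^ N * norm (partial_derivs a h (X - 0 + c *\<^sub>R y) - partial_derivs a h (X - q + c *\<^sub>R y)))"
        unfolding partial_derivs_lincomb[OF s s] partial_derivs_affine[OF h]
        by (simp add: norm_power[symmetric] norm_mult[symmetric] right_diff_distrib mult_ac del: norm_mult norm_power of_real_power)
          (simp add: norm_mult norm_power right_diff_distrib[symmetric])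
      also have "\<dots> \<le> S * (min 1 (norm (0 - q)) * (1 + norm (0::real^'n)) ^ N)"
        using q by (intro inc a) auto
      also have "\<dots> = S * norm q" using q by simp
      finally show "(1 + norm y) ^ N * norm (partial_derivs a (\<lambda>y. 1 * h (X + c *\<^sub>R y) + (-1) * h (X - q + c *\<^sub>R y)) y) \<le> S * norm q" .
    qed
    finally show ?thesis .
  qed simp
  have "((\<lambda>Z. ?G Z - ?G X) \<longlongrightarrow> 0) (at X)"
  proof (rule Lim_null_comparison)
    show "\<forall>\<^sub>F Z in at X. norm (?G Z - ?G X) \<le> C * (S * norm (X - Z))"
      using eventually_at_ball[OF zero_less_one, of X UNIV]
    proof eventually_elim
      case (elim Z)
      then have "norm (X - Z) \<le> 1" by (auto simp: dist_norm)
      from G[OF this] show ?case by (simp add: norm_minus_commute)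
    qed
    have "((\<lambda>Z. C * (S * norm (X - Z))) \<longlongrightarrow> C * (S * norm (X - X))) (at X)"
      by (intro tendsto_intros)
    then show "((\<lambda>Z. C * (S * norm (X - Z))) \<longlongrightarrow> 0) (at X)" by simp
  qed
  then show "isCont ?G X" unfolding isCont_def by (rule LIM_zero_cancel)
qed

text \<open>Simple functions approximating the identity turn the convolution integral into finite
  linear combinations, which commute with the distribution.\<close>

lemma tempered_conv_reproducing:
  fixes h :: "real ^ 'n \<Rightarrow> complex"
  assumes \<eta>: "reproducing_kernel \<eta>"
    and f: "f \<in> tempered_distributions" and h: "h \<in> schwartz" and c: "c \<noteq> 0"
    and supp: "\<And>\<xi>. norm \<xi> > 2 \<Longrightarrow> fourier h \<xi> = 0"
  shows "(\<integral>w. \<eta> w * f (\<lambda>y. h (X - w + c *\<^sub>R y)) \<partial>lborel) = f (\<lambda>y. h (X + c *\<^sub>R y))"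
proof -
  note [measurable] = reproducing_kernel_measurable[OF \<eta>]
  obtain N A C where ctl: "seminorm_controlled N A C f"
    using tempered_seminorm_controlled[OF f] by blast
  then have A: "finite A" "0 < C" by (simp_all add: seminorm_controlled_def)
  note b = seminorm_controlledD[OF ctl]
  let ?G = "\<lambda>X. f (\<lambda>y. h (X + c *\<^sub>R y))"
  have G_cont: "continuous_on UNIV ?G" by (rule tempered_conv_continuous[OF f h c])
  then have [measurable]: "?G \<in> borel_measurable borel" by (rule borel_measurable_continuous_onI)
  obtain M B where B: "0 < B" "\<And>X. norm (?G X) \<le> B * (1 + norm X) ^ M"
    using tempered_conv_bound[OF f h c] by blast
  obtain S where S: "S > 0" and inc: "\<And>a v q y. a \<in> A \<Longrightarrow> norm q \<le> 2 * norm v + 1 \<Longrightarrow>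
    \<bar>c\<bar> ^ length a * ((1 + norm y) ^ N * norm (partial_derivs a h (X - v + c *\<^sub>R y) - partial_derivs a h (X - q + c *\<^sub>R y)))
      \<le> S * (min 1 (norm (v - q)) * (1 + norm v) ^ N)"
    using schwartz_increments_bound[OF h c A(1)] by metis
  have "(\<lambda>w::real^'n. w) \<in> borel_measurable lborel" by measurable
  \<comment> \<open>The approximants of the identity also satisfy
    \<open>norm (s m w) \<le> 2 * norm w\<close>. This keeps them in the range of the increment
    bound and supplies majorants independent of \<open>m\<close>.\<close>
  from borel_measurable_implies_sequence_metric[OF this, of 0]
  obtain s where s: "\<And>m. simple_function lborel (s m)" "\<And>w::real^'n. (\<lambda>m. s m w) \<longlonglongrightarrow> w"
    "\<And>m w. norm (s m w) \<le> 2 * norm w"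
    by (auto simp: dist_norm)
  note [measurable] = borel_measurable_simple_function[OF s(1)]
  have s1: "norm (s m w) \<le> 2 * norm w + 1" for m w using s(3)[of m w] by simp
  have ieta: "integrable lborel \<eta>"
    using reproducing_kernel_integrable[OF \<eta>, of 0] integrable_norm_iff[of \<eta> lborel] by simp
  define u where "u m v = (\<integral>w. \<eta> w * indicator (s m -` {v}) w \<partial>lborel)" for m v
  have fin: "finite (range (s m))" for m using simple_functionD(1)[OF s(1)] by simp
  have simp_int: "(\<integral>w. \<eta> w * g (s m w) \<partial>lborel) = (\<Sum>v\<in>range (s m). u m v * g v)" for m g
    unfolding u_def by (rule integral_mult_simple_function[OF ieta s(1)])
  have sch: "(\<lambda>y. h (X' + c *\<^sub>R y)) \<in> schwartz" for X' by (rule schwartz_affine[OF h c])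
  \<comment> \<open>The averaged increment: the error of the discretised convolution in all
    controlling seminorms, up to the factor \<open>S\<close>. Rapid decay of \<open>\<eta>\<close>
    absorbs the weight, so it tends to zero by dominated convergence.\<close>
  define E where "E m = (\<integral>w. norm (\<eta> w) * (min 1 (norm (w - s m w)) * (1 + norm w) ^ N) \<partial>lborel)" for m
  have iE: "integrable lborel (\<lambda>w. norm (\<eta> w) * (min 1 (norm (w - s m w)) * (1 + norm w) ^ N))" for m
  proof (rule Bochner_Integration.integrable_bound[OF reproducing_kernel_integrable[OF \<eta>, of N]])
    show "AE w in lborel. norm (norm (\<eta> w) * (min 1 (norm (w - s m w)) * (1 + norm w) ^ N)) \<le> norm ((1 + norm w) ^ N * norm (\<eta> w))"
      by (intro AE_I2) (auto simp: abs_mult mult.commute[of "norm (\<eta> _)"] intro!: mult_right_mono mult_left_le_one_le)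
  qed measurable
  have E0: "E m \<ge> 0" for m unfolding E_def by (intro integral_nonneg_AE AE_I2) auto
  have "E \<longlonglongrightarrow> (\<integral>w. 0 \<partial>(lborel :: (real^'n) measure))"
    unfolding E_def
  proof (rule integral_dominated_convergence[OF _ _ reproducing_kernel_integrable[OF \<eta>, of N]])
    show "AE w in lborel. (\<lambda>m. norm (\<eta> w) * (min 1 (norm (w - s m w)) * (1 + norm w) ^ N)) \<longlonglongrightarrow> 0"
    proof (intro AE_I2)
      fix w
      have "(\<lambda>m. norm (\<eta> w) * (min 1 (norm (w - s m w)) * (1 + norm w) ^ N)) \<longlonglongrightarrow> norm (\<eta> w) * (min 1 (norm (w - w)) * (1 + norm w) ^ N)"
        by (intro tendsto_intros s)
      then show "(\<lambda>m. norm (\<eta> w) * (min 1 (norm (w - s m w)) * (1 + norm w) ^ N)) \<longlonglongrightarrow> 0" by simp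
    qed
    show "AE w in lborel. norm (norm (\<eta> w) * (min 1 (norm (w - s m w)) * (1 + norm w) ^ N)) \<le> (1 + norm w) ^ N * norm (\<eta> w)" for m
      by (intro AE_I2) (auto simp: abs_mult mult.commute[of "norm (\<eta> _)"] intro!: mult_right_mono mult_left_le_one_le)
  qed measurable
  then have E: "E \<longlonglongrightarrow> 0" by simp
  \<comment> \<open>\<open>E m\<close> may be zero, whereas \<open>seminorm_controlledD\<close> asks
    for a positive bound; the added null sequence ensures this.\<close>
  have diff: "norm (?G X - (\<integral>w. \<eta> w * ?G (X - s m w) \<partial>lborel)) \<le> C * (S * (E m + 1 / real (Suc m)))" for m
  proof -
    let ?T = "\<lambda>y. \<Sum>v\<in>range (s m). u m v * h (X - v + c *\<^sub>R y)"
    have T: "?T \<in> schwartz" by (intro schwartz_sum fin sch)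
    have "(\<integral>w. \<eta> w * ?G (X - s m w) \<partial>lborel) = f ?T"
      using simp_int[of "\<lambda>v. ?G (X - v)" m] tempered_sum[OF f fin[of m], of "\<lambda>v y. h (X - v + c *\<^sub>R y)" "u m"] sch
      by simp
    then have "?G X - (\<integral>w. \<eta> w * ?G (X - s m w) \<partial>lborel) = f (\<lambda>y. 1 * h (X + c *\<^sub>R y) + (-1) * ?T y)"
      by (subst tempered_lincomb[OF f sch T]) simp
    also have "norm \<dots> \<le> C * (S * (E m + 1 / real (Suc m)))"
    proof (rule b[OF schwartz_lincomb[OF sch T]])
      show "0 < S * (E m + 1 / real (Suc m))" using S E0[of m] by (intro mult_pos_pos add_nonneg_pos) auto
      fix a and y :: "real ^ 'n" assume a: "a \<in> A"
      let ?k = "partial_derivs a h" and ?e = "\<bar>c\<bar> ^ length a * (1 + norm y) ^ N"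
      note [measurable] = schwartz_measurable[OF h, of a]
      obtain K where K: "\<And>x. norm (?k x) \<le> K" using schwartz_bound[OF h, of 0 a] by auto
      have i1: "integrable lborel (\<lambda>w. \<eta> w * ?k (X - w + c *\<^sub>R y))" "integrable lborel (\<lambda>w. \<eta> w * ?k (X - s m w + c *\<^sub>R y))"
        by (rule reproducing_kernel_mult_integrable[OF \<eta>, of _ K 0]; use K in simp)+
      have "partial_derivs a ?T y = (\<Sum>v\<in>range (s m). u m v * (of_real (c ^ length a) * ?k (X - v + c *\<^sub>R y)))"
        by (simp add: partial_derivs_sum[OF fin sch] partial_derivs_affine[OF h] del: of_real_power)
      also have "\<dots> = of_real (c ^ length a) * (\<integral>w. \<eta> w * ?k (X - s m w + c *\<^sub>R y) \<partial>lborel)"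
        unfolding simp_int[of "\<lambda>v. ?k (X - v + c *\<^sub>R y)" m] sum_distrib_left by (simp add: mult_ac)
      finally have t: "partial_derivs a ?T y = of_real (c ^ length a) * (\<integral>w. \<eta> w * ?k (X - s m w + c *\<^sub>R y) \<partial>lborel)" .
      have "partial_derivs a (\<lambda>y. h (X + c *\<^sub>R y)) y = of_real (c ^ length a) * (\<integral>w. \<eta> w * ?k (X - w + c *\<^sub>R y) \<partial>lborel)"
        using reproducing_kernel_partial_derivs[OF \<eta> h supp, of a "X + c *\<^sub>R y"]
        by (simp add: partial_derivs_affine[OF h] algebra_simps)
      \<comment> \<open>Since derivatives are reproduced exactly, the error of the finite sum is a
        single integral of increments of \<open>?k\<close>, to which \<open>inc\<close> applies
        pointwise.\<close>
      then have "partial_derivs a (\<lambda>y. 1 * h (X + c *\<^sub>R y) + (-1) * ?T y) y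
         = of_real (c ^ length a) * (\<integral>w. \<eta> w * ?k (X - w + c *\<^sub>R y) - \<eta> w * ?k (X - s m w + c *\<^sub>R y) \<partial>lborel)"
        unfolding partial_derivs_lincomb[OF sch T] t Bochner_Integration.integral_diff[OF i1]
        by (simp add: algebra_simps)
      then have "(1 + norm y) ^ N * norm (partial_derivs a (\<lambda>y. 1 * h (X + c *\<^sub>R y) + (-1) * ?T y) y)
        = norm (\<integral>w. of_real ?e * (\<eta> w * ?k (X - w + c *\<^sub>R y) - \<eta> w * ?k (X - s m w + c *\<^sub>R y)) \<partial>lborel)"
        unfolding Bochner_Integration.integral_mult_right_zero
        by (simp only: norm_mult norm_of_real) (simp add: abs_mult power_abs)
      also have "\<dots> \<le> (\<integral>w. S * (norm (\<eta> w) * (min 1 (norm (w - s m w)) * (1 + norm w) ^ N)) \<partial>lborel)"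
      proof (intro Bochner_Integration.integral_norm_bound_integral)
        show "integrable lborel (\<lambda>w. of_real ?e * (\<eta> w * ?k (X - w + c *\<^sub>R y) - \<eta> w * ?k (X - s m w + c *\<^sub>R y)))"
          by (intro integrable_mult_right Bochner_Integration.integrable_diff i1)
        show "integrable lborel (\<lambda>w. S * (norm (\<eta> w) * (min 1 (norm (w - s m w)) * (1 + norm w) ^ N)))"
          by (intro integrable_mult_right iE)
        fix w
        have "norm (of_real ?e * (\<eta> w * ?k (X - w + c *\<^sub>R y) - \<eta> w * ?k (X - s m w + c *\<^sub>R y)))
          = norm (\<eta> w) * (\<bar>c\<bar> ^ length a * ((1 + norm y) ^ N * norm (?k (X - w + c *\<^sub>R y) - ?k (X - s m w + c *\<^sub>R y))))"
          unfolding right_diff_distrib[symmetric] norm_mult norm_of_real by (simp add: abs_mult power_abs)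
        also have "\<dots> \<le> norm (\<eta> w) * (S * (min 1 (norm (w - s m w)) * (1 + norm w) ^ N))"
          by (intro mult_left_mono inc a s1) auto
        finally show "norm (of_real ?e * (\<eta> w * ?k (X - w + c *\<^sub>R y) - \<eta> w * ?k (X - s m w + c *\<^sub>R y))) \<le> S * (norm (\<eta> w) * (min 1 (norm (w - s m w)) * (1 + norm w) ^ N))"
          by (simp only: mult.left_commute)
      qed
      also have "\<dots> = S * E m" unfolding E_def by simp
      also have "\<dots> \<le> S * (E m + 1 / real (Suc m))" using S by (intro mult_left_mono) auto
      finally show "(1 + norm y) ^ N * norm (partial_derivs a (\<lambda>y. 1 * h (X + c *\<^sub>R y) + (-1) * ?T y) y) \<le> S * (E m + 1 / real (Suc m))" .
    qed
    finally show ?thesis .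
  qed
  have z: "(\<lambda>m. 1 / real (Suc m)) \<longlonglongrightarrow> 0" by (rule LIMSEQ_Suc[OF lim_1_over_n])
  have "(\<lambda>m. C * (S * (E m + 1 / real (Suc m)))) \<longlonglongrightarrow> C * (S * (0 + 0))"
    by (intro tendsto_mult_left tendsto_add E z)
  then have z': "(\<lambda>m. C * (S * (E m + 1 / real (Suc m)))) \<longlonglongrightarrow> 0" by simp
  have "(\<lambda>m. ?G X - (\<integral>w. \<eta> w * ?G (X - s m w) \<partial>lborel)) \<longlonglongrightarrow> 0"
    by (rule Lim_null_comparison[OF _ z'], rule always_eventually, rule allI, rule diff)
  then have "(\<lambda>m. ?G X - (?G X - (\<integral>w. \<eta> w * ?G (X - s m w) \<partial>lborel))) \<longlonglongrightarrow> ?G X - 0"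
    by (intro tendsto_diff tendsto_const)
  then have "(\<lambda>m. \<integral>w. \<eta> w * ?G (X - s m w) \<partial>lborel) \<longlonglongrightarrow> ?G X" by simp
  moreover have "(\<lambda>m. \<integral>w. \<eta> w * ?G (X - s m w) \<partial>lborel) \<longlonglongrightarrow> (\<integral>w. \<eta> w * ?G (X - w) \<partial>lborel)"
  proof (rule integral_dominated_convergence)
    show "integrable lborel (\<lambda>w. (B * (2 * (1 + norm X)) ^ M) * ((1 + norm w) ^ M * norm (\<eta> w)))"
      by (intro integrable_mult_right reproducing_kernel_integrable \<eta>)
    show "AE w in lborel. (\<lambda>m. \<eta> w * ?G (X - s m w)) \<longlonglongrightarrow> \<eta> w * ?G (X - w)"
      by (intro AE_I2 tendsto_mult_left continuous_on_tendsto_compose[OF G_cont] tendsto_intros s) auto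
    show "AE w in lborel. norm (\<eta> w * ?G (X - s m w)) \<le> (B * (2 * (1 + norm X)) ^ M) * ((1 + norm w) ^ M * norm (\<eta> w))" for m
    proof (intro AE_I2)
      fix w
      have "1 + norm (X - s m w) \<le> 1 + (norm X + 2 * norm w)"
        using norm_triangle_ineq4[of X "s m w"] s(3)[of m w] by linarith
      also have "\<dots> \<le> 2 * (1 + norm X) * (1 + norm w)" by (simp add: algebra_simps)
      finally have "(1 + norm (X - s m w)) ^ M \<le> (2 * (1 + norm X) * (1 + norm w)) ^ M" by (intro power_mono) auto
      then have "norm (?G (X - s m w)) \<le> B * (2 * (1 + norm X) * (1 + norm w)) ^ M"
        using B(1) by (intro order_trans[OF B(2)] mult_left_mono) auto
      then have "norm (\<eta> w) * norm (?G (X - s m w)) \<le> norm (\<eta> w) * (B * (2 * (1 + norm X) * (1 + norm w)) ^ M)"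
        by (rule mult_left_mono) simp
      then show "norm (\<eta> w * ?G (X - s m w)) \<le> (B * (2 * (1 + norm X)) ^ M) * ((1 + norm w) ^ M * norm (\<eta> w))"
        by (simp add: norm_mult power_mult_distrib mult_ac)
    qed
  qed measurable
  ultimately show ?thesis using LIMSEQ_unique by blast
qed

section \<open>The Peetre inequality\<close>

lemma one_plus_norm_triangle:
  fixes x y z :: "'a::real_normed_vector"
  shows "1 + norm (x - z) \<le> (1 + norm (x - y)) * (1 + norm (y - z))"
proof -
  have "norm (x - z) \<le> norm (x - y) + norm (y - z)" by (metis diff_add_cancel add_diff_eq norm_triangle_ineq)
  moreover have "0 \<le> norm (x - y) * norm (y - z)" by simp
  ultimately show ?thesis unfolding distrib_left distrib_right mult_1 mult_1_right by linarith
qed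

text \<open>If \<open>f\<close> is not integrable, its Bochner integral is zero by convention and
  the bound persists.\<close>

lemma norm_integral_le_nn_integral:
  fixes f :: "'a \<Rightarrow> 'b::{banach, second_countable_topology}"
  shows "ennreal (norm (\<integral>x. f x \<partial>M)) \<le> (\<integral>\<^sup>+x. norm (f x) \<partial>M)"
proof (cases "integrable M f")
  case True
  then show ?thesis by (rule integral_norm_bound_ennreal)
qed (simp add: not_integrable_integral_eq)

text \<open>All that the Peetre argument sees of band-limitation; distributions and Fourier
  transforms do not appear in it.\<close>

definition reproduced :: "(real ^ 'n \<Rightarrow> complex) \<Rightarrow> (real ^ 'n \<Rightarrow> complex) \<Rightarrow> bool" where
  "reproduced \<eta> G \<longleftrightarrow> G \<in> borel_measurable borel \<and> (\<forall>X. (\<integral>w. \<eta> w * G (X - w) \<partial>lborel) = G X)"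

definition poly_growth :: "(real ^ 'n \<Rightarrow> complex) \<Rightarrow> bool" where
  "poly_growth G \<longleftrightarrow> (\<exists>B M. 0 < B \<and> (\<forall>X. norm (G X) \<le> B * (1 + norm X) ^ M))"

text \<open>The weight stands inside the power, so its effective order is \<open>m * r\<close>; the
  order needed for integrability thus grows as \<open>r\<close> decreases.\<close>

definition weighted_mean :: "real \<Rightarrow> nat \<Rightarrow> (real ^ 'n \<Rightarrow> complex) \<Rightarrow> real ^ 'n \<Rightarrow> ennreal" where
  "weighted_mean r m G X = (\<integral>\<^sup>+z. ennreal ((norm (G z) / (1 + norm (X - z)) ^ m) powr r) \<partial>lborel)"

text \<open>For the weighted supremum \<open>S\<close> the reproducing formula gives
  \<open>S \<le> K * S powr (1 - r) * \<Lambda> powr r\<close>, and dividing by the power of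
  \<open>S\<close> gives the claim. The growth constant \<open>A\<close> only makes \<open>S\<close>
  finite and so stays out of \<open>C\<close>.\<close>

lemma peetre:
  fixes \<eta> :: "real ^ 'n \<Rightarrow> complex"
  assumes \<eta>: "reproducing_kernel \<eta>" and r: "0 < r" "r \<le> 1"
  shows "\<exists>C>0. \<forall>G A X0 \<Lambda>. reproduced \<eta> G \<longrightarrow>
    (\<forall>X. norm (G X) \<le> A * (1 + norm (X0 - X)) ^ a) \<longrightarrow> 0 \<le> \<Lambda> \<longrightarrow>
    weighted_mean r a G X0 \<le> ennreal (\<Lambda> powr r) \<longrightarrow> norm (G X0) \<le> C * \<Lambda>"
proof -
  obtain K0 where "\<And>x. (1 + norm x) ^ a * norm (\<eta> x) \<le> K0"
    using \<eta> unfolding reproducing_kernel_def by metis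
  then have K: "(1 + norm x) ^ a * norm (\<eta> x) \<le> max K0 1" for x by (meson max.coboundedI1)
  define K where "K = max K0 1"
  have K1: "K \<ge> 1" and K: "(1 + norm x) ^ a * norm (\<eta> x) \<le> K" for x using K unfolding K_def by auto
  have "norm (G X0) \<le> K powr (1 / r) * \<Lambda>"
    if G: "reproduced \<eta> G" and A: "\<And>X. norm (G X) \<le> A * (1 + norm (X0 - X)) ^ a" and \<Lambda>: "0 \<le> \<Lambda>"
      and I: "weighted_mean r a G X0 \<le> ennreal (\<Lambda> powr r)"
    for G :: "real^'n \<Rightarrow> complex" and A X0 \<Lambda>
  proof -
    have [measurable]: "G \<in> borel_measurable borel" and rep: "(\<integral>w. \<eta> w * G (y - w) \<partial>lborel) = G y" for y
      using G by (simp_all add: reproduced_def)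
    note [measurable] = reproducing_kernel_measurable[OF \<eta>]
    let ?W = "\<lambda>z. (1 + norm (X0 - z)) ^ a"
    have W: "?W z > 0" for z by (intro zero_less_power add_pos_nonneg) auto
    define g where "g z = norm (G z) / ?W z" for z
    have [measurable]: "g \<in> borel_measurable borel" unfolding g_def by measurable
    have g0: "0 \<le> g z" for z unfolding g_def using W[of z] by simp
    have gA: "g z \<le> A" for z using A[of z] W[of z] unfolding g_def by (simp add: field_simps)
    have bdd: "bdd_above (range g)" using gA by (auto simp: bdd_above_def)
    define S where "S = (SUP z. g z)"
    have gS: "g z \<le> S" for z unfolding S_def by (rule cSUP_upper[OF _ bdd]) simp
    have S0: "0 \<le> S" using g0[of 0] gS[of 0] by linarith
    have gle: "g y \<le> K * (S powr (1 - r) * \<Lambda> powr r)" for y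
    proof -
      have pt: "norm (\<eta> (y - z) * G z) \<le> ?W y * K * (S powr (1 - r) * g z powr r)" for z
      proof -
        have "norm (G z) = ?W z * g z" unfolding g_def using W[of z] by (simp add: add_nonneg_eq_0_iff)
        also have "\<dots> \<le> (?W y * (1 + norm (y - z)) ^ a) * g z"
          unfolding power_mult_distrib[symmetric]
          by (intro mult_right_mono power_mono one_plus_norm_triangle g0) auto
        finally have "norm (\<eta> (y - z) * G z) \<le> norm (\<eta> (y - z)) * ((?W y * (1 + norm (y - z)) ^ a) * g z)"
          unfolding norm_mult by (rule mult_left_mono) simp
        also have "\<dots> = ?W y * ((1 + norm (y - z)) ^ a * norm (\<eta> (y - z))) * g z" by simp
        also have "\<dots> \<le> ?W y * K * g z"
          using W[of y] g0[of z] by (intro mult_right_mono mult_left_mono K) auto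
        \<comment> \<open>Only the first factor is replaced by the supremum; the second one builds
          the mean. The exponent \<open>1 - r\<close> is nonnegative because
          \<open>r \<le> 1\<close>.\<close>
        also have "g z = g z powr (1 - r) * g z powr r"
          using g0[of z] r by (simp add: powr_add[symmetric])
        also have "\<dots> \<le> S powr (1 - r) * g z powr r"
          using g0 gS r by (intro mult_right_mono powr_mono2) auto
        finally show ?thesis using W[of y] K1 by (simp add: mult_left_mono)
      qed
      have "ennreal (norm (G y)) \<le> (\<integral>\<^sup>+w. norm (\<eta> w * G (y - w)) \<partial>lborel)"
        unfolding rep[of y, symmetric] by (rule norm_integral_le_nn_integral)
      also have "\<dots> = (\<integral>\<^sup>+z. norm (\<eta> (y - z) * G z) \<partial>lborel)"
        by (subst lborel_nn_integral_affine[where c = "-1" and t = y]) simp_all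
      also have "\<dots> \<le> (\<integral>\<^sup>+z. ennreal (?W y * K * S powr (1 - r)) * ennreal (g z powr r) \<partial>lborel)"
        using pt W[of y] K1 by (intro nn_integral_mono) (simp add: ennreal_mult'[symmetric] mult.assoc)
      also have "\<dots> = ennreal (?W y * K * S powr (1 - r)) * (\<integral>\<^sup>+z. ennreal (g z powr r) \<partial>lborel)"
        by (rule nn_integral_cmult) measurable
      also have "\<dots> \<le> ennreal (?W y * K * S powr (1 - r)) * ennreal (\<Lambda> powr r)"
        using I unfolding g_def weighted_mean_def by (intro mult_left_mono) auto
      also have "\<dots> = ennreal (?W y * (K * (S powr (1 - r) * \<Lambda> powr r)))"
        using W[of y] K1 by (simp add: ennreal_mult'[symmetric] mult.assoc)
      finally have "norm (G y) \<le> ?W y * (K * (S powr (1 - r) * \<Lambda> powr r))"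
        using W[of y] K1 by (subst (asm) ennreal_le_iff) auto
      then show ?thesis unfolding g_def using W[of y] by (simp add: field_simps)
    qed
    have "S \<le> K * (S powr (1 - r) * \<Lambda> powr r)" unfolding S_def[of] by (rule cSUP_least) (use gle S_def in auto)
    have "S \<le> K powr (1 / r) * \<Lambda>"
    proof (cases "S = 0")
      case False
      then have S: "S > 0" using S0 by simp
      have "S powr (1 - r) * S powr r = S" using S by (simp add: powr_add[symmetric])
      with \<open>S \<le> K * (S powr (1 - r) * \<Lambda> powr r)\<close> have "S powr (1 - r) * S powr r \<le> S powr (1 - r) * (K * \<Lambda> powr r)"
        by (simp add: mult_ac)
      then have "S powr r \<le> K * \<Lambda> powr r" using S by simp
      then have "(S powr r) powr (1 / r) \<le> (K * \<Lambda> powr r) powr (1 / r)" using r by (intro powr_mono2) auto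
      then show ?thesis using S r K1 \<Lambda> by (simp add: powr_powr powr_mult)
    qed (use \<Lambda> in simp)
    then show ?thesis using gS[of X0] unfolding g_def by simp
  qed
  moreover have "K powr (1 / r) > 0" using K1 by simp
  ultimately show ?thesis by (intro exI[of _ "K powr (1 / r)"]) auto
qed

text \<open>The growth exponent of \<open>G\<close> may be arbitrarily large, but \<open>C\<close> must not depend on it.
  A first application of the Peetre inequality replaces the a priori growth of \<open>G\<close> by that of
  \<open>\<Lambda>\<close>, whose exponent is under control; a second one gives a uniform constant.\<close>

lemma peetre_uniform:
  fixes \<eta> :: "real ^ 'n \<Rightarrow> complex"
  assumes \<eta>: "reproducing_kernel \<eta>" and r: "0 < r" "r \<le> 1"
  shows "\<exists>C>0. \<forall>G L \<Lambda>. reproduced \<eta> G \<longrightarrow> poly_growth G \<longrightarrow> (\<forall>X. 0 \<le> \<Lambda> X) \<longrightarrow>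
    (\<forall>X Y. \<Lambda> Y \<le> L * \<Lambda> X * (1 + norm (X - Y)) ^ m) \<longrightarrow>
    (\<forall>X. weighted_mean r m G X \<le> ennreal (\<Lambda> X powr r)) \<longrightarrow> (\<forall>X. norm (G X) \<le> C * \<Lambda> X)"
proof -
  have ex: "\<exists>C>0. \<forall>G A X0 \<Lambda>. reproduced \<eta> G \<longrightarrow> (\<forall>X. norm (G X) \<le> A * (1 + norm (X0 - X)) ^ a) \<longrightarrow>
    0 \<le> \<Lambda> \<longrightarrow> weighted_mean r a G X0 \<le> ennreal (\<Lambda> powr r) \<longrightarrow> norm (G X0) \<le> C * \<Lambda>" for a
    by (rule peetre[OF \<eta> r])
  obtain C where C0: "C > 0" and C: "\<And>G A X0 \<Lambda>. \<lbrakk>reproduced \<eta> G; \<forall>X. norm (G X) \<le> A * (1 + norm (X0 - X)) ^ m;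
    0 \<le> \<Lambda>; weighted_mean r m G X0 \<le> ennreal (\<Lambda> powr r)\<rbrakk> \<Longrightarrow> norm (G X0) \<le> C * \<Lambda>"
    using ex[of m] by (elim exE conjE) simp
  have "norm (G X) \<le> C * \<Lambda> X"
    if G: "reproduced \<eta> G" "poly_growth G" and \<Lambda>: "\<forall>X. 0 \<le> \<Lambda> X"
      and L: "\<forall>X Y. \<Lambda> Y \<le> L * \<Lambda> X * (1 + norm (X - Y)) ^ m"
      and I: "\<forall>X. weighted_mean r m G X \<le> ennreal (\<Lambda> X powr r)" for G L \<Lambda> X
  proof -
    obtain B M where B: "0 < B" "\<And>X. norm (G X) \<le> B * (1 + norm X) ^ M"
      using G(2) unfolding poly_growth_def by blast
    define a where "a = max m M"
    \<comment> \<open>\<open>D\<close> depends on \<open>a\<close> and hence on \<open>G\<close>. In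
      the second application it is merely part of the growth constant, from which \<open>C\<close>
      is independent.\<close>
    obtain D where D0: "D > 0" and D: "\<And>G A X0 \<Lambda>. \<lbrakk>reproduced \<eta> G; \<forall>X. norm (G X) \<le> A * (1 + norm (X0 - X)) ^ a;
      0 \<le> \<Lambda>; weighted_mean r a G X0 \<le> ennreal (\<Lambda> powr r)\<rbrakk> \<Longrightarrow> norm (G X0) \<le> D * \<Lambda>"
      using ex[of a] by (elim exE conjE) simp
    have p1: "norm (G X) \<le> D * \<Lambda> X" for X
    proof (rule D[OF G(1) _ \<Lambda>[rule_format]], rule allI)
      fix Y
      have "1 + norm Y \<le> (1 + norm X) * (1 + norm (X - Y))"
        using one_plus_norm_triangle[of 0 Y X] by simp
      then have "(1 + norm Y) ^ M \<le> ((1 + norm X) * (1 + norm (X - Y))) ^ M" by (intro power_mono) auto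
      also have "\<dots> \<le> (1 + norm X) ^ M * (1 + norm (X - Y)) ^ a"
        unfolding power_mult_distrib by (intro mult_left_mono power_increasing) (auto simp: a_def)
      finally have "B * (1 + norm Y) ^ M \<le> B * ((1 + norm X) ^ M * (1 + norm (X - Y)) ^ a)"
        using B(1) by (intro mult_left_mono) auto
      then show "norm (G Y) \<le> (B * (1 + norm X) ^ M) * (1 + norm (X - Y)) ^ a"
        using B(2)[of Y] by (simp add: mult.assoc)
    next
      have "weighted_mean r a G X \<le> weighted_mean r m G X"
        unfolding weighted_mean_def
      proof (intro nn_integral_mono ennreal_leI powr_mono2)
        fix z
        have "0 < (1 + norm (X - z)) ^ m" "0 < (1 + norm (X - z)) ^ a"
          by (intro zero_less_power add_pos_nonneg; simp)+
        then show "norm (G z) / (1 + norm (X - z)) ^ a \<le> norm (G z) / (1 + norm (X - z)) ^ m"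
          by (intro divide_left_mono power_increasing mult_pos_pos) (auto simp: a_def)
      qed (use r in auto)
      then show "weighted_mean r a G X \<le> ennreal (\<Lambda> X powr r)" using I by (metis order_trans)
    qed
    show ?thesis
    proof (rule C[OF G(1) _ \<Lambda>[rule_format] I[rule_format]], rule allI)
      fix Y
      have "norm (G Y) \<le> D * \<Lambda> Y" by (rule p1)
      also have "\<dots> \<le> D * (L * \<Lambda> X * (1 + norm (X - Y)) ^ m)"
        using D0 L by (intro mult_left_mono) auto
      finally show "norm (G Y) \<le> (D * L * \<Lambda> X) * (1 + norm (X - Y)) ^ m" by (simp add: mult_ac)
    qed
  qed
  then show ?thesis using C0 by (intro exI[of _ C] conjI allI impI) blast+
qed

section \<open>Integrals over dyadic partitions\<close>

text \<open>Half-open cubes turn membership into an equation for the index. Disjointness, covering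
  and measurability of the index map follow from this form.\<close>

lemma dyadic_cube_unique_index:
  fixes z :: "real ^ 'n"
  shows "z \<in> dyadic_cube i k \<longleftrightarrow> k = (\<chi> a. \<lfloor>2 powi i * z $ a\<rfloor>)"
proof -
  have p: "(2::real) powi i > 0" by simp
  have e: "2 powi (- i) * t \<le> s \<longleftrightarrow> t \<le> 2 powi i * s" "s < 2 powi (- i) * t \<longleftrightarrow> 2 powi i * s < t" for s t :: real
    using p by (simp_all add: power_int_minus field_simps)
  have "z \<in> dyadic_cube i k \<longleftrightarrow> (\<forall>a. of_int (k $ a) \<le> 2 powi i * z $ a \<and> 2 powi i * z $ a < of_int (k $ a) + 1)"
    unfolding mem_dyadic_cube e ..
  also have "\<dots> \<longleftrightarrow> (\<forall>a. k $ a = \<lfloor>2 powi i * z $ a\<rfloor>)"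
    by (metis floor_eq_iff)
  finally show ?thesis by (simp add: vec_eq_iff)
qed

lemma dyadic_cube_measurable [measurable]: "dyadic_cube i k \<in> sets borel"
proof -
  have "dyadic_cube i k = {z. \<forall>a. 2 powi (- i) * of_int (k $ a) \<le> z $ a \<and> z $ a < 2 powi (- i) * (of_int (k $ a) + 1)}"
    by (auto simp: mem_dyadic_cube)
  also have "\<dots> \<in> sets borel" by measurable
  finally show ?thesis .
qed

lemma nn_integral_dyadic_partition_mono:
  fixes f g :: "real ^ 'n \<Rightarrow> ennreal"
  assumes [measurable]: "f \<in> borel_measurable borel" "g \<in> borel_measurable borel"
    and le: "\<And>k. (\<integral>\<^sup>+z. f z * indicator (dyadic_cube i k) z \<partial>lborel) \<le> (\<integral>\<^sup>+z. g z * indicator (dyadic_cube i k) z \<partial>lborel)"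
  shows "(\<integral>\<^sup>+z. f z \<partial>lborel) \<le> (\<integral>\<^sup>+z. g z \<partial>lborel)"
proof -
  \<comment> \<open>An enumeration of the cubes of one level; numbers that code no index get the
    empty set, which preserves disjointness.\<close>
  define A :: "nat \<Rightarrow> (real^'n) set" where "A n = (if \<exists>k::int^'n. to_nat k = n then dyadic_cube i (from_nat n) else {})" for n
  have mA[measurable]: "A n \<in> sets borel" for n unfolding A_def by simp
  have dj: "disjoint_family A"
    unfolding disjoint_family_on_def A_def by (auto simp: dyadic_cube_unique_index)
  have U: "(\<Union>n. A n) = UNIV"
  proof (intro equalityI subsetI UNIV_I)
    fix z :: "real^'n"
    have "z \<in> A (to_nat (\<chi> a. \<lfloor>2 powi i * z $ a\<rfloor> :: int^'n))"
      unfolding A_def by (auto simp: dyadic_cube_unique_index)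
    then show "z \<in> (\<Union>n. A n)" by blast
  qed
  have split: "(\<integral>\<^sup>+z. h z \<partial>lborel) = (\<Sum>n. \<integral>\<^sup>+z. h z * indicator (A n) z \<partial>lborel)"
    if [measurable]: "h \<in> borel_measurable borel" for h :: "real^'n \<Rightarrow> ennreal"
  proof -
    have "(\<Sum>n. emeasure (density lborel h) (A n)) = emeasure (density lborel h) (\<Union>n. A n)"
      by (intro suminf_emeasure dj) auto
    then show ?thesis unfolding U by (simp add: emeasure_density)
  qed
  show ?thesis unfolding split[OF assms(1)] split[OF assms(2)]
  proof (intro suminf_le)
    show "(\<integral>\<^sup>+z. f z * indicator (A n) z \<partial>lborel) \<le> (\<integral>\<^sup>+z. g z * indicator (A n) z \<partial>lborel)" for n
      unfolding A_def using le by simp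
  qed auto
qed

lemma emeasure_dyadic_cube:
  "emeasure lborel (dyadic_cube i k :: (real ^ 'n) set) = ennreal ((2 powi (- i)) ^ CARD('n))"
proof -
  let ?l = "(\<chi> a. 2 powi (- i) * of_int (k $ a)) :: real ^ 'n"
  let ?u = "(\<chi> a. 2 powi (- i) * (of_int (k $ a) + 1)) :: real ^ 'n"
  have le: "(\<And>b. b \<in> Basis \<Longrightarrow> ?l \<bullet> b \<le> ?u \<bullet> b)" by (auto simp: Basis_vec_def inner_axis)
  have p: "prod ((\<bullet>) (?u - ?l)) Basis = (2 powi (- i)) ^ CARD('n)"
  proof -
    have "prod ((\<bullet>) (?u - ?l)) Basis = prod (\<lambda>b. 2 powi (- i)) (Basis :: (real^'n) set)"
      by (intro prod.cong refl) (auto simp: Basis_vec_def inner_axis algebra_simps)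
    then show ?thesis by simp
  qed
  have "box ?l ?u \<subseteq> dyadic_cube i k"
  proof
    fix x assume "x \<in> box ?l ?u"
    then show "x \<in> dyadic_cube i k" by (simp add: mem_dyadic_cube mem_box_cart less_imp_le)
  qed
  then have "emeasure lborel (box ?l ?u) \<le> emeasure lborel (dyadic_cube i k)"
    by (intro emeasure_mono) auto
  moreover have "dyadic_cube i k \<subseteq> cbox ?l ?u"
  proof
    fix x :: "real ^ 'n" assume "x \<in> dyadic_cube i k"
    then show "x \<in> cbox ?l ?u" by (simp add: mem_dyadic_cube mem_box_cart less_imp_le)
  qed
  then have "emeasure lborel (dyadic_cube i k) \<le> emeasure lborel (cbox ?l ?u)"
    by (intro emeasure_mono) auto
  ultimately show ?thesis
    using emeasure_lborel_box[of ?l ?u] emeasure_lborel_cbox[of ?l ?u] le p by (simp add: antisym)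
qed

lemma norm_diff_dyadic_cube:
  fixes x y :: "real ^ 'n"
  assumes "x \<in> dyadic_cube i k" "y \<in> dyadic_cube i k"
  shows "norm (x - y) \<le> real CARD('n) * 2 powi (- i)"
proof -
  have "norm (x - y) \<le> (\<Sum>a\<in>UNIV. \<bar>(x - y) $ a\<bar>)" by (rule norm_le_l1_cart)
  also have "\<dots> \<le> (\<Sum>a\<in>(UNIV::'n set). 2 powi (- i))"
  proof (intro sum_mono)
    fix a
    have "2 powi (- i) * of_int (k $ a) \<le> x $ a" "x $ a < 2 powi (- i) * (of_int (k $ a) + 1)"
      "2 powi (- i) * of_int (k $ a) \<le> y $ a" "y $ a < 2 powi (- i) * (of_int (k $ a) + 1)"
      using assms by (auto simp: mem_dyadic_cube)
    then show "\<bar>(x - y) $ a\<bar> \<le> 2 powi (- i)" by (simp add: algebra_simps abs_le_iff)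
  qed
  finally show ?thesis by simp
qed

text \<open>Replaces the constant power \<open>r\<close> by a variable power above it; the price, a
  summand one, is integrable against the weight.\<close>

lemma powr_le_one_plus_powr:
  assumes "0 \<le> (t::real)" "0 < r" "r \<le> p"
  shows "t powr r \<le> 1 + t powr p"
proof (cases "t \<le> 1")
  case True
  then have "t powr r \<le> 1 powr r" using assms by (intro powr_mono2) auto
  then show ?thesis by (simp add: add_increasing2)
next
  case False
  then have "t powr r \<le> t powr p" using assms by (intro powr_mono) auto
  then show ?thesis by simp
qed

lemma nn_integral_poly_decay_scaled:
  fixes X :: "real ^ 'n"
  assumes s: "s > 0"
  shows "ennreal (s ^ CARD('n)) * (\<integral>\<^sup>+z. ennreal (1 / (1 + s * norm (X - z)) ^ N) \<partial>lborel)
    = (\<integral>\<^sup>+z. ennreal (1 / (1 + norm (z :: real ^ 'n)) ^ N) \<partial>lborel)"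
  by (subst (2) lborel_nn_integral_affine[where c = "- s" and t = "s *\<^sub>R X"])
    (use s in \<open>simp_all add: scaleR_diff_right[symmetric] \<close>)

text \<open>Meant for the pointwise normaliser of \<open>G\<close>: it will combine the smoothness
  factor, the values of \<open>\<phi>\<close> on cubes and the bound \<open>N\<close>.\<close>

definition slowly_varying :: "real \<Rightarrow> nat \<Rightarrow> (real ^ 'n \<Rightarrow> real) \<Rightarrow> bool" where
  "slowly_varying E m V \<longleftrightarrow> V \<in> borel_measurable borel \<and> (\<forall>X. 0 < V X) \<and>
     (\<forall>X Y. V Y \<le> E * V X * (1 + norm (X - Y)) ^ m)"

text \<open>Level \<open>- int d\<close> means side \<open>2 ^ d \<ge> 1\<close>: these are cubes of
  some level \<open>i \<le> j\<close> after dilation by \<open>2 ^ j\<close>, with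
  \<open>d = j - i\<close>.\<close>

definition local_modular_le_1 ::
  "nat \<Rightarrow> (real ^ 'n \<Rightarrow> complex) \<Rightarrow> (real ^ 'n \<Rightarrow> real) \<Rightarrow> (real ^ 'n \<Rightarrow> real) \<Rightarrow> bool" where
  "local_modular_le_1 d G V p \<longleftrightarrow> p \<in> borel_measurable borel \<and>
     (\<forall>k. (\<integral>\<^sup>+z. ennreal ((norm (G z) / V z) powr p z) * indicator (dyadic_cube (- int d) k) z \<partial>lborel) \<le> 1)"

text \<open>On each cube the integral of \<open>(norm (G z) / V z) powr p z\<close> is at most one, while the weight is
  comparable to its mean over the cube; the sum over the cubes is thus bounded by the integral of
  the weight.\<close>

lemma local_average:
  fixes E r :: real and m :: nat
  assumes E: "E > 0" and r: "0 < r"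
  shows "\<exists>m' K. K > 0 \<and> m \<le> m' \<and> (\<forall>d (G :: real ^ 'n \<Rightarrow> complex) V p. G \<in> borel_measurable borel \<longrightarrow>
    slowly_varying E m V \<longrightarrow> local_modular_le_1 d G V p \<longrightarrow> (\<forall>X. r \<le> p X) \<longrightarrow>
    (\<forall>X. weighted_mean r m' G X \<le> ennreal ((K * V X) powr r)))"
proof -
  let ?n = "CARD('n)"
  define N where "N = Suc ?n"
  \<comment> \<open>The additional order that makes the weight, once raised to the power
    \<open>r\<close>, decay at least like order \<open>N\<close>, which is integrable. The order
    \<open>m\<close> itself is spent on comparing \<open>V z\<close> with
    \<open>V X\<close>.\<close>
  define m1 where "m1 = nat \<lceil>real N / r\<rceil>"
  define J where "J = (\<integral>z. 1 / (1 + norm (z :: real ^ 'n)) ^ N \<partial>lborel)"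
  have intJ: "integrable lborel (\<lambda>z :: real ^ 'n. 1 / (1 + norm z) ^ N)"
    unfolding N_def by (rule integrable_poly_decay) simp
  have J: "(\<integral>\<^sup>+z. ennreal (1 / (1 + norm (z :: real ^ 'n)) ^ N) \<partial>lborel) = ennreal J"
    unfolding J_def by (rule nn_integral_eq_integral[OF intJ]) auto
  have J0: "J \<ge> 0" unfolding J_def by (intro integral_nonneg_AE AE_I2) auto
  define H where "H = J + (1 + real ?n) ^ N * J + 1"
  have H: "H > 0" unfolding H_def using J0 by (intro add_nonneg_pos add_nonneg_nonneg mult_nonneg_nonneg) auto
  have m1: "real N \<le> real m1 * r"
  proof -
    have "real N / r \<le> real m1" unfolding m1_def by (rule real_nat_ceiling_ge)
    then show ?thesis using r by (simp add: field_simps)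
  qed
  have "weighted_mean r (m + m1) G X \<le> ennreal ((E * H powr (1 / r) * V X) powr r)"
    if [measurable]: "G \<in> borel_measurable borel" and sv: "slowly_varying E m V"
      and lm: "local_modular_le_1 d G V p" and p0: "\<forall>X. r \<le> p X"
    for d and G :: "real ^ 'n \<Rightarrow> complex" and V p and X
  proof -
    have [measurable]: "V \<in> borel_measurable borel" "p \<in> borel_measurable borel"
      and V0: "V Y > 0" and p: "r \<le> p Y" and VE: "V Y \<le> E * V Y' * (1 + norm (Y' - Y)) ^ m"
      and I: "(\<integral>\<^sup>+z. ennreal ((norm (G z) / V z) powr p z) * indicator (dyadic_cube (- int d) k) z \<partial>lborel) \<le> 1"
      for Y Y' k
      using sv lm p0 by (auto simp: slowly_varying_def local_modular_le_1_def)
    let ?u = "\<lambda>z. norm (G z) / V z"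
    let ?w = "\<lambda>z. 1 / (1 + norm (X - z)) ^ N"
    let ?s = "(1 / 2) ^ d :: real"
    \<comment> \<open>The weight at the scale of the cubes. It varies at most by the factor
      \<open>?c\<close> on a cube, and its integral times \<open>?s ^ ?n\<close> is \<open>J\<close>
      whatever \<open>d\<close> is; this makes the final constant independent of the cube
      size.\<close>
    let ?wd = "\<lambda>z. 1 / (1 + ?s * norm (X - z)) ^ N"
    let ?c = "(1 + real ?n) ^ N"
    have u0: "0 \<le> ?u z" for z using V0[of z] by simp
    have s: "0 < ?s" "?s \<le> 1" by (auto simp: power_le_one)
    have powi: "2 powi (int d) = (2::real) ^ d" by (simp add: power_int_def)
    have pt: "(norm (G z) / (1 + norm (X - z)) ^ (m + m1)) powr r \<le> (E * V X) powr r * (?w z + ?u z powr p z * ?w z)" for z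
    proof -
      have q1: "1 \<le> 1 + norm (X - z)" by simp
      have q: "0 < 1 + norm (X - z)" by (intro add_pos_nonneg) auto
      then have qm: "0 < (1 + norm (X - z)) ^ m" "0 < (1 + norm (X - z)) ^ m1" "0 < (1 + norm (X - z)) ^ N" by (auto intro: zero_less_power)
      have "norm (G z) = ?u z * V z" using V0[of z] by simp
      also have "\<dots> \<le> ?u z * (E * V X * (1 + norm (X - z)) ^ m)"
        by (intro mult_left_mono VE u0)
      finally have "norm (G z) / (1 + norm (X - z)) ^ (m + m1) \<le> ?u z * (E * V X * (1 + norm (X - z)) ^ m) / (1 + norm (X - z)) ^ (m + m1)"
        using q by (intro divide_right_mono) auto
      also have "\<dots> = (E * V X) * (?u z * (1 / (1 + norm (X - z)) ^ m1))"
        using qm by (simp add: power_add add_nonneg_eq_0_iff)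
      finally have "(norm (G z) / (1 + norm (X - z)) ^ (m + m1)) powr r \<le> ((E * V X) * (?u z * (1 / (1 + norm (X - z)) ^ m1))) powr r"
        using r q by (intro powr_mono2) auto
      also have "\<dots> = (E * V X) powr r * (?u z powr r * (1 / (1 + norm (X - z)) ^ m1) powr r)"
        using E V0[of X] u0[of z] q by (simp only: powr_mult)
      also have "\<dots> \<le> (E * V X) powr r * ((1 + ?u z powr p z) * ?w z)"
      proof (intro mult_left_mono mult_mono)
        show "?u z powr r \<le> 1 + ?u z powr p z" by (rule powr_le_one_plus_powr[OF u0 r p])
        have "(1 / (1 + norm (X - z)) ^ m1) powr r = 1 / (1 + norm (X - z)) powr (real m1 * r)"
          using q by (simp add: powr_divide powr_realpow[symmetric] powr_powr)
        also have "\<dots> \<le> 1 / (1 + norm (X - z)) powr real N"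
          using q q1 m1 by (intro divide_left_mono powr_mono mult_pos_pos) (auto simp: add_nonneg_eq_0_iff)
        also have "\<dots> = ?w z" using q by (simp add: powr_realpow)
        finally show "(1 / (1 + norm (X - z)) ^ m1) powr r \<le> ?w z" .
      qed (use q in auto)
      finally show ?thesis by (simp only: distrib_right mult_1_left)
    qed
    have w: "(\<integral>\<^sup>+z. ennreal (?w z) \<partial>lborel) = ennreal J"
      using nn_integral_poly_decay_scaled[of 1 X N] J by simp
    have wd: "ennreal (?s ^ ?n) * (\<integral>\<^sup>+z. ennreal (?wd z) \<partial>lborel) = ennreal J"
      using nn_integral_poly_decay_scaled[of ?s X N] J s by simp
    have cube: "(\<integral>\<^sup>+z. ennreal (?u z powr p z) * ennreal (?w z) * indicator (dyadic_cube (- int d) k) z \<partial>lborel)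
      \<le> (\<integral>\<^sup>+z. (ennreal ?c * ennreal (?s ^ ?n)) * ennreal (?wd z) * indicator (dyadic_cube (- int d) k) z \<partial>lborel)" for k
    proof -
      let ?P = "dyadic_cube (- int d) k :: (real^'n) set"
      let ?R = "\<integral>\<^sup>+z. (ennreal ?c * ennreal (?s ^ ?n)) * ennreal (?wd z) * indicator ?P z \<partial>lborel"
      \<comment> \<open>\<open>?wd y\<close> is the average over the cube of a constant, because
        \<open>?s ^ ?n\<close> is the inverse of the volume; the constant is then exchanged for
        \<open>?c * ?wd z\<close>. As \<open>?R\<close> does not involve \<open>y\<close>, it can be
        pulled out of the integral.\<close>
      have wy: "ennreal (?w y) \<le> ?R" if y: "y \<in> ?P" for y
      proof -
        have wz: "?wd y \<le> ?c * ?wd z" if z: "z \<in> ?P" for z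
        proof -
          have "norm (y - z) \<le> real ?n * 2 ^ d" using norm_diff_dyadic_cube[OF y z] powi by simp
          then have "?s * norm (y - z) \<le> real ?n" by (simp add: power_divide field_simps)
          moreover have "?s * norm (X - z) \<le> ?s * norm (X - y) + ?s * norm (y - z)"
            unfolding distrib_left[symmetric] using s by (intro mult_left_mono) (auto intro: norm_diff_triangle_le[OF order_refl order_refl])
          moreover have "0 \<le> ?s * norm (X - y) * real ?n" by simp
          moreover have "(1 + real ?n) * (1 + ?s * norm (X - y)) = 1 + ?s * norm (X - y) + real ?n + ?s * norm (X - y) * real ?n"
            by (simp add: algebra_simps)
          ultimately have "1 + ?s * norm (X - z) \<le> (1 + real ?n) * (1 + ?s * norm (X - y))"
            by linarith
          then have "(1 + ?s * norm (X - z)) ^ N \<le> ?c * (1 + ?s * norm (X - y)) ^ N"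
            unfolding power_mult_distrib[symmetric] by (intro power_mono) auto
          moreover have "0 < (1 + ?s * norm (X - z)) ^ N" "0 < (1 + ?s * norm (X - y)) ^ N"
            using s by (intro zero_less_power add_pos_nonneg; simp)+
          ultimately show ?thesis by (simp add: pos_divide_le_eq pos_le_divide_eq mult.commute)
        qed
        have a: "ennreal (?wd y) \<le> ennreal ?c * ennreal (?wd z)" if "z \<in> ?P" for z
          using ennreal_leI[OF wz[OF that]] s by (subst ennreal_mult[symmetric]) auto
        have "(1 + ?s * norm (X - y)) ^ N \<le> (1 + norm (X - y)) ^ N"
          using s by (intro power_mono add_left_mono mult_left_le_one_le) auto
        then have "?w y \<le> ?wd y" using s by (intro divide_left_mono) (auto intro!: mult_pos_pos zero_less_power add_pos_nonneg)
        then have "ennreal (?w y) \<le> ennreal (?wd y)" by (rule ennreal_leI)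
        also have "\<dots> = ennreal (?s ^ ?n) * (\<integral>\<^sup>+z. ennreal (?wd y) * indicator ?P z \<partial>lborel)"
          by (simp add: nn_integral_cmult_indicator emeasure_dyadic_cube powi ennreal_mult[symmetric] power_mult_distrib[symmetric]
            mult.left_commute[of _ "?wd y"] power_divide)
        also have "\<dots> \<le> ennreal (?s ^ ?n) * (\<integral>\<^sup>+z. ennreal ?c * ennreal (?wd z) * indicator ?P z \<partial>lborel)"
          by (intro mult_left_mono nn_integral_mono) (auto simp: indicator_def a)
        also have "\<dots> = (\<integral>\<^sup>+z. ennreal (?s ^ ?n) * (ennreal ?c * ennreal (?wd z) * indicator ?P z) \<partial>lborel)"
          by (rule nn_integral_cmult[symmetric]) measurable
        also have "\<dots> = ?R" by (intro nn_integral_cong) (simp add: mult_ac)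
        finally show ?thesis .
      qed
      have "(\<integral>\<^sup>+z. ennreal (?u z powr p z) * ennreal (?w z) * indicator ?P z \<partial>lborel)
        \<le> (\<integral>\<^sup>+z. (ennreal (?u z powr p z) * indicator ?P z) * ?R \<partial>lborel)"
        by (intro nn_integral_mono) (auto split: split_indicator intro!: mult_left_mono wy)
      also have "\<dots> = (\<integral>\<^sup>+z. ennreal (?u z powr p z) * indicator ?P z \<partial>lborel) * ?R"
        by (rule nn_integral_multc) measurable
      also have "\<dots> \<le> 1 * ?R" by (intro mult_right_mono I) auto
      finally show ?thesis by simp
    qed
    have "(\<integral>\<^sup>+z. ennreal (?u z powr p z) * ennreal (?w z) \<partial>lborel)
      \<le> (\<integral>\<^sup>+z. (ennreal ?c * ennreal (?s ^ ?n)) * ennreal (?wd z) \<partial>lborel)"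
      by (rule nn_integral_dyadic_partition_mono[OF _ _ cube]) measurable
    also have "\<dots> = (ennreal ?c * ennreal (?s ^ ?n)) * (\<integral>\<^sup>+z. ennreal (?wd z) \<partial>lborel)"
      by (rule nn_integral_cmult) measurable
    also have "\<dots> = ennreal (?c * J)"
      unfolding mult.assoc wd using J0 by (simp add: ennreal_mult)
    finally have uw: "(\<integral>\<^sup>+z. ennreal (?u z powr p z) * ennreal (?w z) \<partial>lborel) \<le> ennreal (?c * J)" .
    have "(\<integral>\<^sup>+z. ennreal ((norm (G z) / (1 + norm (X - z)) ^ (m + m1)) powr r) \<partial>lborel)
      \<le> (\<integral>\<^sup>+z. ennreal ((E * V X) powr r) * (ennreal (?w z) + ennreal (?u z powr p z) * ennreal (?w z)) \<partial>lborel)"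
    proof (intro nn_integral_mono)
      fix z
      show "ennreal ((norm (G z) / (1 + norm (X - z)) ^ (m + m1)) powr r)
        \<le> ennreal ((E * V X) powr r) * (ennreal (?w z) + ennreal (?u z powr p z) * ennreal (?w z))"
      proof -
        have "ennreal (a * (b + t * b)) = ennreal a * (ennreal b + ennreal t * ennreal b)"
          if "0 \<le> a" "0 \<le> b" "0 \<le> t" for a b t :: real
          using that by (simp add: ennreal_mult)
        from this[of "(E * V X) powr r" "?w z" "?u z powr p z"] show ?thesis
          using ennreal_leI[OF pt[of z]] by simp
      qed
    qed
    also have "\<dots> = ennreal ((E * V X) powr r) * ((\<integral>\<^sup>+z. ennreal (?w z) \<partial>lborel) + (\<integral>\<^sup>+z. ennreal (?u z powr p z) * ennreal (?w z) \<partial>lborel))"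
      by (subst nn_integral_cmult, measurable, subst nn_integral_add) measurable
    also have "\<dots> \<le> ennreal ((E * V X) powr r) * (ennreal J + ennreal (?c * J))"
      unfolding w by (intro mult_left_mono add_left_mono uw) auto
    also have "\<dots> = ennreal ((E * V X) powr r * (J + ?c * J))"
      using J0 by (simp add: ennreal_mult)
    also have "\<dots> \<le> ennreal ((E * V X) powr r * H)"
      unfolding H_def by (intro ennreal_leI mult_left_mono) auto
    also have "(E * V X) powr r * H = (E * H powr (1 / r) * V X) powr r"
      using E V0[of X] H r by (simp add: powr_mult powr_powr)
    finally show ?thesis unfolding weighted_mean_def .
  qed
  then show ?thesis using E H
    by (intro exI[of _ "m + m1"] exI[of _ "E * H powr (1 / r)"] conjI allI impI) auto
qed

text \<open>\<open>V\<close> times the constant of \<open>local_average\<close> serves as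
  \<open>\<Lambda>\<close> in \<open>peetre_uniform\<close>. What matters is the order of
  quantifiers: \<open>C\<close> precedes \<open>d\<close>, \<open>G\<close>, \<open>V\<close> and
  \<open>p\<close>.\<close>

lemma bandlimited_bound:
  fixes \<eta> :: "real ^ 'n \<Rightarrow> complex"
  assumes \<eta>: "reproducing_kernel \<eta>" and r: "0 < r" "r \<le> 1" and E: "E > 0"
  shows "\<exists>C>0. \<forall>d G V p. reproduced \<eta> G \<longrightarrow> poly_growth G \<longrightarrow> slowly_varying E m V \<longrightarrow>
    local_modular_le_1 d G V p \<longrightarrow> (\<forall>X. r \<le> p X) \<longrightarrow> (\<forall>X. norm (G X) \<le> C * V X)"
proof -
  from local_average[OF E r(1), of m, where 'n = 'n] obtain m' K where K: "K > 0" "m \<le> m'" and K0: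
    "\<forall>d (G :: real ^ 'n \<Rightarrow> complex) V p. G \<in> borel_measurable borel \<longrightarrow>
    slowly_varying E m V \<longrightarrow> local_modular_le_1 d G V p \<longrightarrow> (\<forall>X. r \<le> p X) \<longrightarrow>
    (\<forall>X. weighted_mean r m' G X \<le> ennreal ((K * V X) powr r))"
    by (elim exE conjE)
  from peetre_uniform[OF \<eta> r, of m'] obtain C where C: "C > 0" and C0:
    "\<forall>G L \<Lambda>. reproduced \<eta> G \<longrightarrow> poly_growth G \<longrightarrow> (\<forall>X. 0 \<le> \<Lambda> X) \<longrightarrow>
    (\<forall>X Y. \<Lambda> Y \<le> L * \<Lambda> X * (1 + norm (X - Y)) ^ m') \<longrightarrow>
    (\<forall>X. weighted_mean r m' G X \<le> ennreal (\<Lambda> X powr r)) \<longrightarrow> (\<forall>X. norm (G X) \<le> C * \<Lambda> X)"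
    by (elim exE conjE)
  show ?thesis
  proof (intro exI[of _ "C * K"] conjI allI impI)
    show "C * K > 0" using C K by simp
    fix d and G :: "real ^ 'n \<Rightarrow> complex" and V p X
    assume G: "reproduced \<eta> G" "poly_growth G" and V: "slowly_varying E m V"
      and p: "local_modular_le_1 d G V p" "\<forall>X. r \<le> p X"
    have "G \<in> borel_measurable borel" using G by (simp add: reproduced_def)
    then have "\<forall>X. weighted_mean r m' G X \<le> ennreal ((K * V X) powr r)"
      using K0 V p by blast
    moreover have "\<forall>X. 0 \<le> K * V X" using K V by (simp add: slowly_varying_def less_imp_le)
    moreover have "\<forall>X Y. K * V Y \<le> E * (K * V X) * (1 + norm (X - Y)) ^ m'"
    proof (intro allI)
      fix X Y
      have "K * V Y \<le> K * (E * V X * (1 + norm (X - Y)) ^ m)"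
        using K V unfolding slowly_varying_def by (intro mult_left_mono) auto
      also have "\<dots> \<le> K * (E * V X * (1 + norm (X - Y)) ^ m')"
        using K E V unfolding slowly_varying_def
        by (intro mult_left_mono power_increasing mult_nonneg_nonneg) (auto intro: less_imp_le)
      finally show "K * V Y \<le> E * (K * V X) * (1 + norm (X - Y)) ^ m'" by (simp add: mult_ac)
    qed
    ultimately have "\<forall>X. norm (G X) \<le> C * (K * V X)"
      using C0[THEN spec[of _ G], THEN spec[of _ E], THEN spec[of _ "\<lambda>X. K * V X"]] G by simp
    then show "norm (G X) \<le> C * K * V X" by (simp add: mult.assoc)
  qed
qed

section \<open>Log-Hoelder continuity and growth\<close>

text \<open>If \<open>norm (x - y) \<le> 2 powr (- j / 2)\<close>, the logarithm in the log-Hoelder condition compensates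
  for the factor \<open>j\<close>; otherwise \<open>j\<close> is at most a multiple of \<open>ln (1 + 2 ^ j * norm (x - y))\<close>.\<close>

lemma Clog_loc_shift:
  fixes \<sigma> :: "real ^ 'n \<Rightarrow> real"
  assumes "\<sigma> \<in> Clog_loc"
  shows "\<exists>E m. E > 0 \<and> (\<forall>(j::nat) x y. 2 powr (real j * (\<sigma> y - \<sigma> x)) \<le> E * (1 + 2 ^ j * norm (x - y)) ^ m)"
proof -
  obtain C where C: "\<And>x y. \<bar>\<sigma> x - \<sigma> y\<bar> \<le> C / ln (exp 1 + 1 / norm (x - y))"
    using assms by (auto simp: Clog_loc_def)
  define L where "L = max C 0"
  have L0: "L \<ge> 0" unfolding L_def by simp
  have "2 powr (real j * (\<sigma> y - \<sigma> x)) \<le> exp (2 * L) * (1 + 2 ^ j * norm (x - y)) ^ nat \<lceil>2 * L\<rceil>" for j x y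
  proof (cases "x = y")
    case True
    have "0 \<le> 2 * L" using L0 by simp
    then have "1 \<le> exp (2 * L)" by simp
    then show ?thesis using True by simp
  next
    case False
    define d where "d = norm (x - y)"
    have d: "d > 0" unfolding d_def using False by simp
    define T where "T = exp 1 + 1 / d"
    have Te: "exp 1 < T" unfolding T_def using d by simp
    have Tpos: "0 < T" using Te exp_gt_zero[of "1::real"] by linarith
    have "ln (exp 1) \<le> ln T" using Te Tpos by (intro ln_mono) auto
    then have lnT: "1 \<le> ln T" by simp
    have "\<bar>\<sigma> x - \<sigma> y\<bar> \<le> C / ln T" using C[of x y] unfolding T_def d_def .
    also have "\<dots> \<le> L / ln T" using lnT unfolding L_def by (intro divide_right_mono) auto
    finally have sL: "\<bar>\<sigma> x - \<sigma> y\<bar> \<le> L / ln T" .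
    let ?l = "ln (1 + 2 ^ j * d)"
    have p1: "1 \<le> 1 + 2 ^ j * d" using d by simp
    have l0: "0 \<le> ?l" using p1 by (rule ln_ge_zero)
    have J0: "0 \<le> real j * ln 2" by simp
    have "real j * ln 2 * (L / ln T) \<le> 2 * L + 2 * L * ?l"
    \<comment> \<open>The alternative is tested through logarithms: if it fails, then
      \<open>ln d\<close> is below \<open>- real j * ln 2 / 2\<close>, so
      \<open>real j * ln 2 \<le> 2 * ln T\<close> and \<open>ln T\<close> cancels.\<close>
    proof (cases "real j * ln 2 \<le> 2 * ?l")
      case True
      have "L / ln T \<le> L / 1" using lnT L0 by (intro divide_left_mono) auto
      then have "real j * ln 2 * (L / ln T) \<le> real j * ln 2 * L" using J0 by (intro mult_left_mono) auto
      also have "\<dots> \<le> 2 * ?l * L" using True L0 by (rule mult_right_mono)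
      also have "\<dots> \<le> 2 * L + 2 * L * ?l" using L0 by simp
      finally show ?thesis .
    next
      case False
      have "real j * ln 2 + ln d = ln (2 ^ j * d)" using d by (simp add: ln_mult ln_realpow)
      also have "\<dots> \<le> ?l" using d by (intro ln_mono) auto
      finally have "real j * ln 2 \<le> 2 * (- ln d)" using False by linarith
      also have "- ln d = ln (1 / d)" using d by (simp add: ln_div)
      also have "ln (1 / d) \<le> ln T" unfolding T_def using d by (intro ln_mono) auto
      finally have "real j * ln 2 \<le> 2 * ln T" by simp
      then have "real j * ln 2 * (L / ln T) \<le> 2 * ln T * (L / ln T)" using L0 lnT by (intro mult_right_mono) auto
      also have "\<dots> = 2 * L" using lnT by simp
      also have "\<dots> \<le> 2 * L + 2 * L * ?l" using L0 l0 by simp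
      finally show ?thesis .
    qed
    moreover have "real j * (\<sigma> y - \<sigma> x) * ln 2 \<le> real j * ln 2 * (L / ln T)"
    proof -
      have "real j * ln 2 * (\<sigma> y - \<sigma> x) \<le> real j * ln 2 * (L / ln T)"
        using sL J0 by (intro mult_left_mono) auto
      then show ?thesis by (simp add: mult_ac)
    qed
    ultimately have "real j * (\<sigma> y - \<sigma> x) * ln 2 \<le> 2 * L + 2 * L * ?l" by linarith
    then have "2 powr (real j * (\<sigma> y - \<sigma> x)) \<le> exp (2 * L + 2 * L * ?l)"
      unfolding powr_def by simp
    also have "\<dots> = exp (2 * L) * (1 + 2 ^ j * d) powr (2 * L)"
      unfolding powr_def exp_add using p1 by simp
    also have "\<dots> \<le> exp (2 * L) * (1 + 2 ^ j * d) powr real (nat \<lceil>2 * L\<rceil>)"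
      using p1 by (intro mult_left_mono powr_mono real_nat_ceiling_ge) auto
    also have "\<dots> = exp (2 * L) * (1 + 2 ^ j * d) ^ nat \<lceil>2 * L\<rceil>"
      using p1 by (subst powr_realpow) auto
    finally show ?thesis unfolding d_def .
  qed
  then show ?thesis by (intro exI[of _ "exp (2 * L)"] exI[of _ "nat \<lceil>2 * L\<rceil>"]) auto
qed

text \<open>The logarithmic modulus tends to zero with the distance. Continuity provides Borel
  measurability and turns almost everywhere bounds into pointwise ones.\<close>

lemma Clog_loc_continuous:
  fixes \<sigma> :: "real ^ 'n \<Rightarrow> real"
  assumes "\<sigma> \<in> Clog_loc"
  shows "continuous_on UNIV \<sigma>"
proof -
  obtain C where C: "\<And>x y. \<bar>\<sigma> x - \<sigma> y\<bar> \<le> C / ln (exp 1 + 1 / norm (x - y))"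
    using assms by (auto simp: Clog_loc_def)
  have "isCont \<sigma> x" for x
  proof -
    have "((\<lambda>d::real. C / ln (exp 1 + 1 / d)) \<longlongrightarrow> 0) (at_right 0)"
    proof (rule tendsto_divide_0[OF tendsto_const])
      have "filterlim (\<lambda>d::real. 1 / d) at_top (at_right 0)"
        using filterlim_inverse_at_top_right by (simp add: inverse_eq_divide)
      then have "filterlim (\<lambda>d::real. exp 1 + 1 / d) at_top (at_right 0)"
        by (rule filterlim_tendsto_add_at_top[OF tendsto_const])
      then have "filterlim (\<lambda>d::real. ln (exp 1 + 1 / d)) at_top (at_right 0)"
        by (rule filterlim_compose[OF ln_at_top])
      then show "filterlim (\<lambda>d::real. ln (exp 1 + 1 / d)) at_infinity (at_right 0)"
        by (rule filterlim_at_top_imp_at_infinity)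
    qed
    moreover have "filterlim (\<lambda>y. norm (y - x)) (at_right 0) (at x)"
      unfolding filterlim_at
      by (auto intro!: tendsto_eq_intros simp: eventually_at_filter)
    ultimately have lim: "((\<lambda>y. C / ln (exp 1 + 1 / norm (y - x))) \<longlongrightarrow> 0) (at x)"
      by (rule filterlim_compose)
    have "((\<lambda>y. \<sigma> y - \<sigma> x) \<longlongrightarrow> 0) (at x)"
      by (rule Lim_null_comparison[OF _ lim]) (use C in \<open>auto intro!: always_eventually\<close>)
    then show ?thesis unfolding isCont_def by (rule LIM_zero_cancel)
  qed
  then show ?thesis by (intro continuous_at_imp_continuous_on) auto
qed

text \<open>Inversion is Lipschitz with constant \<open>1 / l\<^sup>2\<close> on numbers above
  \<open>l\<close>, so \<open>1 / p\<close> inherits the logarithmic modulus. This puts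
  \<open>\<sigma>\<close> into the class.\<close>

lemma Clog_loc_add_inverse:
  fixes s p :: "real ^ 'n \<Rightarrow> real"
  assumes s: "s \<in> Clog_loc" and p: "p \<in> Clog_loc" and l: "0 < l" "\<And>x. l \<le> p x"
  shows "(\<lambda>x. s x - c * (1 / p x)) \<in> Clog_loc"
proof -
  obtain C where C: "\<And>x y. \<bar>s x - s y\<bar> \<le> C / ln (exp 1 + 1 / norm (x - y))"
    using s by (auto simp: Clog_loc_def)
  obtain D where D: "\<And>x y. \<bar>p x - p y\<bar> \<le> D / ln (exp 1 + 1 / norm (x - y))"
    using p by (auto simp: Clog_loc_def)
  have "\<bar>(s x - c * (1 / p x)) - (s y - c * (1 / p y))\<bar> \<le> (C + \<bar>c\<bar> * (D / l\<^sup>2)) / ln (exp 1 + 1 / norm (x - y))" for x y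
  proof -
    let ?T = "ln (exp 1 + 1 / norm (x - y))"
    have px: "0 < p x" "0 < p y" using l order_less_le_trans by blast+
    have "l * l \<le> p x * p y" using l px by (intro mult_mono) (auto intro: less_imp_le)
    then have ll: "l\<^sup>2 \<le> p x * p y" by (simp add: power2_eq_square)
    have "\<bar>1 / p x - 1 / p y\<bar> = \<bar>p x - p y\<bar> / (p x * p y)"
      using px by (simp add: abs_mult divide_simps abs_minus_commute)
    also have "\<dots> \<le> \<bar>p x - p y\<bar> / l\<^sup>2" using l px ll by (intro divide_left_mono) auto
    also have "\<dots> \<le> (D / ?T) / l\<^sup>2" by (intro divide_right_mono D) auto
    finally have i: "\<bar>1 / p x - 1 / p y\<bar> \<le> (D / l\<^sup>2) / ?T" by (simp add: mult.commute)
    have "\<bar>(s x - c * (1 / p x)) - (s y - c * (1 / p y))\<bar> \<le> \<bar>s x - s y\<bar> + \<bar>c * (1 / p x - 1 / p y)\<bar>"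
      unfolding right_diff_distrib by linarith
    also have "\<dots> \<le> C / ?T + \<bar>c\<bar> * ((D / l\<^sup>2) / ?T)"
      unfolding abs_mult by (intro add_mono C mult_left_mono i) auto
    finally show ?thesis by (simp add: add_divide_distrib)
  qed
  then show ?thesis unfolding Clog_loc_def by blast
qed

text \<open>Below the essential infimum the bound fails only on a null set. By continuity the set
  where the real-valued exponent lies strictly below it is open, and an open null set is
  empty.\<close>

lemma var_exponent_lower_bound:
  fixes p :: "real ^ 'n \<Rightarrow> ennreal"
  assumes p: "p \<in> var_exponents" and fin: "\<And>x. p x < \<infinity>" and cont: "continuous_on UNIV (\<lambda>x. enn2real (p x))"
  shows "\<exists>l>0. \<forall>x. l \<le> enn2real (p x)"
proof -
  have "0 < essinf lebesgue p" using p by (simp add: var_exponents_def)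
  then obtain e where e: "0 < e" "e < essinf lebesgue p" using dense by blast
  then have ef: "e < \<infinity>" by (metis infinity_ennreal_def top.not_eq_extremum less_top order_less_trans)
  have "eventually (\<lambda>x. e < p x) (ae_filter lebesgue)"
    using e(2) unfolding essinf_def by (rule less_LiminfD)
  moreover have "{x. \<not> e < p x} \<in> sets lebesgue"
    using measurable_sets[of p lebesgue borel "{..e}"] p
    by (simp add: var_exponents_def vimage_def not_less)
  ultimately have "{x. \<not> e < p x} \<in> null_sets lebesgue"
    by (subst (asm) AE_iff_null) auto
  then have neg: "negligible {x. \<not> e < p x}" by (simp add: negligible_iff_null_sets)
  have ex: "ennreal (enn2real (p x)) = p x" for x using fin[of x] by simp
  have "enn2real e \<le> enn2real (p x)" for x
  proof (rule ccontr)
    assume n: "\<not> enn2real e \<le> enn2real (p x)"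
    have "open {x. enn2real (p x) < enn2real e}"
      using cont by (intro open_Collect_less) auto
    moreover have "{x. enn2real (p x) < enn2real e} \<noteq> {}" using n by (auto intro!: exI[of _ x])
    moreover have "{x. enn2real (p x) < enn2real e} \<subseteq> {x. \<not> e < p x}"
      using enn2real_mono[OF less_imp_le] fin by (force simp: not_less)
    ultimately show False using neg open_not_negligible negligible_subset by blast
  qed
  moreover have "0 < enn2real e" using e(1) ef by (simp add: enn2real_positive_iff)
  ultimately show ?thesis by blast
qed

section \<open>Polynomial comparison of the weight on cubes of equal size\<close>

lemma growth_class_doubling:
  assumes c: "\<And>x r. r > 0 \<Longrightarrow> \<phi> x r \<le> c * \<phi> x (2 * r)" "\<And>x r. r > 0 \<Longrightarrow> \<phi> x (2 * r) \<le> c * (\<phi> x r :: real)" "0 \<le> c" and r: "r > (0::real)"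
  shows "\<phi> x r \<le> c ^ l * \<phi> x (2 ^ l * r)" "\<phi> x (2 ^ l * r) \<le> c ^ l * \<phi> x r"
proof (induction l)
  case (Suc l)
  have p: "2 ^ l * r > 0" using r by simp
  case 1
  have "c ^ l * \<phi> x (2 ^ l * r) \<le> c ^ l * (c * \<phi> x (2 * (2 ^ l * r)))" using p c by (intro mult_left_mono) auto
  with Suc show ?case by (simp add: mult_ac)
  case 2
  have "\<phi> x (2 * (2 ^ l * r)) \<le> c * \<phi> x (2 ^ l * r)" by (rule c(2)[OF p])
  also have "\<dots> \<le> c * (c ^ l * \<phi> x r)" using Suc c by (intro mult_left_mono) auto
  finally show ?case by (simp add: mult_ac)
qed simp_all

lemma cube_level_dyadic_cube [simp]: "cube_level (dyadic_cube i k) = i"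
  by (simp add: cube_level_def)

lemma cube_side_dyadic_cube [simp]: "cube_side (dyadic_cube i k) = 2 powi (- i)"
  by (simp add: cube_side_def)

lemma cube_center_mem: "cube_center (dyadic_cube i k) \<in> dyadic_cube i k"
  by (simp add: cube_center_def mem_dyadic_cube)

text \<open>Doubling the radius \<open>l\<close> times, until it exceeds the distance of the
  centres, makes the second property of \<open>\<phi>\<close> applicable; then the radius is halved
  back. About \<open>2 * l\<close> factors arise, polynomial in \<open>2 ^ l\<close> and hence in
  the relative distance.\<close>

lemma growth_class_cubes:
  fixes \<phi> :: "real ^ 'n \<Rightarrow> real \<Rightarrow> real"
  assumes "\<phi> \<in> growth_class"
  shows "\<exists>E m. E > 0 \<and> (\<forall>i k k' x y. x \<in> dyadic_cube i k \<longrightarrow> y \<in> dyadic_cube i k' \<longrightarrow>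
    on_cube \<phi> (dyadic_cube i k') \<le> E * on_cube \<phi> (dyadic_cube i k) * (1 + 2 powi i * norm (x - y)) ^ m)"
proof -
  have pos: "\<And>x r. r \<ge> 0 \<Longrightarrow> 0 < \<phi> x r" using assms by (simp add: growth_class_def)
  obtain c1 where c1: "c1 > 0" "\<And>x r. r > 0 \<Longrightarrow> inverse c1 * \<phi> x (2 * r) \<le> \<phi> x r \<and> \<phi> x r \<le> c1 * \<phi> x (2 * r)"
    using assms by (auto simp: growth_class_def)
  obtain c2 where c2: "c2 > 0" "\<And>x y r. r \<ge> 0 \<Longrightarrow> norm (x - y) \<le> r \<Longrightarrow> inverse c2 * \<phi> y r \<le> \<phi> x r \<and> \<phi> x r \<le> c2 * \<phi> y r"
    using assms by (auto simp: growth_class_def)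
  \<comment> \<open>A power of two as doubling constant turns \<open>l\<close> doublings into
    \<open>(2 ^ l) ^ q\<close>, a power with natural exponent.\<close>
  obtain q where q: "c1 < 2 ^ q" using real_arch_pow[of 2 c1] by auto
  let ?c = "2 ^ q :: real" and ?n = "real CARD('n)"
  have d1: "\<phi> x r \<le> ?c * \<phi> x (2 * r)" if "r > 0" for x r
    using c1(2)[OF that, of x] q pos[of "2 * r" x] that
    by (smt (verit) mult_right_mono)
  have d2: "\<phi> x (2 * r) \<le> ?c * \<phi> x r" if "r > 0" for x r
  proof -
    have "\<phi> x (2 * r) \<le> c1 * \<phi> x r" using c1(2)[OF that, of x] c1(1) by (simp add: field_simps)
    also have "\<dots> \<le> ?c * \<phi> x r" using q pos[of r x] that by (intro mult_right_mono) auto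
    finally show ?thesis .
  qed
  let ?E = "c2 * (2 * (1 + 2 * ?n)) ^ (2 * q)"
  have "on_cube \<phi> (dyadic_cube i k') \<le> ?E * on_cube \<phi> (dyadic_cube i k) * (1 + 2 powi i * norm (x - y)) ^ (2 * q)"
    if x: "x \<in> dyadic_cube i k" and y: "y \<in> dyadic_cube i k'" for i k k' x y
  proof -
    let ?c1 = "cube_center (dyadic_cube i k)" and ?c2 = "cube_center (dyadic_cube i k')"
    let ?r = "2 powi (- i) :: real"
    have r: "?r > 0" by simp
    have ri: "2 powi i * ?r = 1" by (simp add: power_int_minus)
    define t where "t = 2 powi i * norm (?c2 - ?c1)"
    have t0: "0 \<le> t" unfolding t_def by simp
    have "norm (?c2 - ?c1) \<le> norm (?c2 - y) + norm (x - y) + norm (x - ?c1)"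
      using norm_triangle_ineq[of "(?c2 - y) - (x - y)" "x - ?c1"] norm_triangle_ineq4[of "?c2 - y" "x - y"] by simp
    also have "\<dots> \<le> ?n * ?r + norm (x - y) + ?n * ?r"
      by (intro add_mono norm_diff_dyadic_cube[OF cube_center_mem y] norm_diff_dyadic_cube[OF x cube_center_mem] order_refl)
    finally have "t \<le> 2 powi i * (?n * ?r + norm (x - y) + ?n * ?r)" unfolding t_def by (intro mult_left_mono) auto
    also have "\<dots> = 2 * ?n * (2 powi i * ?r) + 2 powi i * norm (x - y)" by (simp add: algebra_simps)
    finally have t: "t \<le> 2 * ?n + 2 powi i * norm (x - y)" unfolding ri by simp
    obtain l where l: "t < 2 ^ l" "2 ^ l \<le> 2 * (1 + t)" using ex_power2_between[OF t0] by blast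
    have "norm (?c2 - ?c1) = t * ?r" unfolding t_def using ri by simp
    then have nr: "norm (?c2 - ?c1) \<le> 2 ^ l * ?r" using l(1) r by (simp add: mult_right_mono)
    have "\<phi> ?c2 ?r \<le> ?c ^ l * \<phi> ?c2 (2 ^ l * ?r)"
      by (rule growth_class_doubling(1)[where \<phi> = \<phi> and c = ?c, OF d1 d2 _ r]) auto
    also have "\<dots> \<le> ?c ^ l * (c2 * \<phi> ?c1 (2 ^ l * ?r))"
      using c2(2)[OF _ nr] by (intro mult_left_mono) auto
    also have "\<dots> \<le> ?c ^ l * (c2 * (?c ^ l * \<phi> ?c1 ?r))"
      using c2(1) by (intro mult_left_mono growth_class_doubling(2)[where \<phi> = \<phi> and c = ?c, OF d1 d2 _ r]) auto
    also have "\<dots> = c2 * (2 ^ l) ^ (2 * q) * \<phi> ?c1 ?r"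
    proof -
      have "?c ^ l * ?c ^ l = ((2::real) ^ l) ^ (2 * q)"
        by (simp add: power_mult[symmetric] power_add[symmetric] mult_2 add_mult_distrib mult.commute)
      then show ?thesis by (simp add: mult_ac)
    qed
    also have "\<dots> \<le> c2 * ((2 * (1 + 2 * ?n)) * (1 + 2 powi i * norm (x - y))) ^ (2 * q) * \<phi> ?c1 ?r"
    proof (intro mult_right_mono mult_left_mono power_mono)
      have "(2::real) ^ l \<le> 2 * (1 + (2 * ?n + 2 powi i * norm (x - y)))" using l(2) t by simp
      also have "\<dots> \<le> (2 * (1 + 2 * ?n)) * (1 + 2 powi i * norm (x - y))"
        by (simp add: algebra_simps)
      finally show "(2::real) ^ l \<le> (2 * (1 + 2 * ?n)) * (1 + 2 powi i * norm (x - y))" .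
    qed (use c2(1) pos[of ?r ?c1] in auto)
    finally show ?thesis by (simp add: on_cube_def power_mult_distrib mult_ac)
  qed
  moreover have "?E > 0" using c2(1) by simp
  ultimately show ?thesis by blast
qed

section \<open>Embeddings\<close>

lemma rho_mono: "0 \<le> s \<Longrightarrow> s \<le> t \<Longrightarrow> rho p s \<le> rho p t"
  by (auto simp: rho_def intro!: ennreal_leI powr_mono2)

text \<open>The strict inequality yields an admissible divisor below \<open>l\<close>, and the
  modular decreases as the divisor grows. Attainment of the infimum is thereby avoided.\<close>

lemma modular_if_Lp_norm_less:
  assumes "Lp_norm p E f < ennreal l"
  shows "modular p (\<lambda>x. f x * indicator E x / l) \<le> 1"
proof -
  obtain l' where l': "0 < l'" "modular p (\<lambda>x. f x * indicator E x / l') \<le> 1" "ennreal l' < ennreal l"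
    using assms unfolding Lp_norm_def Inf_less_iff by auto
  then have ll: "l' < l" by (simp add: ennreal_less_iff)
  have "modular p (\<lambda>x. f x * indicator E x / l) \<le> modular p (\<lambda>x. f x * indicator E x / l')"
    unfolding modular_def
    using l'(1) ll by (intro nn_integral_mono rho_mono) (auto simp: abs_divide intro!: divide_left_mono)
  then show ?thesis using l'(2) by (rule order_trans)
qed

lemma Lp_norm_le: "0 < l \<Longrightarrow> modular p (\<lambda>x. f x * indicator E x / l) \<le> 1 \<Longrightarrow> Lp_norm p E f \<le> ennreal l"
  unfolding Lp_norm_def by (intro Inf_lower) auto

lemma rho_step:
  fixes j n A :: real
  assumes p: "0 < p" and q: "0 < P1" and n: "n > 0"
    and e: "a0 - n / p = \<sigma>" "a1 - n * enn2real (1 / P1) = \<sigma>" "a1 \<le> a0"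
    and A: "A \<ge> 0" "l > 0" "C \<ge> 1" "2 powr (j * \<sigma>) * A \<le> C * l"
  shows "rho P1 (2 powr (j * a1) * A / (C * l)) \<le> rho (ennreal p) (2 powr (j * a0) * A / l)"
proof (cases "P1 = \<infinity>")
  case True
  \<comment> \<open>As \<open>1 / \<infinity> = 0\<close>, the supremum bound is exactly the
    statement that the argument is at most one, where \<open>rho\<close> vanishes.\<close>
  then have "a1 = \<sigma>" using e(2) by (simp add: ennreal_divide_top)
  then have "2 powr (j * a1) * A / (C * l) \<le> 1" using A by simp
  then show ?thesis using True by (simp add: rho_def)
next
  case False
  define r where "r = enn2real P1"
  have P1: "P1 = ennreal r" unfolding r_def using False by (simp add: less_top[symmetric])
  have r: "r > 0" using q unfolding P1 by simp
  have "1 / P1 = ennreal (1 / r)" unfolding P1 using r divide_ennreal[of 1 r] by simp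
  then have a1: "a1 = \<sigma> + n / r" using e(2) r by simp
  have a0: "a0 = \<sigma> + n / p" using e(1) by simp
  have "n / r \<le> n / p" using e(3) a1 a0 by simp
  then have pr: "p \<le> r" using n p r by (simp add: field_simps)
  \<comment> \<open>The supremum bound means \<open>u \<le> 1\<close>, so passing from the power
    \<open>r\<close> to the smaller power \<open>p\<close> can only increase the value. Without the
    constant \<open>C\<close> one gets \<open>v \<ge> u\<close>.\<close>
  define u where "u = 2 powr (j * \<sigma>) * A / (C * l)"
  have u: "0 \<le> u" "u \<le> 1" unfolding u_def using A by auto
  define v where "v = 2 powr (j * \<sigma>) * A / l"
  have uv: "u \<le> v" unfolding u_def v_def using A by (intro divide_left_mono) auto
  have x1: "2 powr (j * a1) * A / (C * l) = u * 2 powr (j * n / r)"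
    unfolding a1 u_def by (simp add: distrib_left powr_add)
  have x0: "2 powr (j * a0) * A / l = v * 2 powr (j * n / p)"
    unfolding a0 v_def by (simp add: distrib_left powr_add)
  have "(u * 2 powr (j * n / r)) powr r = u powr r * 2 powr (j * n)"
    using u r by (simp add: powr_mult powr_powr)
  also have "\<dots> \<le> u powr p * 2 powr (j * n)"
    using u pr by (intro mult_right_mono powr_mono') auto
  also have "\<dots> \<le> v powr p * 2 powr (j * n)"
    using u uv p by (intro mult_right_mono powr_mono2) auto
  also have "\<dots> = (v * 2 powr (j * n / p)) powr p"
    using u uv p by (simp add: powr_mult powr_powr)
  finally show ?thesis unfolding x1 x0 using False r p by (simp add: rho_def r_def ennreal_leI)
qed

text \<open>Integrates \<open>rho_step\<close>. Outside \<open>P\<close> the indicator makes both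
  arguments zero, so the supremum bound is needed on \<open>P\<close> only.\<close>

lemma Lp_norm_step:
  fixes A :: "real ^ 'n \<Rightarrow> real" and n :: real
  assumes p: "\<And>x. 0 < p x" "\<And>x. 0 < p1 x" and n: "n > 0"
    and e: "\<And>x. s0 x - n / p x = \<sigma> x" "\<And>x. s1 x - n * enn2real (1 / p1 x) = \<sigma> x" "\<And>x. s1 x \<le> s0 x"
    and A: "\<And>x. A x \<ge> 0" "l > 0" "C \<ge> 1" and sup: "\<And>x. x \<in> P \<Longrightarrow> 2 powr (j * \<sigma> x) * A x \<le> C * l"
    and mod: "modular (\<lambda>x. ennreal (p x)) (\<lambda>x. 2 powr (j * s0 x) * A x * indicator P x / l) \<le> 1"
  shows "Lp_norm p1 P (\<lambda>x. 2 powr (j * s1 x) * A x) \<le> ennreal (C * l)"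
proof (rule Lp_norm_le)
  show "0 < C * l" using A by simp
  have "modular p1 (\<lambda>x. 2 powr (j * s1 x) * A x * indicator P x / (C * l))
    \<le> modular (\<lambda>x. ennreal (p x)) (\<lambda>x. 2 powr (j * s0 x) * A x * indicator P x / l)"
    unfolding modular_def
  proof (intro nn_integral_mono)
    fix x
    have "0 \<le> 2 powr (j * s1 x) * A x * indicator P x / (C * l)" "0 \<le> 2 powr (j * s0 x) * A x * indicator P x / l"
      using A by auto
    moreover have "rho (p1 x) (2 powr (j * s1 x) * (A x * indicator P x) / (C * l))
        \<le> rho (ennreal (p x)) (2 powr (j * s0 x) * (A x * indicator P x) / l)"
      using sup A by (intro rho_step[OF p n e]) (auto simp: indicator_def)
    ultimately show "rho (p1 x) \<bar>2 powr (j * s1 x) * A x * indicator P x / (C * l)\<bar>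
      \<le> rho (ennreal (p x)) \<bar>2 powr (j * s0 x) * A x * indicator P x / l\<bar>"
      by (simp only: abs_of_nonneg mult.assoc)
  qed
  then show "modular p1 (\<lambda>x. 2 powr (j * s1 x) * A x * indicator P x / (C * l)) \<le> 1"
    using mod by (rule order_trans)
qed

text \<open>The common frame of both embeddings. The premise of \<open>step\<close> ranges over all
  cubes of level \<open>i\<close>, not just the one of the conclusion, because distributions need
  the neighbours. It is available only for \<open>N\<close> strictly above the norm, so the bound is
  reached by letting \<open>N\<close> decrease to it.\<close>

lemma norm_embedding:
  fixes F0 F1 :: "(real ^ 'n) set \<Rightarrow> nat \<Rightarrow> real ^ 'n \<Rightarrow> real" and \<phi> :: "real ^ 'n \<Rightarrow> real \<Rightarrow> real"
  defines "T p F \<equiv> (SUP P\<in>dyadic_cubes. ennreal (1 / on_cube \<phi> P) *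
    (SUP j\<in>{nat (max (cube_level P) 0)..}. Lp_norm p P (F P j)))"
  assumes pos: "\<And>P. 0 < on_cube \<phi> P" and C: "0 < C"
    and step: "\<And>i j N k. 0 < N \<Longrightarrow> i \<le> int j \<Longrightarrow>
      (\<And>k. modular p0 (\<lambda>x. F0 (dyadic_cube i k) j x * indicator (dyadic_cube i k) x / (on_cube \<phi> (dyadic_cube i k) * N)) \<le> 1) \<Longrightarrow>
      Lp_norm p1 (dyadic_cube i k) (F1 (dyadic_cube i k) j) \<le> ennreal (C * (on_cube \<phi> (dyadic_cube i k) * N))"
    and fin: "T p0 F0 < \<infinity>"
  shows "T p1 F1 \<le> ennreal C * T p0 F0"
proof -
  obtain t where t: "0 \<le> t" "T p0 F0 = ennreal t" using fin by (cases "T p0 F0") auto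
  have le: "Lp_norm p0 P (F0 P j) \<le> ennreal (on_cube \<phi> P * t)" if "P \<in> dyadic_cubes" "nat (max (cube_level P) 0) \<le> j" for P j
  proof -
    have "ennreal (1 / on_cube \<phi> P) * Lp_norm p0 P (F0 P j) \<le>
       ennreal (1 / on_cube \<phi> P) * (SUP j\<in>{nat (max (cube_level P) 0)..}. Lp_norm p0 P (F0 P j))"
      using that by (intro mult_left_mono SUP_upper) auto
    also have "\<dots> \<le> T p0 F0" unfolding T_def using that by (intro SUP_upper) auto
    finally have "ennreal (on_cube \<phi> P) * (ennreal (1 / on_cube \<phi> P) * Lp_norm p0 P (F0 P j)) \<le> ennreal (on_cube \<phi> P) * ennreal t"
      unfolding t(2) by (intro mult_left_mono) auto
    moreover have "ennreal (on_cube \<phi> P) * ennreal (1 / on_cube \<phi> P) = 1"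
      using pos[of P] by (simp add: ennreal_mult[symmetric])
    ultimately show ?thesis using pos[of P] t(1) by (simp add: mult.assoc[symmetric] ennreal_mult)
  qed
  have main: "T p1 F1 \<le> ennreal (C * N)" if N: "t < N" for N
  proof -
    have N0: "0 < N" using N t(1) by simp
    show ?thesis unfolding T_def
    proof (rule SUP_least)
      fix P :: "(real^'n) set" assume "P \<in> dyadic_cubes"
      then obtain i k where P: "P = dyadic_cube i k" by (auto simp: dyadic_cubes_def)
      have "(SUP j\<in>{nat (max (cube_level P) 0)..}. Lp_norm p1 P (F1 P j)) \<le> ennreal (C * (on_cube \<phi> P * N))"
      proof (rule SUP_least)
        fix j assume "j \<in> {nat (max (cube_level P) 0)..}"
        then have ij: "i \<le> int j" unfolding P by simp
        show "Lp_norm p1 P (F1 P j) \<le> ennreal (C * (on_cube \<phi> P * N))" unfolding P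
        proof (rule step[OF N0 ij])
          fix k
          let ?P = "dyadic_cube i k :: (real^'n) set"
          have "Lp_norm p0 ?P (F0 ?P j) \<le> ennreal (on_cube \<phi> ?P * t)"
            using ij by (intro le) (auto simp: dyadic_cubes_def)
          also have "\<dots> < ennreal (on_cube \<phi> ?P * N)"
            using pos[of ?P] N t(1) N0 by (intro ennreal_lessI) auto
          finally show "modular p0 (\<lambda>x. F0 ?P j x * indicator ?P x / (on_cube \<phi> ?P * N)) \<le> 1"
            by (rule modular_if_Lp_norm_less)
        qed
      qed
      then have "ennreal (1 / on_cube \<phi> P) * (SUP j\<in>{nat (max (cube_level P) 0)..}. Lp_norm p1 P (F1 P j))
        \<le> ennreal (1 / on_cube \<phi> P) * ennreal (C * (on_cube \<phi> P * N))" by (intro mult_left_mono) auto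
      also have "\<dots> = ennreal (C * N)" using pos[of P] C N0 by (simp add: ennreal_mult[symmetric])
      finally show "ennreal (1 / on_cube \<phi> P) * (SUP j\<in>{nat (max (cube_level P) 0)..}. Lp_norm p1 P (F1 P j)) \<le> ennreal (C * N)" .
    qed
  qed
  have "T p1 F1 \<le> ennreal (C * t)"
  proof (rule ennreal_le_epsilon)
    fix e :: real assume e: "0 < e"
    have "T p1 F1 \<le> ennreal (C * (t + e / C))" using e C by (intro main) simp
    also have "C * (t + e / C) = C * t + e" using C by (simp add: field_simps)
    finally show "T p1 F1 \<le> ennreal (C * t) + ennreal e" using t(1) C e by simp
  qed
  then show ?thesis using t C by (simp add: ennreal_mult)
qed

section \<open>Supremum bounds for sequences and for distributions\<close>

definition level_sum :: "((real ^ 'n) set \<Rightarrow> complex) \<Rightarrow> (real ^ 'n) set \<Rightarrow> nat \<Rightarrow> real ^ 'n \<Rightarrow> real" where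
  "level_sum t P j x = (\<Sum>Q\<in>{Q \<in> small_dyadic_cubes. Q \<subseteq> P \<and> cube_side Q = 2 powi (- int j)}. norm (t Q) * normalized_indicator Q x)"

text \<open>The test function is dilated explicitly, so \<open>h\<close> itself, with spectrum in
  the ball of radius two, stays the same at every level \<open>j \<ge> 1\<close>.\<close>

definition scaled_conv_norm ::
  "((real ^ 'n \<Rightarrow> complex) \<Rightarrow> complex) \<Rightarrow> (real ^ 'n \<Rightarrow> complex) \<Rightarrow> nat \<Rightarrow> real ^ 'n \<Rightarrow> real" where
  "scaled_conv_norm f h j x = 2 ^ (j * CARD('n)) * norm (f (\<lambda>y. h (2 ^ j *\<^sub>R x + (- (2 ^ j)) *\<^sub>R y)))"

text \<open>The cubes of the sum have measure \<open>2 powr (- j * n)\<close>, so the factor with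
  the variable smoothness is the same for all of them. Pulling it out gives the form shared with
  distributions.\<close>

lemma sum_normalized_indicator:
  fixes P :: "(real ^ 'n) set"
  shows "(\<Sum>Q\<in>{Q \<in> small_dyadic_cubes. Q \<subseteq> P \<and> cube_side Q = 2 powi (- int j)}.
      measure lebesgue Q powr (- s x / real CARD('n)) * norm (t Q :: complex) * normalized_indicator Q x)
    = 2 powr (real j * s x) * level_sum t P j x"
  unfolding level_sum_def sum_distrib_left
proof (intro sum.cong refl)
  fix Q assume "Q \<in> {Q \<in> small_dyadic_cubes. Q \<subseteq> P \<and> cube_side Q = 2 powi (- int j)}"
  then obtain k where Q: "Q = dyadic_cube (int j) k"
    by (auto simp: small_dyadic_cubes_def dyadic_cubes_def two_powi_inject)
  have "measure lebesgue Q = (2 powi (- int j)) ^ CARD('n)"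
    unfolding Q measure_def by (simp add: emeasure_dyadic_cube)
  also have "\<dots> = 2 powr (- (real j * real CARD('n)))"
    by (simp add: powr_realpow[symmetric] powr_powr powr_real_of_int'[symmetric])
  finally have "measure lebesgue Q powr (- s x / real CARD('n)) = 2 powr (real j * s x)"
    by (simp add: powr_powr)
  then show "measure lebesgue Q powr (- s x / real CARD('n)) * norm (t Q) * normalized_indicator Q x
    = 2 powr (real j * s x) * (norm (t Q) * normalized_indicator Q x)" by simp
qed

text \<open>If \<open>2 powr (j * \<sigma>)\<close> times the sum exceeded \<open>2 * l\<close>
  throughout a small cube, the modular over that cube alone would exceed one. Hence some point of
  the cube is good, and the shift estimate for \<open>\<sigma>\<close> carries the bound to every
  other point of it.\<close>

lemma b_sup_bound:
  fixes p s0 \<sigma> :: "real ^ 'n \<Rightarrow> real"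
  assumes l: "0 < pm" "\<And>x. pm \<le> p x" and e: "\<And>x. s0 x - real CARD('n) / p x = \<sigma> x" and \<sigma>: "\<sigma> \<in> Clog_loc"
  shows "\<exists>C\<ge>1. \<forall>P j (t :: (real ^ 'n) set \<Rightarrow> complex) l. 0 < l \<longrightarrow>
    modular (\<lambda>x. ennreal (p x)) (\<lambda>x. 2 powr (real j * s0 x) * level_sum t P j x * indicator P x / l) \<le> 1 \<longrightarrow>
    (\<forall>x. 2 powr (real j * \<sigma> x) * level_sum t P j x \<le> C * l)"
proof -
  obtain E m where E: "E > 0" "\<And>(j::nat) x y. 2 powr (real j * (\<sigma> y - \<sigma> x)) \<le> E * (1 + 2 ^ j * norm (x - y)) ^ m"
    using Clog_loc_shift[OF \<sigma>] by blast
  let ?n = "real CARD('n)"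
  \<comment> \<open>Points of one cube satisfy \<open>2 ^ j * norm (y - x) \<le> ?n\<close>; the
    factor \<open>2\<close> is the threshold of the contradiction argument, and
    \<open>C \<ge> 1\<close> is required by \<open>rho_step\<close>.\<close>
  define C where "C = max 1 (E * (1 + ?n) ^ m * 2)"
  have main: "2 powr (real j * \<sigma> x) * level_sum t P j x \<le> C * l"
    if l0: "0 < l" and mod: "modular (\<lambda>x. ennreal (p x)) (\<lambda>x. 2 powr (real j * s0 x) * level_sum t P j x * indicator P x / l) \<le> 1"
    for P j x l and t :: "(real ^ 'n) set \<Rightarrow> complex"
  proof -
    define K where "K = {Q \<in> small_dyadic_cubes. Q \<subseteq> P \<and> cube_side Q = 2 powi (- int j)}"
    define A where "A = level_sum t P j"
    have A_eq: "A x = (\<Sum>Q\<in>K. norm (t Q) * normalized_indicator Q x)" for x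
      unfolding A_def level_sum_def K_def ..
    have A0: "0 \<le> A x" for x unfolding A_eq by (intro sum_nonneg) (simp add: normalized_indicator_def)
    have K: "\<exists>k. Q = dyadic_cube (int j) k" if "Q \<in> K" for Q
      using that by (auto simp: K_def small_dyadic_cubes_def dyadic_cubes_def two_powi_inject)
    show ?thesis unfolding A_def[symmetric]
    proof (cases "A x = 0")
      case True
      then show "2 powr (real j * \<sigma> x) * A x \<le> C * l" using l0 unfolding C_def by simp
    next
      case False
      then obtain Q where Q: "Q \<in> K" "x \<in> Q"
        unfolding A_eq normalized_indicator_def by (metis (no_types, lifting) indicator_simps(2) mult_zero_right sum.neutral)
      then obtain k where k: "Q = dyadic_cube (int j) k" using K by blast
      have Ay: "A y = A x" if "y \<in> Q" for y
        unfolding A_eq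
      proof (intro sum.cong refl)
        fix Q' assume "Q' \<in> K"
        then obtain k' where k': "Q' = dyadic_cube (int j) k'" using K by blast
        have "x \<in> Q' \<longleftrightarrow> y \<in> Q'"
          using that Q(2) unfolding k k' dyadic_cube_unique_index by simp
        then show "norm (t Q') * normalized_indicator Q' y = norm (t Q') * normalized_indicator Q' x"
          by (simp add: normalized_indicator_def indicator_def)
      qed
      have "\<exists>y\<in>Q. 2 powr (real j * \<sigma> y) * A y \<le> 2 * l"
      proof (rule ccontr)
        assume "\<not> ?thesis"
        then have big: "2 * l < 2 powr (real j * \<sigma> y) * A y" if "y \<in> Q" for y using that by auto
        \<comment> \<open>The first factor cancels the measure of \<open>Q\<close>, leaving
          \<open>2 powr pm > 1\<close> as the integral. The threshold \<open>2\<close> instead of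
          \<open>1\<close> creates this strict excess.\<close>
        let ?c = "2 powr (real j * ?n) * 2 powr pm"
        have "1 < 2 powr pm" using l(1) by simp
        have "ennreal (2 powr pm) = (\<integral>\<^sup>+y. ennreal ?c * indicator Q y \<partial>lebesgue)"
        proof -
          have "(\<integral>\<^sup>+y. ennreal ?c * indicator Q y \<partial>lebesgue) = ennreal ?c * ennreal ((2 powi (- int j)) ^ CARD('n))"
            unfolding k nn_integral_completion by (simp add: nn_integral_cmult_indicator emeasure_dyadic_cube)
          also have "\<dots> = ennreal (2 powr pm * (2 powr (real j * ?n) * (2 powi (- int j)) ^ CARD('n)))"
            by (simp add: ennreal_mult[symmetric] mult_ac)
          also have "2 powr (real j * ?n) * (2 powi (- int j)) ^ CARD('n) = (1::real)"
            by (simp add: powr_powr[symmetric] powr_realpow power_int_minus power_mult_distrib[symmetric] powr_mult_base)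
          finally show ?thesis by simp
        qed
        also have "\<dots> \<le> modular (\<lambda>x. ennreal (p x)) (\<lambda>x. 2 powr (real j * s0 x) * A x * indicator P x / l)"
          unfolding modular_def
        proof (intro nn_integral_mono)
          fix y
          show "ennreal ?c * indicator Q y \<le> rho (ennreal (p y)) \<bar>2 powr (real j * s0 y) * A y * indicator P y / l\<bar>"
          proof (cases "y \<in> Q")
            case True
            then have yP: "y \<in> P" using Q(1) unfolding K_def by auto
            have py: "0 < p y" using l order_less_le_trans by blast
            define v where "v = 2 powr (real j * \<sigma> y) * A y / l"
            have v: "2 \<le> v" unfolding v_def using big[OF True] l0 by (simp add: field_simps)
            have s: "s0 y = \<sigma> y + ?n / p y" using e[of y] by simp
            have "2 powr (real j * s0 y) * A y / l = v * 2 powr (real j * ?n / p y)"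
              unfolding s v_def by (simp add: distrib_left powr_add)
            then have "(2 powr (real j * s0 y) * A y / l) powr p y = v powr p y * 2 powr (real j * ?n)"
              using v py by (simp add: powr_mult powr_powr)
            moreover have "2 powr pm \<le> v powr p y"
            proof -
              have "2 powr pm \<le> 2 powr p y" using l by (intro powr_mono) auto
              also have "\<dots> \<le> v powr p y" using v py by (intro powr_mono2) auto
              finally show ?thesis .
            qed
            ultimately have "?c \<le> (2 powr (real j * s0 y) * A y / l) powr p y"
              by (simp add: mult.commute)
            moreover have "0 \<le> 2 powr (real j * s0 y) * A y / l" using A0[of y] l0 by simp
            then have "\<bar>2 powr (real j * s0 y) * A y * indicator P y / l\<bar> = 2 powr (real j * s0 y) * A y / l"
              using yP by (simp only: indicator_simps mult_1_right abs_of_nonneg)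
            ultimately show ?thesis using True py by (simp add: rho_def ennreal_leI)
          qed simp
        qed
        also have "\<dots> \<le> 1" using mod unfolding A_def[symmetric] .
        finally show False using \<open>1 < 2 powr pm\<close> by simp
      qed
      then obtain y where y: "y \<in> Q" "2 powr (real j * \<sigma> y) * A y \<le> 2 * l" by blast
      have "norm (y - x) \<le> ?n * 2 powi (- int j)"
        using y(1) Q(2) unfolding k by (rule norm_diff_dyadic_cube)
      then have "2 ^ j * norm (y - x) \<le> 2 ^ j * (?n * 2 powi (- int j))" by (intro mult_left_mono) auto
      also have "\<dots> = ?n" by (simp add: power_int_minus)
      finally have d: "2 ^ j * norm (y - x) \<le> ?n" .
      have "2 powr (real j * \<sigma> x) * A x = 2 powr (real j * (\<sigma> x - \<sigma> y)) * (2 powr (real j * \<sigma> y) * A y)"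
        by (simp add: Ay[OF y(1)] powr_add[symmetric] algebra_simps flip: mult.assoc)
      also have "\<dots> \<le> (E * (1 + 2 ^ j * norm (y - x)) ^ m) * (2 * l)"
        by (rule mult_mono[OF E(2) y(2)]) (use E(1) A0[of y] in \<open>auto intro!: mult_nonneg_nonneg\<close>)
      also have "\<dots> \<le> (E * (1 + ?n) ^ m) * (2 * l)"
        using E(1) d l0 by (intro mult_right_mono mult_left_mono power_mono) auto
      also have "\<dots> = E * (1 + ?n) ^ m * 2 * l" by simp
      also have "\<dots> \<le> C * l" unfolding C_def using l0 by (intro mult_right_mono) auto
      finally show "2 powr (real j * \<sigma> x) * A x \<le> C * l" .
    qed
  qed
  show ?thesis
    by (rule exI[of _ C], intro conjI allI impI, simp add: C_def, rule main)
qed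


text \<open>There are countably many indices, each with a dyadic cube as preimage. This makes the
  piecewise constant normaliser of the distribution estimate measurable.\<close>

lemma index_measurable:
  "(\<lambda>x::real ^ 'n. (\<chi> a. \<lfloor>2 powi i * x $ a\<rfloor>) :: int ^ 'n) \<in> borel \<rightarrow>\<^sub>M count_space UNIV"
proof (subst measurable_count_space_eq2_countable)
  have "(\<lambda>x::real ^ 'n. (\<chi> a. \<lfloor>2 powi i * x $ a\<rfloor>) :: int ^ 'n) -` {k} = dyadic_cube i k" for k
    by (auto simp: dyadic_cube_unique_index)
  then show "(\<lambda>x::real ^ 'n. (\<chi> a. \<lfloor>2 powi i * x $ a\<rfloor>) :: int ^ 'n) \<in> space borel \<rightarrow> UNIV \<and>
    (\<forall>k\<in>UNIV. (\<lambda>x::real ^ 'n. (\<chi> a. \<lfloor>2 powi i * x $ a\<rfloor>) :: int ^ 'n) -` {k} \<inter> space borel \<in> sets borel)"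
    by simp
qed

text \<open>The substitution \<open>Z = 2 ^ j *\<^sub>R x\<close> reduces the estimate to \<open>bandlimited_bound\<close>, with cubes of
  side at least one.\<close>

lemma B_sup_bound:
  fixes p s0 \<sigma> :: "real ^ 'n \<Rightarrow> real" and \<phi> :: "real ^ 'n \<Rightarrow> real \<Rightarrow> real"
  assumes ker: "\<exists>\<eta> :: real ^ 'n \<Rightarrow> complex. reproducing_kernel \<eta>"
    and l: "0 < pm" "\<And>x. pm \<le> p x" and e: "\<And>x. s0 x - real CARD('n) / p x = \<sigma> x" and \<sigma>: "\<sigma> \<in> Clog_loc"
    and pmeas: "p \<in> borel_measurable borel" and \<phi>: "\<phi> \<in> growth_class"
  shows "\<exists>C\<ge>1. \<forall>f h i j N. f \<in> tempered_distributions \<longrightarrow> h \<in> schwartz \<longrightarrow> (\<forall>\<xi>. norm \<xi> > 2 \<longrightarrow> fourier h \<xi> = 0) \<longrightarrow>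
    0 < N \<longrightarrow> i \<le> int j \<longrightarrow>
    (\<forall>k. modular (\<lambda>x. ennreal (p x)) (\<lambda>x. 2 powr (real j * s0 x) * scaled_conv_norm f h j x * indicator (dyadic_cube i k) x / (on_cube \<phi> (dyadic_cube i k) * N)) \<le> 1) \<longrightarrow>
    (\<forall>k. \<forall>x\<in>dyadic_cube i k. 2 powr (real j * \<sigma> x) * scaled_conv_norm f h j x \<le> C * (on_cube \<phi> (dyadic_cube i k) * N))"
proof -
  obtain \<eta> :: "real ^ 'n \<Rightarrow> complex" where \<eta>: "reproducing_kernel \<eta>" using ker by blast
  let ?n = "CARD('n)"
  obtain E1 m1 where E1: "E1 > 0" "\<And>(j::nat) x y. 2 powr (real j * (\<sigma> y - \<sigma> x)) \<le> E1 * (1 + 2 ^ j * norm (x - y)) ^ m1"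
    using Clog_loc_shift[OF \<sigma>] by blast
  obtain E2 m2 where E2: "E2 > 0" "\<And>i k k' x y. x \<in> dyadic_cube i k \<Longrightarrow> y \<in> dyadic_cube i k' \<Longrightarrow>
    on_cube \<phi> (dyadic_cube i k') \<le> E2 * on_cube \<phi> (dyadic_cube i k) * (1 + 2 powi i * norm (x - y)) ^ m2"
    using growth_class_cubes[OF \<phi>] by blast
  have \<phi>0: "0 < on_cube \<phi> P" for P
    using \<phi> by (auto simp: growth_class_def on_cube_def cube_side_def)
  \<comment> \<open>Small enough for the absorption, which needs \<open>r \<le> 1\<close>, and for
    the comparison with the variable exponent, which needs \<open>r \<le> p x\<close>.\<close>
  define r where "r = min 1 pm"
  have r: "0 < r" "r \<le> 1" "\<And>x. r \<le> p x" unfolding r_def using l by (auto intro: min.coboundedI2)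
  have [measurable]: "\<sigma> \<in> borel_measurable borel"
    by (intro borel_measurable_continuous_onI Clog_loc_continuous \<sigma>)
  note [measurable] = pmeas
  have E12: "E1 * E2 > 0" using E1(1) E2(1) by simp
  from bandlimited_bound[OF \<eta> r(1,2) E12, of "m1 + m2"]
  obtain C where C: "C > 0" and C0: "\<forall>d G V p. reproduced \<eta> G \<longrightarrow> poly_growth G \<longrightarrow>
    slowly_varying (E1 * E2) (m1 + m2) V \<longrightarrow> local_modular_le_1 d G V p \<longrightarrow> (\<forall>X. r \<le> p X) \<longrightarrow> (\<forall>X. norm (G X) \<le> C * V X)"
    by (elim exE conjE)
  have main: "2 powr (real j * \<sigma> x) * scaled_conv_norm f h j x \<le> C * (on_cube \<phi> (dyadic_cube i k) * N)"
    if f: "f \<in> tempered_distributions" and h: "h \<in> schwartz" and supp: "\<And>\<xi>. norm \<xi> > 2 \<Longrightarrow> fourier h \<xi> = 0"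
      and N: "0 < N" and ij: "i \<le> int j" and mod: "\<And>k. modular (\<lambda>x. ennreal (p x)) (\<lambda>x. 2 powr (real j * s0 x) * scaled_conv_norm f h j x * indicator (dyadic_cube i k) x / (on_cube \<phi> (dyadic_cube i k) * N)) \<le> 1" and xk: "x \<in> dyadic_cube i k"
    for f h i j N k and x :: "real ^ 'n"
  proof -
    let ?s = "2 ^ j :: real" and ?t = "1 / 2 ^ j :: real"
    define G where "G X = f (\<lambda>y. h (X + (- ?s) *\<^sub>R y))" for X
    define idx where "idx x = ((\<chi> a. \<lfloor>2 powi i * x $ a\<rfloor>) :: int ^ 'n)" for x :: "real ^ 'n"
    \<comment> \<open>The normaliser of whichever cube of level \<open>i\<close> contains
      \<open>x\<close>: it merges the separate hypotheses on the cubes into conditions on one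
      function.\<close>
    define W where "W x = on_cube \<phi> (dyadic_cube i (idx x)) * N" for x
    \<comment> \<open>Solved from the goal: at \<open>X = ?s *\<^sub>R x\<close> the bound
      \<open>norm (G X) \<le> C * V X\<close> is the claimed estimate at \<open>x\<close>.\<close>
    define V where "V X = 2 powr (- (real j * \<sigma> (?t *\<^sub>R X))) * (1 / ?s ^ ?n) * W (?t *\<^sub>R X)" for X
    define d where "d = nat (int j - i)"
    have idx: "x \<in> dyadic_cube i k \<longleftrightarrow> k = idx x" for x k unfolding idx_def by (rule dyadic_cube_unique_index)
    have s: "?s \<noteq> 0" "?s > 0" by simp_all
    have dyad: "X \<in> dyadic_cube (- int d) k \<longleftrightarrow> ?t *\<^sub>R X \<in> dyadic_cube i k" for X :: "real ^ 'n" and k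
    proof -
      have "2 powi (- int d) = (2 powi i * ?t :: real)"
        unfolding d_def using ij by (simp add: power_int_diff)
      then show ?thesis unfolding dyadic_cube_unique_index by (simp add: mult.assoc)
    qed
    have W0: "W x > 0" for x unfolding W_def using \<phi>0 N by simp
    have V0: "V X > 0" for X unfolding V_def using W0 by simp
    have Gc: "continuous_on UNIV G" unfolding G_def using tempered_conv_continuous[OF f h, of "- ?s"] by simp
    then have Gm[measurable]: "G \<in> borel_measurable borel" by (rule borel_measurable_continuous_onI)
    have Grep: "(\<integral>w. \<eta> w * G (X - w) \<partial>lborel) = G X" for X
      unfolding G_def by (rule tempered_conv_reproducing[OF \<eta> f h _ supp]) auto
    have Gp: "poly_growth G"
      unfolding G_def poly_growth_def using tempered_conv_bound[OF f h, of "- ?s"] by (subst ex_comm) simp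
    have Gf: "scaled_conv_norm f h j x = ?s ^ ?n * norm (G (?s *\<^sub>R x))" for x
      unfolding scaled_conv_norm_def G_def by (simp add: power_mult)
    have Wm[measurable]: "W \<in> borel_measurable borel"
      unfolding W_def idx_def
      by (rule measurable_compose[OF index_measurable, of "\<lambda>k. on_cube \<phi> (dyadic_cube i k) * N"]) simp
    have Vm: "V \<in> borel_measurable borel" unfolding V_def by measurable
    have VE: "V Y \<le> E1 * E2 * V X * (1 + norm (X - Y)) ^ (m1 + m2)" for X Y
    proof -
      let ?x = "?t *\<^sub>R X" and ?y = "?t *\<^sub>R Y"
      have n: "?s * norm (?x - ?y) = norm (X - Y)" by (simp add: scaleR_diff_right[symmetric])
      have a: "2 powr (- (real j * \<sigma> ?y)) \<le> 2 powr (- (real j * \<sigma> ?x)) * (E1 * (1 + norm (X - Y)) ^ m1)"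
      proof -
        have "2 powr (- (real j * \<sigma> ?y)) = 2 powr (- (real j * \<sigma> ?x)) * 2 powr (real j * (\<sigma> ?x - \<sigma> ?y))"
          by (simp add: powr_add[symmetric] algebra_simps)
        also have "2 powr (real j * (\<sigma> ?x - \<sigma> ?y)) \<le> E1 * (1 + norm (X - Y)) ^ m1"
          using E1(2)[of j ?x ?y] n by (simp add: norm_minus_commute)
        finally show ?thesis by simp
      qed
      \<comment> \<open>A distance counted in large cubes is at most the distance counted in units
        of \<open>2 ^ (- j)\<close>, so the variation of \<open>\<phi>\<close> fits the weight in
        \<open>X - Y\<close>.\<close>
      have "2 powi i \<le> (2::real) powi int j" using ij by (intro power_int_increasing) auto
      then have pi: "2 powi i * norm (?x - ?y) \<le> norm (X - Y)" unfolding n[symmetric]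
        by (intro mult_right_mono) (auto simp: power_int_def)
      have "on_cube \<phi> (dyadic_cube i (idx ?y)) \<le> E2 * on_cube \<phi> (dyadic_cube i (idx ?x)) * (1 + 2 powi i * norm (?x - ?y)) ^ m2"
        by (rule E2(2)) (simp_all add: idx)
      also have "\<dots> \<le> E2 * on_cube \<phi> (dyadic_cube i (idx ?x)) * (1 + norm (X - Y)) ^ m2"
        using E2(1) \<phi>0 pi by (intro mult_left_mono power_mono add_left_mono) (auto intro!: mult_nonneg_nonneg less_imp_le)
      finally have b: "W ?y \<le> E2 * W ?x * (1 + norm (X - Y)) ^ m2"
        unfolding W_def using N by (simp add: mult_right_mono mult_ac)
      have "V Y \<le> (2 powr (- (real j * \<sigma> ?x)) * (E1 * (1 + norm (X - Y)) ^ m1)) * (1 / ?s ^ ?n) * (E2 * W ?x * (1 + norm (X - Y)) ^ m2)"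
        unfolding V_def using a b W0[of ?y] E1(1) by (intro mult_mono) (auto intro: less_imp_le)
      also have "\<dots> = E1 * E2 * V X * (1 + norm (X - Y)) ^ (m1 + m2)"
        unfolding V_def by (simp add: power_add mult_ac)
      finally show ?thesis .
    qed
    have I: "(\<integral>\<^sup>+z. ennreal ((norm (G z) / V z) powr p (?t *\<^sub>R z)) * indicator (dyadic_cube (- int d) k) z \<partial>lborel) \<le> 1" for k
    proof -
      let ?P = "dyadic_cube i k :: (real ^ 'n) set"
      note [measurable] = Vm
      have [measurable]: "(\<lambda>z::real ^ 'n. p (?t *\<^sub>R z)) \<in> borel_measurable borel" by measurable
      have "(\<integral>\<^sup>+z. ennreal ((norm (G z) / V z) powr p (?t *\<^sub>R z)) * indicator (dyadic_cube (- int d) k) z \<partial>lborel)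
        = ennreal (?s ^ ?n) * (\<integral>\<^sup>+y. ennreal ((norm (G (?s *\<^sub>R y)) / V (?s *\<^sub>R y)) powr p (?t *\<^sub>R (?s *\<^sub>R y))) * indicator (dyadic_cube (- int d) k) (?s *\<^sub>R y) \<partial>lborel)"
        by (subst lborel_nn_integral_affine[OF _ s(1), of _ 0]) simp_all
      also have "\<dots> = (\<integral>\<^sup>+y. ennreal (?s ^ ?n) * (ennreal ((norm (G (?s *\<^sub>R y)) / V (?s *\<^sub>R y)) powr p (?t *\<^sub>R (?s *\<^sub>R y))) * indicator (dyadic_cube (- int d) k) (?s *\<^sub>R y)) \<partial>lborel)"
        by (rule nn_integral_cmult[symmetric]) measurable
      also have "\<dots> \<le> modular (\<lambda>x. ennreal (p x)) (\<lambda>x. 2 powr (real j * s0 x) * scaled_conv_norm f h j x * indicator ?P x / (on_cube \<phi> ?P * N))"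
        unfolding modular_def nn_integral_completion
      proof (intro nn_integral_mono)
        fix y :: "real ^ 'n"
        show "ennreal (?s ^ ?n) * (ennreal ((norm (G (?s *\<^sub>R y)) / V (?s *\<^sub>R y)) powr p (?t *\<^sub>R (?s *\<^sub>R y))) * indicator (dyadic_cube (- int d) k) (?s *\<^sub>R y))
          \<le> rho (ennreal (p y)) \<bar>2 powr (real j * s0 y) * scaled_conv_norm f h j y * indicator ?P y / (on_cube \<phi> ?P * N)\<bar>"
        proof (cases "y \<in> ?P")
          case True
          have ty: "?t *\<^sub>R (?s *\<^sub>R y) = y" by simp
          have py: "0 < p y" using l order_less_le_trans by blast
          have Wy: "W y = on_cube \<phi> ?P * N" using True unfolding W_def idx by simp
          define v where "v = norm (G (?s *\<^sub>R y)) / V (?s *\<^sub>R y)"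
          have v0: "0 \<le> v" unfolding v_def using V0[of "?s *\<^sub>R y"] by simp
          have sy: "s0 y = \<sigma> y + ?n / p y" using e[of y] by simp
          \<comment> \<open>The gap \<open>?n / p y\<close> between \<open>s0\<close> and
            \<open>\<sigma>\<close>, after the power \<open>p y\<close>, is exactly the Jacobian
            \<open>?s ^ ?n\<close> of the dilation.\<close>
          have "2 powr (real j * s0 y) * (?s ^ ?n * norm (G (?s *\<^sub>R y))) / W y = v * 2 powr (real j * ?n / p y)"
            unfolding v_def V_def ty sy
            by (simp add: distrib_left powr_add powr_minus field_simps)
          then have eq: "\<bar>2 powr (real j * s0 y) * (?s ^ ?n * norm (G (?s *\<^sub>R y))) * indicator ?P y / W y\<bar> = v * 2 powr (real j * ?n / p y)"
            using True v0 by simp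
          have "(v * 2 powr (real j * ?n / p y)) powr p y = v powr p y * 2 powr (real j * ?n)"
            using v0 py by (simp add: powr_mult powr_powr)
          also have "2 powr (real j * ?n) = ?s ^ ?n"
            by (simp add: powr_powr[symmetric] powr_realpow)
          finally have "rho (ennreal (p y)) (v * 2 powr (real j * ?n / p y)) = ennreal (?s ^ ?n) * ennreal (v powr p y)"
            using py by (simp add: rho_def ennreal_mult mult.commute)
          then show ?thesis
            using True dyad[of "?s *\<^sub>R y" k] eq unfolding Gf Wy[symmetric] ty v_def[symmetric] by simp
        next
          case False
          then show ?thesis using dyad[of "?s *\<^sub>R y" k] by simp
        qed
      qed
      also have "\<dots> \<le> 1" by (rule mod)
      finally show ?thesis .
    qed
    have "\<forall>X. norm (G X) \<le> C * V X"
    proof -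
      have "reproduced \<eta> G" using Gm Grep by (simp add: reproduced_def)
      moreover have "slowly_varying (E1 * E2) (m1 + m2) V"
        using Vm V0 VE by (simp add: slowly_varying_def)
      moreover have "local_modular_le_1 d G V (\<lambda>z. p (?t *\<^sub>R z))"
        unfolding local_modular_le_1_def using I by (intro conjI allI) measurable
      ultimately show ?thesis using C0 Gp r(3) by blast
    qed
    then have "norm (G (?s *\<^sub>R x)) \<le> C * V (?s *\<^sub>R x)" by blast
    then have "(2 powr (real j * \<sigma> x) * ?s ^ ?n) * norm (G (?s *\<^sub>R x)) \<le> (2 powr (real j * \<sigma> x) * ?s ^ ?n) * (C * V (?s *\<^sub>R x))"
      by (intro mult_left_mono) auto
    also have "\<dots> = C * W x"
      unfolding V_def by (simp add: powr_minus)
    also have "W x = on_cube \<phi> (dyadic_cube i k) * N" using xk unfolding W_def idx by simp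
    finally show ?thesis unfolding Gf by (simp add: mult.assoc)
  qed
  have "max C 1 * (on_cube \<phi> P * N) \<ge> C * (on_cube \<phi> P * N)" if "N > 0" for P N
    using \<phi>0[of P] that by (intro mult_right_mono) auto
  then show ?thesis
    by (intro exI[of _ "max C 1"] conjI allI impI ballI) (simp, rule order_trans[OF main], auto)
qed

section \<open>Assembly of the two embeddings\<close>

lemma embedsI:
  assumes "\<And>f. f \<in> X \<Longrightarrow> f \<in> Z \<and> norm_X f < \<infinity>" "\<And>f. f \<in> Z \<Longrightarrow> norm_Y f < \<infinity> \<Longrightarrow> f \<in> Y"
    and "0 < C" "\<And>f. f \<in> X \<Longrightarrow> norm_Y f \<le> ennreal C * norm_X f"
  shows "embeds X norm_X Y norm_Y"
  unfolding embeds_def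
proof (intro conjI exI[of _ C] subsetI ballI)
  fix f assume f: "f \<in> X"
  have "norm_Y f \<le> ennreal C * norm_X f" by (rule assms(4)[OF f])
  also have "\<dots> < \<infinity>" using assms(1)[OF f] by (simp add: ennreal_mult_less_top)
  finally show "f \<in> Y" using assms(1,2) f by blast
qed (use assms in auto)

lemma norm_conv_dilate:
  fixes \<psi> \<Psi> :: "real ^ 'n \<Rightarrow> complex"
  assumes f: "f \<in> tempered_distributions" and h: "(if j = 0 then \<Psi> else \<psi>) \<in> schwartz"
  shows "norm (conv (dilate \<psi> \<Psi> j) f x) =
    scaled_conv_norm f (if j = 0 then \<Psi> else \<psi>) j x"
proof -
  let ?h = "if j = 0 then \<Psi> else \<psi>"
  let ?k = "\<lambda>y. ?h (2 ^ j *\<^sub>R x + (- (2 ^ j)) *\<^sub>R y)"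
  have k: "?k \<in> schwartz" using schwartz_affine[OF h, of "- (2 ^ j)" "2 ^ j *\<^sub>R x"] by simp
  have "(\<lambda>y. dilate \<psi> \<Psi> j (x - y)) = (\<lambda>y. of_real (2 ^ (j * CARD('n))) * ?k y + 0 * ?k y)"
    by (auto simp: dilate_def scaleR_diff_right)
  then have "conv (dilate \<psi> \<Psi> j) f x = of_real (2 ^ (j * CARD('n))) * f ?k"
    unfolding conv_def by (simp only: tempered_lincomb[OF f k k]) simp
  then show ?thesis unfolding scaled_conv_norm_def by (simp only: norm_mult norm_of_real) simp
qed

lemma enn2real_inverse_ennreal: "0 < r \<Longrightarrow> enn2real (1 / ennreal r) = 1 / r"
  using divide_ennreal[of 1 r] by simp

theorem proposition4p2:
  fixes \<phi> :: "real ^ 'n \<Rightarrow> real \<Rightarrow> real"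
    and s0 s1 :: "real ^ 'n \<Rightarrow> real"
    and p0 p1 :: "real ^ 'n \<Rightarrow> ennreal"
    and \<psi> \<Psi> :: "real ^ 'n \<Rightarrow> complex"
  assumes "admissible \<psi> \<Psi>"
    and "\<phi> \<in> growth_class"
    and "s0 \<in> Clog_loc \<inter> Linfty" and "s1 \<in> Clog_loc \<inter> Linfty"
    and "p0 \<in> Clog_exponents" and "p1 \<in> Clog_exponents"
    and "\<And>x. s1 x \<le> s0 x"
    and "\<And>x. s0 x - real CARD('n) * enn2real (1 / p0 x) = s1 x - real CARD('n) * enn2real (1 / p1 x)"
  shows "embeds (b_space s0 \<phi> p0) (b_norm s0 \<phi> p0) (b_space s1 \<phi> p1) (b_norm s1 \<phi> p1) \<and>
         embeds (B_space \<psi> \<Psi> s0 \<phi> p0) (B_norm \<psi> \<Psi> s0 \<phi> p0) (B_space \<psi> \<Psi> s1 \<phi> p1) (B_norm \<psi> \<Psi> s1 \<phi> p1)"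
proof (cases "\<forall>x. p0 x = \<infinity>")
  case True
  \<comment> \<open>With \<open>p0\<close> infinite the relation reads
    \<open>s0 = s1 - n / p1\<close>, and \<open>s1 \<le> s0\<close> leaves no room for a positive
    last term. The two spaces coincide.\<close>
  have p1: "p1 x = \<infinity> \<and> s0 x = s1 x" for x
  proof -
    have e: "s0 x = s1 x - real CARD('n) * enn2real (1 / p1 x)"
      using assms(8)[of x] True by (simp add: ennreal_divide_top)
    have "p1 x = \<infinity>"
    proof (rule ccontr)
      assume "p1 x \<noteq> \<infinity>"
      then obtain r where r: "p1 x = ennreal r" "0 \<le> r" by (cases "p1 x") auto
      have "0 < p1 x" using assms(6) by (simp add: Clog_exponents_def var_exponents_def)
      then have "0 < r" using r by simp
      then have "0 < real CARD('n) * enn2real (1 / p1 x)" unfolding r(1) by (simp add: enn2real_inverse_ennreal)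
      then show False using e assms(7)[of x] by linarith
    qed
    then show ?thesis using e by (simp add: ennreal_divide_top)
  qed
  have "p1 = p0" "s1 = s0" using p1 True by auto
  then show ?thesis unfolding embeds_def by (auto intro!: exI[of _ 1])
next
  case False
  let ?n = "real CARD('n)"
  define p where "p x = enn2real (p0 x)" for x
  have fin: "p0 x < \<infinity>" for x using assms(5) False by (auto simp: Clog_exponents_def)
  then have p: "p0 = (\<lambda>x. ennreal (p x))" unfolding p_def by simp
  have pC: "p \<in> Clog_loc"
    using assms(5) False by (auto simp: Clog_exponents_def Clog_def p_def[abs_def])
  have cont: "continuous_on UNIV p" by (rule Clog_loc_continuous[OF pC])
  have pm: "p \<in> borel_measurable borel" using cont by (rule borel_measurable_continuous_onI)
  obtain l where l: "0 < l" "\<And>x. l \<le> p x"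
    using var_exponent_lower_bound[of p0] assms(5) fin cont unfolding p_def[abs_def] Clog_exponents_def by blast
  have p0: "0 < p x" for x using l order_less_le_trans by blast
  have p1: "0 < p1 x" for x using assms(6) by (simp add: Clog_exponents_def var_exponents_def)
  \<comment> \<open>Defined from the source side, where the exponent is finite and bounded below.
    The target side yields the same function by hypothesis, even if \<open>p1\<close> is
    infinite.\<close>
  define \<sigma> where "\<sigma> x = s0 x - ?n * (1 / p x)" for x
  have \<sigma>: "\<sigma> \<in> Clog_loc"
    unfolding \<sigma>_def[abs_def] using assms(3) pC l by (intro Clog_loc_add_inverse[where l = l]) auto
  have e0: "s0 x - ?n / p x = \<sigma> x" for x unfolding \<sigma>_def by simp
  have e1: "s1 x - ?n * enn2real (1 / p1 x) = \<sigma> x" for x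
    using assms(8)[of x] p0 unfolding p \<sigma>_def by (simp add: enn2real_inverse_ennreal)
  have n: "?n > 0" by simp
  have \<phi>0: "0 < on_cube \<phi> P" for P
    using assms(2) by (auto simp: growth_class_def on_cube_def cube_side_def)
  note step = Lp_norm_step[OF p0 p1 n e0 e1 assms(7)]
  show ?thesis
  proof
    obtain C where C: "1 \<le> C" and sup: "\<And>P j (t :: (real ^ 'n) set \<Rightarrow> complex) l x. 0 < l \<Longrightarrow>
      modular (\<lambda>x. ennreal (p x)) (\<lambda>x. 2 powr (real j * s0 x) * level_sum t P j x * indicator P x / l) \<le> 1 \<Longrightarrow>
      2 powr (real j * \<sigma> x) * level_sum t P j x \<le> C * l"
      using b_sup_bound[OF l e0 \<sigma>] by (elim exE conjE) simp
    have "b_norm s1 \<phi> p1 t \<le> ennreal C * b_norm s0 \<phi> p0 t" if "b_norm s0 \<phi> p0 t < \<infinity>" for t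
      unfolding b_norm_def
    proof (rule norm_embedding[OF \<phi>0])
      fix i j N k
      let ?P = "\<lambda>k. dyadic_cube i k :: (real ^ 'n) set"
      assume N: "0 < N" and "i \<le> int j"
        and mod: "\<And>k. modular p0 (\<lambda>x. (\<Sum>Q\<in>{Q \<in> small_dyadic_cubes. Q \<subseteq> ?P k \<and> cube_side Q = 2 powi (- int j)}.
          measure lebesgue Q powr (- s0 x / ?n) * norm (t Q) * normalized_indicator Q x) * indicator (?P k) x / (on_cube \<phi> (?P k) * N)) \<le> 1"
      have N': "0 < on_cube \<phi> (?P k) * N" using N \<phi>0 by simp
      note m = mod[of k, unfolded sum_normalized_indicator p]
      show "Lp_norm p1 (?P k) (\<lambda>x. \<Sum>Q\<in>{Q \<in> small_dyadic_cubes. Q \<subseteq> ?P k \<and> cube_side Q = 2 powi (- int j)}.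
        measure lebesgue Q powr (- s1 x / ?n) * norm (t Q) * normalized_indicator Q x) \<le> ennreal (C * (on_cube \<phi> (?P k) * N))"
        unfolding sum_normalized_indicator
        by (rule step[OF _ N' C sup[OF N' m] m]) (simp add: level_sum_def sum_nonneg normalized_indicator_def)
    qed (use C that in \<open>simp_all add: b_norm_def\<close>)
    then show "embeds (b_space s0 \<phi> p0) (b_norm s0 \<phi> p0) (b_space s1 \<phi> p1) (b_norm s1 \<phi> p1)"
      using C by (intro embedsI[where Z = "extensional small_dyadic_cubes" and C = C]) (auto simp: b_space_def)
  next
    have h: "(if j = 0 then \<Psi> else \<psi>) \<in> schwartz" for j :: nat
      using assms(1) by (simp add: admissible_def)
    have "supp (fourier (if j = 0 then \<Psi> else \<psi>)) \<subseteq> {\<xi>. norm \<xi> \<le> 2}" for j :: nat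
      using assms(1) unfolding admissible_def by auto
    then have supp: "\<forall>\<xi>. norm \<xi> > 2 \<longrightarrow> fourier (if j = 0 then \<Psi> else \<psi>) \<xi> = 0" for j :: nat
      using fourier_zero_if_supp by blast
    from B_sup_bound[OF reproducing_kernel_exists[OF assms(1)] l e0 \<sigma> pm assms(2)]
    obtain C where C: "1 \<le> C" and sup: "\<forall>f h i j N. f \<in> tempered_distributions \<longrightarrow> h \<in> schwartz \<longrightarrow> (\<forall>\<xi>. norm \<xi> > 2 \<longrightarrow> fourier h \<xi> = 0) \<longrightarrow>
      0 < N \<longrightarrow> i \<le> int j \<longrightarrow>
      (\<forall>k. modular (\<lambda>x. ennreal (p x)) (\<lambda>x. 2 powr (real j * s0 x) * scaled_conv_norm f h j x * indicator (dyadic_cube i k) x / (on_cube \<phi> (dyadic_cube i k) * N)) \<le> 1) \<longrightarrow>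
      (\<forall>k. \<forall>x\<in>dyadic_cube i k. 2 powr (real j * \<sigma> x) * scaled_conv_norm f h j x \<le> C * (on_cube \<phi> (dyadic_cube i k) * N))"
      by (elim exE conjE)
    have "B_norm \<psi> \<Psi> s1 \<phi> p1 f \<le> ennreal C * B_norm \<psi> \<Psi> s0 \<phi> p0 f"
      if f: "f \<in> tempered_distributions" and "B_norm \<psi> \<Psi> s0 \<phi> p0 f < \<infinity>" for f
      unfolding B_norm_def
    proof (rule norm_embedding[OF \<phi>0])
      fix i j N k
      let ?P = "\<lambda>k. dyadic_cube i k :: (real ^ 'n) set"
      assume N: "0 < N" and ij: "i \<le> int j"
        and mod: "\<And>k. modular p0 (\<lambda>x. 2 powr (real j * s0 x) * norm (conv (dilate \<psi> \<Psi> j) f x) * indicator (?P k) x / (on_cube \<phi> (?P k) * N)) \<le> 1"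
      have N': "0 < on_cube \<phi> (?P k) * N" using N \<phi>0 by simp
      note m = mod[unfolded p]
      have s: "2 powr (real j * \<sigma> x) * norm (conv (dilate \<psi> \<Psi> j) f x) \<le> C * (on_cube \<phi> (?P k) * N)" if "x \<in> ?P k" for x
        using sup[THEN spec[of _ f], THEN spec[of _ "if j = 0 then \<Psi> else \<psi>"], THEN spec[of _ i], THEN spec[of _ j], THEN spec[of _ N]]
          f h supp N ij m that unfolding norm_conv_dilate[OF f h] by blast
      show "Lp_norm p1 (?P k) (\<lambda>x. 2 powr (real j * s1 x) * norm (conv (dilate \<psi> \<Psi> j) f x)) \<le> ennreal (C * (on_cube \<phi> (?P k) * N))"
        by (rule step[OF _ N' C s m]) auto
    qed (use C that in \<open>simp_all add: B_norm_def\<close>)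
    then show "embeds (B_space \<psi> \<Psi> s0 \<phi> p0) (B_norm \<psi> \<Psi> s0 \<phi> p0) (B_space \<psi> \<Psi> s1 \<phi> p1) (B_norm \<psi> \<Psi> s1 \<phi> p1)"
      using C by (intro embedsI[where Z = tempered_distributions and C = C]) (auto simp: B_space_def)
  qed
qed

end
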